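(* Let $d\geq 3$ and let $\mu$ be a Borel probability measure on $\mathbb{T}^d$. Suppose that, for some $\epsilon>0$, there is a finite constant $C$ such that $$|\widehat{\mu}_k| \le C |k|^{-(d-2+\epsilon)}\quad\text{for all } k\in\mathbb{Z}^d\setminus\{0\}.$$ Then the observability inequality and the trace inequality hold for $\mu$.
   Context: $\mathbb{T}^d=\mathbb{R}^d/\mathbb{Z}^d$ with Lebesgue measure $dx$. $\sqrt{\mathbb{N}}=\{\sqrt n : n\in\mathbb{N}\}$. For $\lambda\in\sqrt{\mathbb{N}}$, $\mathcal{S}^{d-1}_\lambda=\{k\in\mathbb{Z}^d : |k|=\lambda\}$ and $E_\lambda=\{\sum_{k\in\mathcal{S}^{d-1}_\lambda} \widehat{u}_k e^{2\pi i k\cdot x} : \widehat{u}_k\in\mathbb{C}\}$ (the Laplace eigenspace with eigenvalue $-4\pi^2\lambda^2$). The trace inequality holds for $\mu$ if there is a finite constant $\mathfrak{C}$ such that $\int_{\mathbb{T}^d}|u|^2\,d\mu\le \mathfrak{C}\int_{\mathbb{T}^d}|u|^2\,dx$ for all $u\in\bigcup_{\lambda\in\sqrt{\mathbb{N}}}E_\lambda$. The observability inequality holds for $\mu$ if there is a finite constant $\mathfrak{c}$ such that $\int_{\mathbb{T}^d}|u|^2\,dx\le \mathfrak{c}\int_{\mathbb{T}^d}|u|^2\,d\mu$ for all $u\in\bigcup_{\lambda\in\sqrt{\mathbb{N}}}E_\lambda$. Fourier coefficients: $\widehat{\mu}_k=\int_{\mathbb{T}^d}e^{-2\pi i k\cdot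 x}\,d\mu(x)$, $k\in\mathbb{Z}^d$. *)

theory Defs
  imports "HOL-Probability.Probability"
begin

definition int_vec :: "int ^ 'n \<Rightarrow> real ^ 'n" where
  "int_vec k = (\<chi> i. real_of_int (k $ i))"

definition lattice_equiv :: "real ^ 'n \<Rightarrow> real ^ 'n \<Rightarrow> bool" where
  "lattice_equiv x y \<longleftrightarrow> (\<exists>m. x - y = int_vec m)"

lemma int_vec_0: "int_vec 0 = 0"
  by (simp add: int_vec_def vec_eq_iff)

lemma int_vec_uminus: "int_vec (- k) = - int_vec k"
  by (simp add: int_vec_def vec_eq_iff)

lemma int_vec_add: "int_vec (k + l) = int_vec k + int_vec l"
  by (simp add: int_vec_def vec_eq_iff)

lemma equivp_lattice_equiv: "equivp lattice_equiv"
proof (rule equivpI)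
  show "reflp lattice_equiv"
    unfolding reflp_def lattice_equiv_def by (metis diff_self int_vec_0)
  show "symp lattice_equiv"
    unfolding symp_def lattice_equiv_def by (metis minus_diff_eq int_vec_uminus)
  show "transp lattice_equiv"
    unfolding transp_def lattice_equiv_def by (metis diff_add_cancel add_diff_eq int_vec_add)
qed

text \<open>The torus \<open>\<real>\<^sup>d / \<int>\<^sup>d\<close>, where \<open>d = CARD('n)\<close>.\<close>

quotient_type (overloaded) 'n torus = "real ^ ('n::finite)" / lattice_equiv
  morphisms torus_rep torus_proj
  by (rule equivp_lattice_equiv)

text \<open>The quotient topology; it determines the Borel sets of the torus.\<close>

instantiation torus :: (finite) topological_space
begin

definition open_torus :: "'a torus set \<Rightarrow> bool" where
  "open_torus U \<longleftrightarrow> open (torus_proj -` U)"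

instance
proof
  show "open (UNIV :: 'a torus set)"
    by (simp add: open_torus_def)
  show "open (S \<inter> T)" if "open S" "open T" for S T :: "'a torus set"
    using that by (auto simp: open_torus_def)
  show "open (\<Union>K)" if "\<forall>S\<in>K. open S" for K :: "'a torus set set"
    using that by (auto simp: open_torus_def vimage_Union)
qed

end

lemma continuous_on_torus_proj: "continuous_on UNIV torus_proj"
  by (simp add: continuous_on_open_vimage open_torus_def)

lemma torus_proj_measurable [measurable]: "torus_proj \<in> borel_measurable borel"
  by (rule borel_measurable_continuous_onI[OF continuous_on_torus_proj])

text \<open>Lebesgue measure on the torus, transported from the half-open unit cube, which
  contains exactly one representative of each class.\<close>

definition torus_lebesgue :: "('n::finite) torus measure" where
  "torus_lebesgue =
     distr (restrict_space lborel {x. \<forall>i. 0 \<le> x $ i \<and> x $ i < 1}) borel torus_proj"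

lift_definition torus_char :: "int ^ 'n \<Rightarrow> ('n::finite) torus \<Rightarrow> complex" is
  "\<lambda>k x. exp (2 * complex_of_real pi * \<i> * complex_of_real (int_vec k \<bullet> x))"
proof -
  fix k :: "int ^ 'n" and x y :: "real ^ 'n"
  assume "lattice_equiv x y"
  then obtain m where "x - y = int_vec m"
    by (auto simp: lattice_equiv_def)
  then have x: "x = y + int_vec m"
    by (simp add: algebra_simps)
  have "int_vec k \<bullet> int_vec m = real_of_int (\<Sum>i\<in>UNIV. k $ i * m $ i)"
    by (simp add: int_vec_def inner_vec_def)
  then obtain j where j: "int_vec k \<bullet> int_vec m = real_of_int j"
    by blast
  have "exp (2 * complex_of_real pi * \<i> * complex_of_real (real_of_int j)) = 1"
    using exp_integer_2pi[of "of_int j"] by (simp add: mult_ac)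
  then show "exp (2 * complex_of_real pi * \<i> * complex_of_real (int_vec k \<bullet> x))
           = exp (2 * complex_of_real pi * \<i> * complex_of_real (int_vec k \<bullet> y))"
    by (simp add: x inner_add_right j distrib_left exp_add)
qed

definition sqrt_nats :: "real set" where
  "sqrt_nats = range (\<lambda>n::nat. sqrt (real n))"

definition lattice_sphere :: "real \<Rightarrow> (int ^ 'n) set" where
  "lattice_sphere r = {k. norm (int_vec k) = r}"

lemma finite_lattice_sphere: "finite (lattice_sphere r :: (int ^ 'n) set)"
proof -
  have bound: "k $ i \<in> {-\<lceil>r\<rceil>..\<lceil>r\<rceil>}" if "k \<in> lattice_sphere r" for k :: "int ^ 'n" and i
  proof -
    have "\<bar>real_of_int (k $ i)\<bar> \<le> r"
      using that component_le_norm_cart[of "int_vec k" i]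
      by (simp add: lattice_sphere_def int_vec_def)
    then show ?thesis
      by (simp add: abs_le_iff) linarith
  qed
  have "finite (PiE (UNIV :: 'n set) (\<lambda>_. {-\<lceil>r\<rceil>..\<lceil>r\<rceil>}))"
    by (rule finite_PiE) auto
  moreover have "vec_nth ` (lattice_sphere r :: (int ^ 'n) set)
      \<subseteq> PiE UNIV (\<lambda>_. {-\<lceil>r\<rceil>..\<lceil>r\<rceil>})"
    using bound by (auto simp: PiE_def extensional_def)
  ultimately have "finite (vec_nth ` (lattice_sphere r :: (int ^ 'n) set))"
    by (rule rev_finite_subset)
  then show ?thesis
    by (rule finite_imageD) (simp add: inj_on_def vec_nth_inject)
qed

definition eigenspace :: "real \<Rightarrow> (('n::finite) torus \<Rightarrow> complex) set" where
  "eigenspace r = {u. \<exists>c. u = (\<lambda>x. \<Sum>k\<in>lattice_sphere r. c k * torus_char k x)}"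

definition trace_inequality :: "('n::finite) torus measure \<Rightarrow> bool" where
  "trace_inequality M \<longleftrightarrow>
     (\<exists>C::real. \<forall>u \<in> (\<Union>r\<in>sqrt_nats. eigenspace r).
        (\<integral>x. (cmod (u x))\<^sup>2 \<partial>M) \<le> C * (\<integral>x. (cmod (u x))\<^sup>2 \<partial>torus_lebesgue))"

definition observability_inequality :: "('n::finite) torus measure \<Rightarrow> bool" where
  "observability_inequality M \<longleftrightarrow>
     (\<exists>c::real. \<forall>u \<in> (\<Union>r\<in>sqrt_nats. eigenspace r).
        (\<integral>x. (cmod (u x))\<^sup>2 \<partial>torus_lebesgue) \<le> c * (\<integral>x. (cmod (u x))\<^sup>2 \<partial>M))"

definition fourier_coeff :: "('n::finite) torus measure \<Rightarrow> int ^ 'n \<Rightarrow> complex" where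
  "fourier_coeff M k = (\<integral>x. torus_char (- k) x \<partial>M)"

end

theory Submission
  imports Defs "HOL-Computational_Algebra.Primes" "HOL-Complex_Analysis.Cauchy_Integral_Theorem"
begin

text \<open>
  Write \<open>d\<close> for the dimension, \<open>e k\<close> for the characters and \<open>m k\<close> for the Fourier coefficients of the
  measure. For \<open>u = \<Sum>k. b k * e k\<close> the integral of \<open>|u|\<^sup>2\<close> against the measure is \<open>\<Sum>k. |b k|\<^sup>2\<close> plus the
  off-diagonal terms \<open>b k * cnj (b l) * m (l - k)\<close>, whereas the Lebesgue integral is the diagonal
  alone. Schur's test bounds the terms with \<open>|l - k| \<ge> \<rho>\<close> by \<open>\<Sum>k. |b k|\<^sup>2\<close> times the largest of the
  sums of \<open>|m (l - k)|\<close> over the lattice points \<open>l\<close> of the sphere with \<open>|l - k| \<ge> \<rho>\<close>.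

  These sums are finite, uniformly in the sphere, and tend to \<open>0\<close> as \<open>\<rho>\<close> grows
  (\<open>lattice_sphere_tail_sum\<close>), because a ball of radius \<open>R\<close> contains only \<open>O(R powr (d - 2 + \<delta>))\<close>
  lattice points of any sphere: once all but two coordinates are fixed, the other two lie on a
  piece of a circle. If the circle is large compared with \<open>R\<close>, its piece is too flat to contain
  three lattice points; otherwise its squared radius is polynomial in \<open>R\<close> and the divisor bound
  applies. With \<open>\<rho> = 1\<close> this is the trace inequality.

  For observability, induct on the dimension spanned by the differences of the frequencies
  (\<open>observes_of_small_dim\<close>). With \<open>\<rho>\<close> so large that the far terms cost at most half of the
  constant already obtained, the frequencies split into clusters at mutual distance at least
  \<open>\<rho>\<close>. By \<open>sphere_cluster_bound\<close> either every cluster spans fewer dimensions, and the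
  induction hypothesis treats each of them, or all frequencies lie within a distance \<open>D\<close> of one
  another that depends on \<open>\<rho>\<close> alone. Since translating the frequencies does not change the
  quadratic form, the second case concerns one finite set of frequencies, and compactness gives a
  constant as soon as the form is positive definite.

  Positive definiteness means that no nonzero trigonometric polynomial vanishes almost
  everywhere (\<open>trig_poly_zero_set_null\<close>). Up to a null set, its zero set is a countable union of sets on
  which some partial derivative of the polynomial is bounded away from \<open>0\<close>; such a set
  behaves like a hypersurface and meets \<open>O(N^(d-1))\<close> of the cells of a grid of mesh comparable to
  \<open>1/N\<close>. The decay of the Fourier coefficients makes the sum of the squared masses of all cells
  \<open>o(N^(1-d))\<close>, so by the Cauchy-Schwarz inequality the set is null.
\<close>

section \<open>Lattice points on circles\<close>

lemma card_le_fibres: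
  assumes "finite B" "f ` A \<subseteq> B" "\<And>y. y \<in> B \<Longrightarrow> card {x \<in> A. f x = y} \<le> m"
  shows "card A \<le> card B * m"
proof -
  have "A = (\<Union>y\<in>B. {x \<in> A. f x = y})"
    using assms(2) by auto
  then have "card A = card (\<Union>y\<in>B. {x \<in> A. f x = y})"
    by simp
  also have "\<dots> \<le> (\<Sum>y\<in>B. card {x \<in> A. f x = y})"
    by (rule card_UN_le[OF assms(1)])
  also have "\<dots> \<le> card B * m"
    using sum_bounded_above[of B "\<lambda>y. card {x \<in> A. f x = y}" m] assms(3) by simp
  finally show ?thesis .
qed

lemma card_divisors_prime_power_mult:
  fixes p m a :: nat
  assumes "prime p" "m > 0"
  shows "card {d. d dvd p ^ a * m} \<le> (a + 1) * card {d. d dvd m}"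
proof -
  have "{d. d dvd p ^ a * m} \<subseteq> (\<lambda>(i, d). p ^ i * d) ` ({..a} \<times> {d. d dvd m})"
  proof
    fix d assume "d \<in> {d. d dvd p ^ a * m}"
    then obtain x y where "d = x * y" "x dvd p ^ a" "y dvd m"
      using division_decomp by blast
    moreover from this obtain i where "i \<le> a" "x = p ^ i"
      using divides_primepow_nat[OF assms(1)] by blast
    ultimately show "d \<in> (\<lambda>(i, d). p ^ i * d) ` ({..a} \<times> {d. d dvd m})"
      by force
  qed
  then have "card {d. d dvd p ^ a * m} \<le> card ({..a} \<times> {d. d dvd m})"
    using assms(2) by (intro surj_card_le) auto
  then show ?thesis
    by (simp add: card_cartesian_product)
qed

text \<open>The quotient of the divisor count by \<open>n powr \<delta>\<close> is at most a product over the primes \<open>p\<close>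
  dividing \<open>n\<close> of factors \<open>(a + 1) / p powr (a * \<delta>)\<close>. For \<open>p \<ge> T\<close> such a factor is at most
  \<open>(a + 1) / 2 ^ a \<le> 1\<close>; for the fewer than \<open>T\<close> remaining primes it is bounded by \<open>B\<close>,
  whatever \<open>a\<close> is. Peeling off one prime at a time turns this into an induction.\<close>

lemma divisor_bound:
  fixes \<delta> :: real
  assumes "\<delta> > 0"
  obtains K where "K \<ge> 1"
    "\<And>n::nat. n > 0 \<Longrightarrow> real (card {d. d dvd n}) \<le> K * real n powr \<delta>"
proof -
  define T where "T = nat \<lceil>2 powr (1 / \<delta>)\<rceil>"
  define B where "B = max 1 (1 / (\<delta> * ln 2))"
  define P where "P n = {p. prime p \<and> p < T \<and> p dvd n}" for n :: nat
  have B1: "B \<ge> 1" by (simp add: B_def)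
  have large: "2 \<le> real p powr \<delta>" if "p \<ge> T" for p
  proof -
    have "2 powr (1 / \<delta>) \<le> real p"
      using that unfolding T_def by linarith
    then have "(2 powr (1 / \<delta>)) powr \<delta> \<le> real p powr \<delta>"
      using assms by (intro powr_mono2) auto
    then show ?thesis using assms by (simp add: powr_powr)
  qed
  have small: "real (a + 1) \<le> B * (real p powr \<delta>) ^ a" if "p \<ge> 2" for a p :: nat
  proof -
    have "\<delta> * ln 2 > 0" using assms by simp
    then have B2: "B * (\<delta> * ln 2) \<ge> 1"
      by (smt (verit) B_def max.cobounded2 mult_right_mono nonzero_divide_eq_eq)
    have "B * (1 + real a * (\<delta> * ln 2)) \<ge> 1 + real a"
      using B1 mult_left_mono[OF B2, of "real a"] by (simp add: algebra_simps)
    also have "1 + real a * (\<delta> * ln 2) \<le> exp (real a * (\<delta> * ln 2))"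
      by simp
    also have "\<dots> = (2 powr \<delta>) ^ a"
      by (simp add: powr_def exp_of_nat_mult)
    also have "\<dots> \<le> (real p powr \<delta>) ^ a"
      using that assms by (intro power_mono powr_mono2) auto
    finally (order_trans[OF _ mult_left_mono]) show ?thesis
      using B1 by (simp add: mult_left_mono)
  qed
  have main: "real (card {d. d dvd n}) \<le> B ^ card (P n) * real n powr \<delta>" if "n > 0" for n
    using that
  proof (induction n rule: less_induct)
    case (less n)
    show ?case
    proof (cases "n = 1")
      case True
      then show ?thesis using B1 by simp
    next
      case False
      then obtain p where p: "prime p" "p dvd n"
        using prime_factor_nat by blast
      obtain m where m: "n = p ^ multiplicity p n * m" "\<not> p dvd m"
        using less.prems p
        by (metis multiplicity_decompose' not_prime_unit nat_neq_iff)
      \<comment> \<open>Remove all factors \<open>p\<close> at once, so that \<open>p\<close> is charged only once to \<open>P n\<close>.\<close>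
      define a where "a = multiplicity p n"
      have a: "a > 0"
        using p less.prems by (simp add: a_def prime_multiplicity_gt_zero_iff)
      have m0: "m > 0" and nm: "n = p ^ a * m" using m less.prems by (auto simp: a_def intro: Nat.gr0I)
      have p2: "p \<ge> 2" using p prime_ge_2_nat by blast
      have "m < n"
        using nm m0 a p2 one_less_power[of p a] by simp
      then have IH: "real (card {d. d dvd m}) \<le> B ^ card (P m) * real m powr \<delta>"
        using less.IH m0 by blast
      have fin: "finite (P n)" by (simp add: P_def)
      have step: "real (a + 1) * B ^ card (P m) \<le> B ^ card (P n) * (real p powr \<delta>) ^ a"
      proof (cases "p < T")
        case True
        have "insert p (P m) \<subseteq> P n" "p \<notin> P m"
          using p True m(2) nm by (auto simp: P_def)
        then have "Suc (card (P m)) \<le> card (P n)"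
          using fin by (metis card_insert_disjoint card_mono finite_subset subset_insertI subset_trans)
        then have "B * B ^ card (P m) \<le> B ^ card (P n)"
          using power_increasing[OF _ B1] by (metis power_Suc)
        then have "B * B ^ card (P m) * (real p powr \<delta>) ^ a \<le> B ^ card (P n) * (real p powr \<delta>) ^ a"
          by (intro mult_right_mono) auto
        moreover have "real (a + 1) * B ^ card (P m) \<le> B * (real p powr \<delta>) ^ a * B ^ card (P m)"
          using small[OF p2] B1 by (intro mult_right_mono) auto
        ultimately show ?thesis by (simp add: algebra_simps)
      next
        case False
        have "P m \<subseteq> P n" using nm by (auto simp: P_def)
        then have 1: "B ^ card (P m) \<le> B ^ card (P n)"
          using fin B1 by (intro power_increasing card_mono) auto
        have "real (a + 1) \<le> real (2 ^ a)"
          by (metis Suc_eq_plus1 Suc_leI less_exp of_nat_le_iff)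
        also have "\<dots> \<le> (real p powr \<delta>) ^ a"
          using large[of p] False by (simp add: power_mono)
        finally show ?thesis
          using 1 B1 by (simp only: mult.commute[of "B ^ card (P n)"], intro mult_mono) auto
      qed
      have "real (card {d. d dvd n}) \<le> real ((a + 1) * card {d. d dvd m})"
        using card_divisors_prime_power_mult[OF p(1) m0] unfolding nm of_nat_le_iff .
      also have "\<dots> \<le> real (a + 1) * (B ^ card (P m) * real m powr \<delta>)"
        unfolding of_nat_mult by (intro mult_left_mono IH) auto
      also have "\<dots> \<le> B ^ card (P n) * (real p powr \<delta>) ^ a * real m powr \<delta>"
        using step by (simp add: mult.assoc[symmetric] mult_right_mono)
      also have "\<dots> = B ^ card (P n) * real n powr \<delta>"
        using p2 m0 by (simp add: nm powr_mult powr_powr mult_ac flip: powr_realpow)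
      finally show ?thesis .
    qed
  qed
  show ?thesis
  proof (rule that)
    show "B ^ T \<ge> 1" using B1 by simp
    fix n :: nat assume n: "n > 0"
    have "card (P n) \<le> card {..<T}"
      by (intro card_mono) (auto simp: P_def)
    then have "B ^ card (P n) \<le> B ^ T"
      using B1 by (intro power_increasing) auto
    then show "real (card {d. d dvd n}) \<le> B ^ T * real n powr \<delta>"
      by (smt (verit) main[OF n] mult_right_mono powr_ge_zero)
  qed
qed

definition circle_points :: "int \<Rightarrow> (int \<times> int) set" where
  "circle_points N = {(x, y). x\<^sup>2 + y\<^sup>2 = N}"

lemma finite_circle_points: "finite (circle_points N)"
proof -
  have "circle_points N \<subseteq> {- \<bar>N\<bar>..\<bar>N\<bar>} \<times> {- \<bar>N\<bar>..\<bar>N\<bar>}"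
  proof
    fix z assume "z \<in> circle_points N"
    then obtain x y where z: "z = (x, y)" "x\<^sup>2 + y\<^sup>2 = N"
      by (auto simp: circle_points_def)
    have *: "\<bar>t\<bar> \<le> t\<^sup>2" for t :: int
      using mult_left_mono[of 1 "\<bar>t\<bar>" "\<bar>t\<bar>"]
      by (cases "t = 0") (auto simp: power2_eq_square abs_mult[symmetric])
    show "z \<in> {- \<bar>N\<bar>..\<bar>N\<bar>} \<times> {- \<bar>N\<bar>..\<bar>N\<bar>}"
      using z *[of x] *[of y] zero_le_power2[of x] zero_le_power2[of y] by auto
  qed
  then show ?thesis
    by (rule finite_subset) simp
qed

definition primitive_circle_points :: "int \<Rightarrow> (int \<times> int) set" where
  "primitive_circle_points N = {(x, y) \<in> circle_points N. coprime x y}"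

lemma coprime_circle_point:
  assumes "(x, y) \<in> primitive_circle_points N"
  shows "coprime x N" "coprime y N"
proof -
  have N: "N = x * x + y\<^sup>2" "N = y * y + x\<^sup>2" and cop: "coprime x (y\<^sup>2)" "coprime y (x\<^sup>2)"
    using assms by (auto simp: primitive_circle_points_def circle_points_def power2_eq_square
        coprime_commute)
  show "coprime x N" using cop(1)
    by (subst N(1)) (simp add: coprime_iff_gcd_eq_1 gcd_add_mult)
  show "coprime y N" using cop(2)
    by (subst N(2)) (simp add: coprime_iff_gcd_eq_1 gcd_add_mult)
qed

text \<open>Since \<open>N\<close> divides \<open>gcd (A * B) (N * B) = gcd A N * B\<close>, the common factor cancels.\<close>

lemma dvd_cofactor_of_dvd_mult:
  fixes A B N h :: int
  assumes "N dvd A * B" "N = gcd A N * h" "N \<noteq> 0"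
  shows "h dvd B"
proof -
  have "N dvd gcd (A * B) (N * B)"
    using assms(1) by simp
  also have "gcd (A * B) (N * B) = gcd A N * \<bar>B\<bar>"
    by (simp add: gcd_mult_right abs_mult gcd.commute)
  finally have "gcd A N * h dvd gcd A N * \<bar>B\<bar>"
    using assms(2) by simp
  then show ?thesis
    using assms by (metis abs_dvd_iff dvd_abs_iff dvd_mult_cancel_left mult_zero_left)
qed

text \<open>A gcd remembers a point of the circle up to a bounded number of choices. Fix a primitive point
  \<open>(x0, y0)\<close>. For any point \<open>(x, y)\<close> of the same circle
  \<open>(x0 * y - y0 * x) * (x0 * y + y0 * x) = N * (x0\<^sup>2 - x\<^sup>2)\<close>, so if the gcd \<open>g\<close> of the first factor
  with \<open>N\<close> is known, the second one vanishes modulo the cofactor \<open>h\<close>. Two points with the same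
  \<open>g\<close> therefore have proportional coordinates modulo \<open>g\<close> and modulo \<open>h\<close>, hence modulo their
  least common multiple, and \<open>gcd g h\<close> divides \<open>2\<close>. In terms of Gaussian integers, \<open>g\<close> records
  which prime factors the two points share.\<close>

lemma same_gcd_imp_dvd_twice_det:
  fixes x0 y0 x y x' y' N :: int
  assumes N: "N > 0"
    and z0: "(x0, y0) \<in> primitive_circle_points N"
    and z: "(x, y) \<in> primitive_circle_points N"
    and z': "(x', y') \<in> circle_points N"
    and gcd_eq: "gcd (x0 * y' - y0 * x') N = gcd (x0 * y - y0 * x) N"
  shows "N dvd 2 * (x * y' - x' * y)"
proof -
  define g where "g = gcd (x0 * y - y0 * x) N"
  obtain h where h: "N = g * h"
    unfolding g_def by (metis dvdE gcd_dvd2)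
  define D where "D = x * y' - x' * y"
  have gN: "g dvd N" and hN: "h dvd N" using h by auto
  have cop: "coprime x0 g" "coprime x0 h"
    using coprime_circle_point(1)[OF z0] gN hN by (auto intro: coprime_divisors[OF dvd_refl])
  have hB: "h dvd x0 * v + y0 * u" if uv: "(u, v) \<in> circle_points N" "gcd (x0 * v - y0 * u) N = g" for u v
  proof (rule dvd_cofactor_of_dvd_mult)
    have eqs: "u\<^sup>2 + v\<^sup>2 = N" "x0\<^sup>2 + y0\<^sup>2 = N"
      using uv z0 by (auto simp: circle_points_def primitive_circle_points_def)
    have "(x0 * v - y0 * u) * (x0 * v + y0 * u) = x0\<^sup>2 * v\<^sup>2 - y0\<^sup>2 * u\<^sup>2"
      by (simp add: algebra_simps power2_eq_square)
    also have "\<dots> = x0\<^sup>2 * (N - u\<^sup>2) - (N - x0\<^sup>2) * u\<^sup>2"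
      using eqs by (metis add_diff_cancel_left')
    also have "\<dots> = N * (x0\<^sup>2 - u\<^sup>2)"
      by (simp add: algebra_simps)
    finally show "N dvd (x0 * v - y0 * u) * (x0 * v + y0 * u)" by simp
    show "N = gcd (x0 * v - y0 * u) N * h" using h uv by simp
    show "N \<noteq> 0" using N by simp
  qed
  have gA: "g dvd x0 * y - y0 * x" "g dvd x0 * y' - y0 * x'"
    unfolding g_def by simp (metis gcd_eq gcd_dvd1)
  have zc: "(x, y) \<in> circle_points N" using z by (simp add: primitive_circle_points_def)
  have hA: "h dvd x0 * y + y0 * x" "h dvd x0 * y' + y0 * x'"
    using hB[OF zc] hB[OF z'] gcd_eq by (auto simp: g_def)
  have "g dvd x * (x0 * y' - y0 * x') - x' * (x0 * y - y0 * x)"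
    by (rule dvd_diff[OF dvd_mult[OF gA(2)] dvd_mult[OF gA(1)]])
  also have "x * (x0 * y' - y0 * x') - x' * (x0 * y - y0 * x) = x0 * D"
    by (simp add: D_def algebra_simps)
  finally have gD: "g dvd D" using cop(1) by (metis coprime_commute coprime_dvd_mult_right_iff)
  have "h dvd x * (x0 * y' + y0 * x') - x' * (x0 * y + y0 * x)"
    by (rule dvd_diff[OF dvd_mult[OF hA(2)] dvd_mult[OF hA(1)]])
  also have "x * (x0 * y' + y0 * x') - x' * (x0 * y + y0 * x) = x0 * D"
    by (simp add: D_def algebra_simps)
  finally have hD: "h dvd D" using cop(2) by (metis coprime_commute coprime_dvd_mult_right_iff)
  have "gcd g h dvd (x0 * y - y0 * x) + (x0 * y + y0 * x)"
    using gA hA by (meson dvd_add dvd_trans gcd_dvd1 gcd_dvd2)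
  also have "(x0 * y - y0 * x) + (x0 * y + y0 * x) = x0 * (y * 2)"
    by simp
  finally have "gcd g h dvd y * 2"
    using cop(1) by (metis coprime_commute coprime_divisors coprime_dvd_mult_right_iff dvd_refl gcd_dvd1)
  moreover have "coprime y (gcd g h)"
    using coprime_circle_point(2)[OF z] gN by (meson coprime_divisors dvd_refl dvd_trans gcd_dvd1)
  ultimately have "gcd g h dvd 2"
    by (metis coprime_commute coprime_dvd_mult_right_iff)
  moreover have "lcm g h dvd D"
    using gD hD by simp
  ultimately have "gcd g h * lcm g h dvd 2 * D"
    by (rule mult_dvd_mono)
  then show ?thesis
    by (simp add: h D_def flip: abs_mult)
qed

text \<open>The determinant \<open>D\<close> and the inner product \<open>E\<close> of two points of the circle satisfy
  \<open>D\<^sup>2 + E\<^sup>2 = N\<^sup>2\<close> and determine the second point from the first. As \<open>2 * D\<close> is a multiple of \<open>N\<close>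
  there are five values of \<open>D\<close>, and then two signs of \<open>E\<close>.\<close>

lemma card_circle_points_with_det_le:
  assumes N: "N > 0" and z: "(x, y) \<in> circle_points N"
  shows "card {(x', y') \<in> circle_points N. N dvd 2 * (x * y' - x' * y)} \<le> 10"
proof -
  define S where "S = {(x', y') \<in> circle_points N. N dvd 2 * (x * y' - x' * y)}"
  define D where "D = (\<lambda>(x', y'). x * y' - x' * y)"
  define E where "E = (\<lambda>(x', y'). x * x' + y * y')"
  have DE: "(D p)\<^sup>2 + (E p)\<^sup>2 = N\<^sup>2" if "p \<in> circle_points N" for p
  proof -
    obtain x' y' where p: "p = (x', y')" by force
    have "(D p)\<^sup>2 + (E p)\<^sup>2 = (x\<^sup>2 + y\<^sup>2) * (x'\<^sup>2 + y'\<^sup>2)"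
      by (simp add: D_def E_def p algebra_simps power2_eq_square)
    then show ?thesis
      using that z by (simp add: p circle_points_def power2_eq_square)
  qed
  have rec: "fst p * N = x * E p - y * D p" "snd p * N = y * E p + x * D p" for p
    using z by (auto simp: D_def E_def circle_points_def power2_eq_square algebra_simps split: prod.splits)
  have "inj_on (\<lambda>p. (2 * D p div N, E p \<ge> 0)) S"
  proof (rule inj_onI)
    fix p q assume p: "p \<in> S" and q: "q \<in> S"
      and "(2 * D p div N, E p \<ge> 0) = (2 * D q div N, E q \<ge> 0)"
    then have eq: "2 * D p div N = 2 * D q div N" "E p \<ge> 0 \<longleftrightarrow> E q \<ge> 0" by auto
    have dv: "N dvd 2 * D p" "N dvd 2 * D q"
      using p q by (auto simp: S_def D_def)
    have D: "D p = D q"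
      using eq(1) dv N by (metis dvd_div_eq_cancel mult_cancel_left zero_neq_numeral)
    have "(E p)\<^sup>2 = (E q)\<^sup>2"
      using DE[of p] DE[of q] D p q by (auto simp: S_def)
    then have E: "E p = E q"
      using eq(2) by (metis abs_of_nonneg linorder_not_le minus_equation_iff power2_eq_iff neg_0_le_iff_le order_less_imp_le order.antisym)
    show "p = q"
      using rec[of p] rec[of q] D E N by (metis mult_cancel_right less_irrefl prod.expand)
  qed
  moreover have "(\<lambda>p. (2 * D p div N, E p \<ge> 0)) ` S \<subseteq> {-2..2} \<times> UNIV"
  proof
    fix w assume "w \<in> (\<lambda>p. (2 * D p div N, E p \<ge> 0)) ` S"
    then obtain p where p: "p \<in> S" "w = (2 * D p div N, E p \<ge> 0)" by auto
    have "(D p)\<^sup>2 \<le> N\<^sup>2"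
      using DE[of p] p(1) zero_le_power2[of "E p"] unfolding S_def by (smt (verit) Collect_case_prodD mem_Collect_eq split_conv prod.collapse)
    then have "\<bar>D p\<bar> \<le> N"
      using N by (simp add: abs_le_square_iff[symmetric])
    then have "2 * D p \<le> 2 * N" "(-2) * N \<le> 2 * D p" by auto
    then have "2 * D p div N \<le> (2 * N) div N" "((-2) * N) div N \<le> 2 * D p div N"
      using N by (intro zdiv_mono1; simp)+
    then show "w \<in> {-2..2} \<times> UNIV"
      using p N nonzero_mult_div_cancel_right[of N "-2"] by simp
  qed
  ultimately have "card S \<le> card ({-2..2::int} \<times> (UNIV :: bool set))"
    by (intro card_inj_on_le) auto
  then show ?thesis
    by (simp add: S_def card_cartesian_product)
qed

lemma card_primitive_circle_points:
  fixes N :: nat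
  assumes N: "N > 0"
  shows "card (primitive_circle_points (int N)) \<le> 10 * card {d. d dvd N}"
proof (cases "primitive_circle_points (int N) = {}")
  case False
  then obtain x0 y0 where z0: "(x0, y0) \<in> primitive_circle_points (int N)" by auto
  define f where "f = (\<lambda>(x, y). nat (gcd (x0 * y - y0 * x) (int N)))"
  have "card (primitive_circle_points (int N)) \<le> card {d. d dvd N} * 10"
  proof (rule card_le_fibres[where f = f])
    show "finite {d. d dvd N}" using N by simp
    show "f ` primitive_circle_points (int N) \<subseteq> {d. d dvd N}"
      by (auto simp: f_def nat_dvd_iff)
    fix g
    show "card {p \<in> primitive_circle_points (int N). f p = g} \<le> 10" (is "card ?F \<le> 10")
    proof (cases "?F = {}")
      case False
      then obtain x y where z: "(x, y) \<in> primitive_circle_points (int N)" "f (x, y) = g" by auto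
      have "?F \<subseteq> {(x', y') \<in> circle_points (int N). int N dvd 2 * (x * y' - x' * y)}"
      proof clarify
        fix x' y' assume z': "(x', y') \<in> primitive_circle_points (int N)" "g = f (x', y')"
        have "gcd (x0 * y' - y0 * x') (int N) = gcd (x0 * y - y0 * x) (int N)"
          using z(2) z'(2) by (simp add: f_def eq_nat_nat_iff)
        then show "(x', y') \<in> circle_points (int N) \<and> int N dvd 2 * (x * y' - x' * y)"
          using same_gcd_imp_dvd_twice_det[OF _ z0 z(1)] z'(1) N
          by (auto simp: primitive_circle_points_def)
      qed
      then have "card ?F \<le> card {(x', y') \<in> circle_points (int N). int N dvd 2 * (x * y' - x' * y)}"
        by (intro card_mono finite_subset[OF _ finite_circle_points[of "int N"]]) auto
      also have "\<dots> \<le> 10"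
        using z N by (intro card_circle_points_with_det_le) (auto simp: primitive_circle_points_def)
      finally show ?thesis .
    qed (simp only: card.empty)
  qed
  then show ?thesis by simp
qed simp

text \<open>Sort the points by the gcd \<open>g\<close> of their coordinates: dividing by \<open>g\<close> gives primitive points of
  the circle \<open>N / g\<^sup>2\<close>, whose divisors are among those of \<open>N\<close>.\<close>

lemma card_circle_points:
  fixes N :: nat
  assumes N: "N > 0"
  shows "card (circle_points (int N)) \<le> 10 * (card {d. d dvd N})\<^sup>2"
proof -
  define f where "f = (\<lambda>(x, y). nat (gcd x y) :: nat)"
  have "card (circle_points (int N)) \<le> card {d. d dvd N} * (10 * card {d. d dvd N})"
  proof (rule card_le_fibres[where f = f])
    show "finite {d. d dvd N}" using N by simp
    show "f ` circle_points (int N) \<subseteq> {d. d dvd N}"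
    proof clarify
      fix x y assume "(x, y) \<in> circle_points (int N)"
      then have "gcd x y dvd int N"
        unfolding circle_points_def by (auto simp: power2_eq_square) (metis dvd_add dvd_mult gcd_dvd1 gcd_dvd2)
      then show "f (x, y) dvd N" by (simp add: f_def nat_dvd_iff)
    qed
    fix g
    show "card {p \<in> circle_points (int N). f p = g} \<le> 10 * card {d. d dvd N}" (is "card ?F \<le> _")
    proof (cases "?F = {}")
      case False
      have split: "\<exists>u v. p = (int g * u, int g * v) \<and> coprime u v \<and> int g ^ 2 * (u\<^sup>2 + v\<^sup>2) = int N"
        if pF: "p \<in> ?F" for p
      proof -
        obtain x y where p: "p = (x, y)" "x\<^sup>2 + y\<^sup>2 = int N" "gcd x y = int g"
          using pF by (cases p) (auto simp: f_def circle_points_def)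
        have "gcd x y \<noteq> 0" using p(2) N by auto
        then obtain u v where "x = u * gcd x y" "y = v * gcd x y" "coprime u v"
          using gcd_coprime_exists by metis
        then show ?thesis
          using p by (intro exI[of _ u] exI[of _ v]) (auto simp: power2_eq_square algebra_simps)
      qed
      obtain u v where uv: "int g ^ 2 * (u\<^sup>2 + v\<^sup>2) = int N" using False split by blast
      define n where "n = nat (u\<^sup>2 + v\<^sup>2)"
      have n: "int g ^ 2 * int n = int N" using uv by (simp add: n_def)
      have gn: "g\<^sup>2 * n = N"
        using n by (metis of_nat_eq_iff of_nat_mult of_nat_power)
      have g0: "g > 0" "n > 0" using gn N by (auto intro: Nat.gr0I)
      have "?F \<subseteq> (\<lambda>(u, v). (int g * u, int g * v)) ` primitive_circle_points (int n)"
      proof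
        fix p assume "p \<in> ?F"
        then obtain u v where *: "p = (int g * u, int g * v)" "coprime u v" "int g ^ 2 * (u\<^sup>2 + v\<^sup>2) = int N"
          using split by blast
        then have "u\<^sup>2 + v\<^sup>2 = int n"
          using n g0 by (metis mult_cancel_left of_nat_0_eq_iff less_irrefl power_not_zero)
        then show "p \<in> (\<lambda>(u, v). (int g * u, int g * v)) ` primitive_circle_points (int n)"
          using * by (force simp: primitive_circle_points_def circle_points_def)
      qed
      moreover have "finite (primitive_circle_points (int n))"
        by (rule finite_subset[OF _ finite_circle_points[of "int n"]]) (auto simp: primitive_circle_points_def)
      ultimately have "card ?F \<le> card (primitive_circle_points (int n))"
        by (rule surj_card_le[rotated])
      also have "\<dots> \<le> 10 * card {d. d dvd n}"
        using g0 by (intro card_primitive_circle_points) simp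
      also have "card {d. d dvd n} \<le> card {d. d dvd N}"
        using gn N by (intro card_mono) auto
      finally show ?thesis by simp
    qed (simp only: card.empty)
  qed
  then show ?thesis by (simp add: power2_eq_square)
qed

text \<open>Three lattice points on a circle span a triangle whose doubled area \<open>D\<close> is a nonzero integer,
  so a short arc with three lattice points cannot be too flat. The relations
  \<open>2 * (P \<bullet> u) = - |u|\<^sup>2\<close> and \<open>2 * (P \<bullet> v) = - |v|\<^sup>2\<close> for the two chords, solved for \<open>P\<close> by Cramer's
  rule, bound \<open>2 * D * P\<close> in terms of the chords alone.\<close>

lemma circle_norm_le_of_three_points:
  fixes px py ux uy vx vy N R :: int
  assumes P: "(px, py) \<in> circle_points N" "(px + ux, py + uy) \<in> circle_points N"
      "(px + vx, py + vy) \<in> circle_points N"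
    and distinct: "(ux, uy) \<noteq> (0, 0)" "(vx, vy) \<noteq> (0, 0)" "(ux, uy) \<noteq> (vx, vy)"
    and small: "\<bar>ux\<bar> \<le> 2 * R" "\<bar>uy\<bar> \<le> 2 * R" "\<bar>vx\<bar> \<le> 2 * R" "\<bar>vy\<bar> \<le> 2 * R"
  shows "N \<le> 512 * R ^ 6"
proof -
  define U where "U = ux\<^sup>2 + uy\<^sup>2"
  define V where "V = vx\<^sup>2 + vy\<^sup>2"
  define D where "D = ux * vy - uy * vx"
  have N: "N = px\<^sup>2 + py\<^sup>2" using P by (simp add: circle_points_def)
  have u: "2 * (px * ux + py * uy) = - U" and v: "2 * (px * vx + py * vy) = - V"
    using P by (auto simp: circle_points_def U_def V_def power2_eq_square algebra_simps)
  have UV0: "U \<noteq> 0" "V \<noteq> 0" using distinct by (auto simp: U_def V_def sum_power2_eq_zero_iff)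
  have "2 * D * px = vy * (2 * (px * ux + py * uy)) - uy * (2 * (px * vx + py * vy))"
    by (simp add: D_def algebra_simps)
  then have X: "2 * D * px = V * uy - U * vy"
    unfolding u v by (simp add: algebra_simps)
  have "2 * D * py = ux * (2 * (px * vx + py * vy)) - vx * (2 * (px * ux + py * uy))"
    by (simp add: D_def algebra_simps)
  then have Y: "2 * D * py = U * vx - V * ux"
    unfolding u v by (simp add: algebra_simps)
  have "D \<noteq> 0"
  proof
    assume "D = 0"
    then have eq: "V * uy = U * vy" "V * ux = U * vx" using X Y by auto
    have "U * U * V = (U * vx)\<^sup>2 + (U * vy)\<^sup>2"
      by (simp add: V_def power2_eq_square algebra_simps)
    also have "\<dots> = V * V * U"
      by (simp add: eq[symmetric]) (simp add: U_def power2_eq_square algebra_simps)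
    finally have "U = V" using UV0 by simp
    then show False using eq UV0 distinct by simp
  qed
  then have "D\<^sup>2 \<ge> 1" using zero_less_power2[of D] by linarith
  have sq: "t\<^sup>2 \<le> 4 * R\<^sup>2" if "\<bar>t\<bar> \<le> 2 * R" for t
    using that power_mono[OF that, of 2] by (simp add: power2_eq_square)
  have "U \<le> 8 * R\<^sup>2" "V \<le> 8 * R\<^sup>2" "U \<ge> 0" "V \<ge> 0"
    using sq[OF small(1)] sq[OF small(2)] sq[OF small(3)] sq[OF small(4)]
    by (auto simp: U_def V_def)
  then have UVb: "\<bar>U\<bar> \<le> 8 * R\<^sup>2" "\<bar>V\<bar> \<le> 8 * R\<^sup>2" by auto
  have prod: "\<bar>S * t\<bar> \<le> 16 * R ^ 3" if "\<bar>S\<bar> \<le> 8 * R\<^sup>2" "\<bar>t\<bar> \<le> 2 * R" for S t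
  proof -
    have "\<bar>S * t\<bar> \<le> (8 * R\<^sup>2) * (2 * R)"
      unfolding abs_mult using that by (intro mult_mono) auto
    then show ?thesis by (simp add: power3_eq_cube power2_eq_square)
  qed
  have "\<bar>V * uy - U * vy\<bar> \<le> 32 * R ^ 3" "\<bar>U * vx - V * ux\<bar> \<le> 32 * R ^ 3"
    using prod[OF UVb(2) small(2)] prod[OF UVb(1) small(4)] prod[OF UVb(1) small(3)] prod[OF UVb(2) small(1)]
    by linarith+
  then have "\<bar>2 * D * px\<bar> ^ 2 \<le> (32 * R ^ 3) ^ 2" "\<bar>2 * D * py\<bar> ^ 2 \<le> (32 * R ^ 3) ^ 2"
    unfolding X Y by (intro power_mono; simp)+
  then have "(2 * D * px)\<^sup>2 + (2 * D * py)\<^sup>2 \<le> 2048 * R ^ 6"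
    by (simp add: power_mult_distrib flip: power_mult)
  then have "4 * (D\<^sup>2 * N) \<le> 2048 * R ^ 6"
    by (simp add: N power_mult_distrib algebra_simps)
  moreover have "1 * N \<le> D\<^sup>2 * N"
    using \<open>D\<^sup>2 \<ge> 1\<close> by (intro mult_right_mono) (auto simp: N)
  ultimately show ?thesis by linarith
qed

text \<open>The bound does not depend on the circle. Above \<open>N = 512 * R ^ 6\<close> there are at most two points;
  below it \<open>N\<close> is polynomial in \<open>R\<close> and the points of the whole circle are few. The exponent
  \<open>\<delta> / 12\<close> accounts for the square of the divisor count and for the sixth power of \<open>R\<close>.\<close>

lemma card_circle_points_in_box:
  fixes \<delta> :: real
  assumes "\<delta> > 0"
  obtains K where "K \<ge> 1"
    "\<And>(N::int) p q (R::nat). R \<ge> 1 \<Longrightarrow>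
       real (card {(x, y) \<in> circle_points N. \<bar>x - p\<bar> \<le> int R \<and> \<bar>y - q\<bar> \<le> int R}) \<le> K * real R powr \<delta>"
proof -
  obtain K0 where K0: "K0 \<ge> 1"
    "\<And>n::nat. n > 0 \<Longrightarrow> real (card {d. d dvd n}) \<le> K0 * real n powr (\<delta> / 12)"
    using divisor_bound[of "\<delta> / 12"] assms by auto
  define K where "K = 10 * K0\<^sup>2 * 512 powr (\<delta> / 6)"
  have "K0\<^sup>2 \<ge> 1" "512 powr (\<delta> / 6) \<ge> 1"
    using K0 assms by (auto simp: ge_one_powr_ge_zero one_le_power)
  then have "K0\<^sup>2 * 512 powr (\<delta> / 6) \<ge> 1 * 1"
    by (intro mult_mono) auto
  then have K: "K \<ge> 10" by (simp add: K_def)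
  show ?thesis
  proof (rule that)
    show "K \<ge> 1" using K by simp
    fix N p q :: int and R :: nat assume R: "R \<ge> 1"
    define A where "A = {(x, y) \<in> circle_points N. \<bar>x - p\<bar> \<le> int R \<and> \<bar>y - q\<bar> \<le> int R}"
    have sub: "A \<subseteq> circle_points N" by (auto simp: A_def)
    have finA: "finite A" using sub finite_circle_points finite_subset by blast
    have R1: "real R powr \<delta> \<ge> 1" using R assms by (simp add: ge_one_powr_ge_zero)
    have two: "real (card A) \<le> K * real R powr \<delta>" if "card A \<le> 2"
    proof -
      have "real (card A) \<le> K * 1" using that K by simp
      also have "\<dots> \<le> K * real R powr \<delta>" using R1 K by (intro mult_left_mono) auto
      finally show ?thesis .
    qed
    consider "N \<le> 0" | "0 < N" "N \<le> 512 * int R ^ 6" | "N > 512 * int R ^ 6" by linarith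
    then have "real (card A) \<le> K * real R powr \<delta>"
    proof cases
      case 1
      have "A \<subseteq> {(0, 0)}"
      proof
        fix z assume "z \<in> A"
        then obtain x y where z: "z = (x, y)" "x\<^sup>2 + y\<^sup>2 = N" by (auto simp: A_def circle_points_def)
        then have "x\<^sup>2 + y\<^sup>2 \<le> 0" using 1 by simp
        then show "z \<in> {(0, 0)}" using z(1) by (simp only: sum_power2_le_zero_iff) simp
      qed
      then have "card A \<le> card {(0::int, 0::int)}" by (intro card_mono) auto
      then show ?thesis by (intro two) simp
    next
      case 2
      define n where "n = nat N"
      have n: "N = int n" "n > 0" using 2 by (auto simp: n_def)
      have "real (card A) \<le> real (card (circle_points (int n)))"
        using card_mono[OF finite_circle_points sub] n by simp
      also have "\<dots> \<le> 10 * (real (card {d. d dvd n}))\<^sup>2"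
        using card_circle_points[OF n(2)] by (metis of_nat_le_iff of_nat_mult of_nat_numeral of_nat_power)
      also have "\<dots> \<le> 10 * (K0 * real n powr (\<delta> / 12))\<^sup>2"
        using K0(2)[OF n(2)] by (intro mult_left_mono power_mono) auto
      also have "\<dots> = 10 * K0\<^sup>2 * real n powr (\<delta> / 6)"
        by (simp add: power_mult_distrib power2_eq_square flip: powr_add)
      also have "real n powr (\<delta> / 6) \<le> (512 * real R ^ 6) powr (\<delta> / 6)"
      proof (rule powr_mono2)
        have "int n \<le> int (512 * R ^ 6)" using 2 n by simp
        then have "real n \<le> real (512 * R ^ 6)" by (simp only: of_nat_le_iff)
        then show "real n \<le> 512 * real R ^ 6" by simp
      qed (use assms in auto)
      also have "(512 * real R ^ 6) powr (\<delta> / 6) = 512 powr (\<delta> / 6) * (real R powr 6) powr (\<delta> / 6)"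
        using R by (simp add: powr_mult)
      also have "(real R powr 6) powr (\<delta> / 6) = real R powr \<delta>"
        unfolding powr_powr by simp
      finally show ?thesis using K0(1) by (simp add: K_def mult_ac mult_left_mono)
    next
      case 3
      have "card A \<le> 2"
      proof (rule ccontr)
        assume "\<not> card A \<le> 2"
        then have "3 \<le> card A" by simp
        then obtain B where B: "B \<subseteq> A" "card B = 3"
          by (rule obtain_subset_with_card_n) blast
        obtain a b c where "B = {a, b, c}" and distinct: "a \<noteq> b" "a \<noteq> c" "b \<noteq> c"
          using iffD1[OF card_3_iff B(2)] by blast
        then have abc: "a \<in> A" "b \<in> A" "c \<in> A"
          using B(1) by blast+
        obtain ax ay where a: "a = (ax, ay)" by (cases a)
        obtain bx b_y where b: "b = (bx, b_y)" by (cases b)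
        obtain cx cy where c: "c = (cx, cy)" by (cases c)
        have "N \<le> 512 * int R ^ 6"
        proof (rule circle_norm_le_of_three_points)
          show "(ax, ay) \<in> circle_points N" "(ax + (bx - ax), ay + (b_y - ay)) \<in> circle_points N"
            "(ax + (cx - ax), ay + (cy - ay)) \<in> circle_points N"
            using abc by (simp_all add: a b c A_def)
          show "(bx - ax, b_y - ay) \<noteq> (0, 0)" "(cx - ax, cy - ay) \<noteq> (0, 0)"
            "(bx - ax, b_y - ay) \<noteq> (cx - ax, cy - ay)"
            using distinct distinct[symmetric] by (simp_all add: a b c)
          have "\<bar>ax - p\<bar> \<le> int R" "\<bar>ay - q\<bar> \<le> int R" "\<bar>bx - p\<bar> \<le> int R" "\<bar>b_y - q\<bar> \<le> int R"
            "\<bar>cx - p\<bar> \<le> int R" "\<bar>cy - q\<bar> \<le> int R"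
            using abc by (simp_all add: a b c A_def)
          then show "\<bar>bx - ax\<bar> \<le> 2 * int R" "\<bar>b_y - ay\<bar> \<le> 2 * int R"
            "\<bar>cx - ax\<bar> \<le> 2 * int R" "\<bar>cy - ay\<bar> \<le> 2 * int R"
            by linarith+
        qed
        then show False using 3 by simp
      qed
      then show ?thesis by (rule two)
    qed
    then show "real (card {(x, y) \<in> circle_points N. \<bar>x - p\<bar> \<le> int R \<and> \<bar>y - q\<bar> \<le> int R})
        \<le> K * real R powr \<delta>" by (simp add: A_def)
  qed
qed

section \<open>Lattice points on spheres\<close>

lemma lattice_sphere_sum_squares:
  assumes "k \<in> lattice_sphere r"
  shows "real_of_int (\<Sum>i\<in>UNIV. (k $ i)\<^sup>2) = r\<^sup>2"
proof -
  have "r\<^sup>2 = int_vec k \<bullet> int_vec k"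
    using assms by (simp add: lattice_sphere_def flip: power2_norm_eq_inner)
  then show ?thesis
    by (simp add: inner_vec_def int_vec_def power2_eq_square)
qed

text \<open>All but two of the coordinates range over a box of side \<open>2 * R + 1\<close>; given these, the remaining
  two lie on a circle.\<close>

lemma card_lattice_sphere_in_ball:
  fixes \<delta> :: real
  assumes "\<delta> > 0" and dim: "CARD('n::finite) \<ge> 2"
  obtains K where "K \<ge> 1"
    "\<And>r (k0 :: int ^ 'n) (R::nat). R \<ge> 1 \<Longrightarrow>
       real (card {k \<in> lattice_sphere r. norm (int_vec k - int_vec k0) \<le> real R})
         \<le> K * real R powr (real CARD('n) - 2 + \<delta>)"
proof -
  obtain K0 where K0: "K0 \<ge> 1"
    "\<And>(N::int) p q (R::nat). R \<ge> 1 \<Longrightarrow>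
       real (card {(x, y) \<in> circle_points N. \<bar>x - p\<bar> \<le> int R \<and> \<bar>y - q\<bar> \<le> int R}) \<le> K0 * real R powr \<delta>"
    using card_circle_points_in_box[OF assms(1)] by blast
  obtain B :: "'n set" where "card B = 2"
    using obtain_subset_with_card_n[OF dim] by blast
  then obtain a b :: 'n where ab: "a \<noteq> b"
    unfolding card_2_iff by blast
  define I where "I = UNIV - {a, b}"
  have cI: "card I = CARD('n) - 2"
    using ab by (simp add: I_def card_Diff_subset)
  have split: "(\<Sum>i\<in>UNIV. (k $ i)\<^sup>2) = (\<Sum>i\<in>I. (k $ i)\<^sup>2) + ((k $ a)\<^sup>2 + (k $ b)\<^sup>2)" for k :: "int ^ 'n"
  proof -
    have "(\<Sum>i\<in>UNIV. (k $ i)\<^sup>2) = (\<Sum>i\<in>I. (k $ i)\<^sup>2) + (\<Sum>i\<in>{a, b}. (k $ i)\<^sup>2)"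
      unfolding I_def by (intro sum.subset_diff) auto
    then show ?thesis using ab by simp
  qed
  show ?thesis
  proof (rule that)
    show "3 ^ (CARD('n) - 2) * K0 \<ge> 1"
      using K0(1) mult_mono[of 1 "3 ^ (CARD('n) - 2)" 1 K0] by simp
    fix r and k0 :: "int ^ 'n" and R :: nat assume R: "R \<ge> 1"
    define A where "A = {k \<in> lattice_sphere r. norm (int_vec k - int_vec k0) \<le> real R}"
    define Bx where "Bx = PiE I (\<lambda>i. {k0 $ i - int R..k0 $ i + int R})"
    define m where "m = nat \<lfloor>K0 * real R powr \<delta>\<rfloor>"
    have K0R: "K0 * real R powr \<delta> \<ge> 0" using K0(1) by simp
    have box: "\<bar>k $ i - k0 $ i\<bar> \<le> int R" if "k \<in> A" for k i
    proof -
      have "\<bar>(int_vec k - int_vec k0) $ i\<bar> \<le> real R"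
        using that component_le_norm_cart[of "int_vec k - int_vec k0" i] by (auto simp: A_def)
      then have "\<bar>real_of_int (k $ i - k0 $ i)\<bar> \<le> real_of_int (int R)" by (simp add: int_vec_def)
      then show ?thesis by linarith
    qed
    have "card A \<le> card Bx * m"
    proof (rule card_le_fibres[where f = "\<lambda>k. restrict (\<lambda>i. k $ i) I"])
      show "finite Bx" unfolding Bx_def by (intro finite_PiE) auto
      show "(\<lambda>k. restrict (($) k) I) ` A \<subseteq> Bx"
      proof (rule image_subsetI)
        fix k assume k: "k \<in> A"
        have "k $ i \<in> {k0 $ i - int R..k0 $ i + int R}" for i
          using box[OF k, of i] by (auto simp: abs_le_iff)
        then show "restrict (($) k) I \<in> Bx"
          by (auto simp: Bx_def)
      qed
      fix y
      show "card {k \<in> A. restrict (($) k) I = y} \<le> m" (is "card ?F \<le> m")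
      proof (cases "?F = {}")
        case False
        then obtain l where l: "l \<in> ?F" by blast
        define N where "N = (l $ a)\<^sup>2 + (l $ b)\<^sup>2"
        let ?C = "{(x, y) \<in> circle_points N. \<bar>x - k0 $ a\<bar> \<le> int R \<and> \<bar>y - k0 $ b\<bar> \<le> int R}"
        have "card ?F \<le> card ?C"
        proof (rule card_inj_on_le[where f = "\<lambda>k. (k $ a, k $ b)"])
          show "inj_on (\<lambda>k. (k $ a, k $ b)) ?F"
          proof (rule inj_onI)
            fix k k' assume k: "k \<in> ?F" "k' \<in> ?F" and eq: "(k $ a, k $ b) = (k' $ a, k' $ b)"
            have "k $ i = k' $ i" for i
            proof (cases "i \<in> I")
              case True
              have "restrict (($) k) I = restrict (($) k') I" using k by simp
              then show ?thesis using True by (metis restrict_apply')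
            qed (use eq in \<open>auto simp: I_def\<close>)
            then show "k = k'" by (simp add: vec_eq_iff)
          qed
          show "(\<lambda>k. (k $ a, k $ b)) ` ?F \<subseteq> ?C"
          proof (rule image_subsetI)
            fix k assume k: "k \<in> ?F"
            have "restrict (($) k) I = restrict (($) l) I" using k l by simp
            then have "k $ i = l $ i" if "i \<in> I" for i using that by (metis restrict_apply')
            then have "(\<Sum>i\<in>I. (k $ i)\<^sup>2) = (\<Sum>i\<in>I. (l $ i)\<^sup>2)" by simp
            moreover have "real_of_int (\<Sum>i\<in>UNIV. (k $ i)\<^sup>2) = real_of_int (\<Sum>i\<in>UNIV. (l $ i)\<^sup>2)"
              using k l lattice_sphere_sum_squares[of k r] lattice_sphere_sum_squares[of l r]
              unfolding A_def mem_Collect_eq by argo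
            then have "(\<Sum>i\<in>UNIV. (k $ i)\<^sup>2) = (\<Sum>i\<in>UNIV. (l $ i)\<^sup>2)" by (simp only: of_int_eq_iff)
            ultimately have "(k $ a, k $ b) \<in> circle_points N"
              by (simp add: split circle_points_def N_def)
            then show "(k $ a, k $ b) \<in> ?C" using box k by auto
          qed
          show "finite ?C" by (rule finite_subset[OF _ finite_circle_points[of N]]) auto
        qed
        also have "card ?C \<le> m"
          unfolding m_def using K0(2)[OF R, of N "k0 $ a" "k0 $ b"] by linarith
        finally show ?thesis .
      qed (simp only: card.empty)
    qed
    moreover have "card Bx = (2 * R + 1) ^ (CARD('n) - 2)"
      unfolding Bx_def by (subst card_PiE) (auto simp: I_def[symmetric] cI nat_add_distrib nat_mult_distrib algebra_simps)
    ultimately have "real (card A) \<le> real ((2 * R + 1) ^ (CARD('n) - 2)) * real m"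
      by (metis of_nat_le_iff of_nat_mult)
    also have "\<dots> \<le> (3 * real R) ^ (CARD('n) - 2) * (K0 * real R powr \<delta>)"
    proof (rule mult_mono)
      have "(2 * R + 1) ^ (CARD('n) - 2) \<le> (3 * R) ^ (CARD('n) - 2)"
        using R by (intro power_mono) auto
      then have "real ((2 * R + 1) ^ (CARD('n) - 2)) \<le> real ((3 * R) ^ (CARD('n) - 2))"
        by (simp only: of_nat_le_iff)
      then show "real ((2 * R + 1) ^ (CARD('n) - 2)) \<le> (3 * real R) ^ (CARD('n) - 2)" by simp
      show "real m \<le> K0 * real R powr \<delta>" using K0R by (simp add: m_def)
    qed auto
    also have "\<dots> = 3 ^ (CARD('n) - 2) * K0 * (real R powr real (CARD('n) - 2) * real R powr \<delta>)"
      using R by (simp add: power_mult_distrib powr_realpow)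
    also have "real R powr real (CARD('n) - 2) * real R powr \<delta> = real R powr (real CARD('n) - 2 + \<delta>)"
      using dim by (simp add: of_nat_diff flip: powr_add)
    finally show "real (card {k \<in> lattice_sphere r. norm (int_vec k - int_vec k0) \<le> real R})
         \<le> 3 ^ (CARD('n) - 2) * K0 * real R powr (real CARD('n) - 2 + \<delta>)" by (simp add: A_def)
  qed
qed

lemma two_powr_power: "(2 powr a) ^ n = 2 powr (a * real n)" for a :: real
  by (simp add: powr_power mult.commute)

text \<open>A dyadic decomposition: the shell \<open>|l - k| \<le> 2 ^ i\<close> contains \<open>O(2 powr (i * (d - 2 + \<epsilon> / 2)))\<close>
  points, each of weight \<open>O(2 powr (- i * (d - 2 + \<epsilon>)))\<close>, so the shells form a geometric series
  of ratio \<open>2 powr (- \<epsilon> / 2)\<close> that starts at \<open>i = J\<close>.\<close>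

lemma lattice_sphere_tail_sum:
  fixes \<epsilon> :: real
  assumes eps: "\<epsilon> > 0" and dim: "CARD('n::finite) \<ge> 2"
  obtains K where "K \<ge> 0"
    "\<And>r (k :: int ^ 'n) (J::nat).
       (\<Sum>l | l \<in> lattice_sphere r \<and> 2 ^ J \<le> norm (int_vec l - int_vec k).
          norm (int_vec l - int_vec k) powr (- (real CARD('n) - 2 + \<epsilon>)))
         \<le> K * (2 powr (- \<epsilon> / 2)) ^ J"
proof -
  obtain K where K: "K \<ge> 1"
    "\<And>r (k0 :: int ^ 'n) (R::nat). R \<ge> 1 \<Longrightarrow>
       real (card {k \<in> lattice_sphere r. norm (int_vec k - int_vec k0) \<le> real R})
         \<le> K * real R powr (real CARD('n) - 2 + \<epsilon> / 2)"
    by (rule card_lattice_sphere_in_ball[OF half_gt_zero[OF eps] dim]) blast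
  define s where "s = real CARD('n) - 2 + \<epsilon>"
  define q where "q = 2 powr (- \<epsilon> / 2)"
  have s0: "s > 0" using assms by (simp add: s_def)
  have q: "0 < q" "q < 1" using eps by (auto simp: q_def powr_less_one)
  show ?thesis
  proof (rule that)
    show "2 powr s * K / (1 - q) \<ge> 0" using q K by simp
    fix r and k :: "int ^ 'n" and J :: nat
    define x where "x l = norm (int_vec l - int_vec k)" for l
    define S where "S = {l. l \<in> lattice_sphere r \<and> 2 ^ J \<le> x l}"
    \<comment> \<open>the index of the dyadic shell of \<open>l\<close>\<close>
    define j where "j l = nat \<lceil>log 2 (x l)\<rceil>" for l
    have finS: "finite S"
      by (rule finite_subset[OF _ finite_lattice_sphere[of r]]) (auto simp: S_def)
    have x1: "x l \<ge> 1" if "l \<in> S" for l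
    proof -
      have "(1::real) \<le> 2 ^ J" by (rule one_le_power) simp
      also have "\<dots> \<le> x l" using that by (simp add: S_def)
      finally show ?thesis .
    qed
    have upper: "x l \<le> 2 ^ j l" and lower: "2 ^ j l < 2 * x l" if "l \<in> S" for l
    proof -
      have l0: "log 2 (x l) \<ge> 0" using x1[OF that] by (simp add: zero_le_log_cancel_iff)
      have j: "real (j l) \<ge> log 2 (x l)" "real (j l) < log 2 (x l) + 1"
        using l0 unfolding j_def by linarith+
      have "x l = 2 powr log 2 (x l)" using x1[OF that] by simp
      also have "\<dots> \<le> 2 powr real (j l)" using j by (intro powr_mono) auto
      finally show "x l \<le> 2 ^ j l" by (simp add: powr_realpow)
      have "2 powr real (j l) < 2 powr (log 2 (x l) + 1)" using j by (intro powr_less_mono) auto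
      then show "2 ^ j l < 2 * x l" using x1[OF that] by (simp add: powr_realpow powr_add)
    qed
    have jJ: "J \<le> j l" if "l \<in> S" for l
    proof -
      have "2 ^ J \<le> x l" using that by (simp add: S_def)
      also have "\<dots> \<le> 2 ^ j l" by (rule upper[OF that])
      finally show ?thesis by simp
    qed
    define M where "M = Max (insert J (j ` S))"
    have jM: "j ` S \<subseteq> {J..M}" using finS jJ by (auto simp: M_def)
    have term_le: "x l powr (- s) \<le> 2 powr s * (2 powr (- s)) ^ j l" if "l \<in> S" for l
    proof -
      have "x l powr (- s) \<le> (2 ^ j l / 2) powr (- s)"
        using lower[OF that] s0 x1[OF that] by (intro powr_mono2') auto
      also have "\<dots> = 2 powr s * (2 powr (- s)) ^ j l"
      proof -
        have "(2 ^ j l / 2) powr (- s) = (2 powr (real (j l) - 1)) powr (- s)"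
          by (simp add: powr_diff powr_realpow)
        also have "\<dots> = 2 powr s * 2 powr (- s * real (j l))"
          by (simp only: powr_powr powr_add[symmetric]) (simp add: algebra_simps)
        finally show ?thesis by (simp only: two_powr_power)
      qed
      finally show ?thesis .
    qed
    have "(\<Sum>l\<in>S. x l powr (- s)) \<le> (\<Sum>l\<in>S. 2 powr s * (2 powr (- s)) ^ j l)"
      by (intro sum_mono term_le)
    also have "\<dots> = (\<Sum>i\<in>{J..M}. \<Sum>l | l \<in> S \<and> j l = i. 2 powr s * (2 powr (- s)) ^ j l)"
      using sum.group[OF finS _ jM, of "\<lambda>l. 2 powr s * (2 powr (- s)) ^ j l"] by simp
    also have "\<dots> \<le> (\<Sum>i\<in>{J..M}. 2 powr s * K * q ^ i)"
    proof (rule sum_mono)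
      fix i
      have "{l. l \<in> S \<and> j l = i} \<subseteq> {l \<in> lattice_sphere r. norm (int_vec l - int_vec k) \<le> real (2 ^ i)}"
        using upper by (auto simp: S_def x_def)
      then have "card {l. l \<in> S \<and> j l = i} \<le> card {l \<in> lattice_sphere r. norm (int_vec l - int_vec k) \<le> real (2 ^ i)}"
        by (intro card_mono) (auto intro: finite_subset[OF _ finite_lattice_sphere[of r]])
      then have "real (card {l. l \<in> S \<and> j l = i})
          \<le> real (card {l \<in> lattice_sphere r. norm (int_vec l - int_vec k) \<le> real (2 ^ i)})"
        by (simp only: of_nat_le_iff)
      also have "\<dots> \<le> K * real (2 ^ i) powr (real CARD('n) - 2 + \<epsilon> / 2)"
        by (rule K(2)) simp
      also have "real (2 ^ i) powr (real CARD('n) - 2 + \<epsilon> / 2) = (2 powr (s - \<epsilon> / 2)) ^ i"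
      proof -
        have "real (2 ^ i) = 2 powr real i" by (simp add: powr_realpow)
        moreover have "real CARD('n) - 2 + \<epsilon> / 2 = s - \<epsilon> / 2" by (simp add: s_def)
        ultimately show ?thesis by (simp only: powr_powr two_powr_power mult.commute)
      qed
      finally have *: "real (card {l. l \<in> S \<and> j l = i}) \<le> K * (2 powr (s - \<epsilon> / 2)) ^ i" .
      have "(\<Sum>l | l \<in> S \<and> j l = i. 2 powr s * (2 powr (- s)) ^ j l)
          = real (card {l. l \<in> S \<and> j l = i}) * (2 powr s * (2 powr (- s)) ^ i)"
        by simp
      also have "\<dots> \<le> K * (2 powr (s - \<epsilon> / 2)) ^ i * (2 powr s * (2 powr (- s)) ^ i)"
        using * by (intro mult_right_mono) auto
      also have "\<dots> = 2 powr s * K * ((2 powr (s - \<epsilon> / 2)) * (2 powr (- s))) ^ i"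
        by (simp add: power_mult_distrib)
      also have "2 powr (s - \<epsilon> / 2) * 2 powr (- s) = q"
        by (simp add: q_def flip: powr_add)
      finally show "(\<Sum>l | l \<in> S \<and> j l = i. 2 powr s * (2 powr (- s)) ^ j l) \<le> 2 powr s * K * q ^ i" .
    qed
    also have "\<dots> = 2 powr s * K * (\<Sum>i\<in>{J..M}. q ^ i)"
      by (simp add: sum_distrib_left)
    also have "(\<Sum>i\<in>{J..M}. q ^ i) \<le> q ^ J / (1 - q)"
      using q by (simp add: sum_gp divide_right_mono)
    finally show "(\<Sum>l | l \<in> lattice_sphere r \<and> 2 ^ J \<le> norm (int_vec l - int_vec k).
          norm (int_vec l - int_vec k) powr (- (real CARD('n) - 2 + \<epsilon>)))
         \<le> 2 powr s * K / (1 - q) * (2 powr (- \<epsilon> / 2)) ^ J"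
      using K(1) by (simp add: S_def x_def s_def q_def mult_left_mono)
  qed
qed

section \<open>Clusters on a sphere\<close>

lemma dist_le_of_inner_bound:
  fixes k y :: "'a::euclidean_space"
  assumes "0 \<le> D" "norm y = norm k" "\<bar>k \<bullet> (y - k)\<bar> \<le> D * norm (y - k)"
  shows "norm (y - k) \<le> 2 * D"
proof (cases "y = k")
  case True
  then show ?thesis using assms by simp
next
  case False
  have "(norm y)\<^sup>2 = (norm k)\<^sup>2 + 2 * (k \<bullet> (y - k)) + (norm (y - k))\<^sup>2"
    by (simp add: power2_norm_eq_inner inner_diff_left inner_diff_right inner_commute algebra_simps)
  then have "(norm (y - k))\<^sup>2 \<le> 2 * D * norm (y - k)"
    using assms by simp
  then show ?thesis using False by (simp add: power2_eq_square)
qed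

text \<open>The hypothesis on \<open>k\<close> says that the orthogonal projection of \<open>k\<close> to \<open>W\<close> has norm at most \<open>D\<close>.
  Points of equal norm in one coset of \<open>W\<close> have the same component orthogonal to \<open>W\<close>, hence
  projections to \<open>W\<close> of equal norm.\<close>

lemma inner_bound_coset_invariant:
  fixes k k' :: "'a::euclidean_space"
  assumes W: "subspace W" and k: "\<And>w. w \<in> W \<Longrightarrow> \<bar>k \<bullet> w\<bar> \<le> D * norm w"
    and k': "norm k' = norm k" "k' - k \<in> W" and w: "w \<in> W"
  shows "\<bar>k' \<bullet> w\<bar> \<le> D * norm w"
proof -
  have spanW: "span W = W" using W by (simp add: span_eq_iff)
  obtain p z where p: "p \<in> W" and z: "\<And>w. w \<in> W \<Longrightarrow> orthogonal z w" and kpz: "k = p + z"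
    by (rule orthogonal_subspace_decomp_exists[of W k]) (use spanW in auto)
  define p' where "p' = p + (k' - k)"
  have p': "p' \<in> W" and k'pz: "k' = p' + z"
    using subspace_add[OF W p k'(2)] by (auto simp: p'_def kpz)
  have pyth: "(norm (q + z))\<^sup>2 = (norm q)\<^sup>2 + (norm z)\<^sup>2" if "q \<in> W" for q
    using norm_add_Pythagorean[of q z] z[OF that] by (simp add: orthogonal_commute)
  have "norm p' = norm p"
    using pyth[OF p] pyth[OF p'] k' by (simp add: kpz[symmetric] k'pz[symmetric])
  have inner: "(q + z) \<bullet> u = q \<bullet> u" if "u \<in> W" for q u
    using z[OF that] by (simp add: inner_add_left orthogonal_def)
  have pD: "norm p \<le> D" if "p \<noteq> 0"
  proof -
    have "(norm p)\<^sup>2 \<le> D * norm p"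
      using k[OF p] inner[OF p, of p] by (simp add: kpz[symmetric] power2_norm_eq_inner)
    then show ?thesis using that by (simp add: power2_eq_square)
  qed
  have "\<bar>k' \<bullet> w\<bar> \<le> norm p * norm w"
    using inner[OF w, of p'] Cauchy_Schwarz_ineq2[of p' w] \<open>norm p' = norm p\<close> by (simp add: k'pz)
  also have "\<dots> \<le> D * norm w"
  proof (cases "p = 0")
    case True
    then show ?thesis using abs_ge_zero[of "k \<bullet> w"] k[OF w] by simp
  next
    case False
    then show ?thesis by (intro mult_right_mono pD) auto
  qed
  finally show ?thesis .
qed

lemma norm_add_scaleR_ge:
  fixes v :: "'a::euclidean_space"
  assumes W: "subspace W" and v: "v \<notin> W"
  shows "\<exists>\<kappa>>0. \<forall>w\<in>W. \<forall>a. \<kappa> * \<bar>a\<bar> \<le> norm (w + a *\<^sub>R v)"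
proof -
  have spanW: "span W = W" using W by (simp add: span_eq_iff)
  obtain p u where p: "p \<in> W" and u: "\<And>w. w \<in> W \<Longrightarrow> orthogonal u w" and vpu: "v = p + u"
    by (rule orthogonal_subspace_decomp_exists[of W v]) (use spanW in auto)
  have u0: "u \<noteq> 0" using v p vpu by auto
  have "norm u * \<bar>a\<bar> \<le> norm (w + a *\<^sub>R v)" if w: "w \<in> W" for w a
  proof -
    have "(w + a *\<^sub>R v) \<bullet> u = a * (norm u)\<^sup>2"
      using u[OF w] u[OF p]
      by (simp add: vpu inner_add_left inner_add_right orthogonal_def inner_commute power2_norm_eq_inner)
    then have "\<bar>a\<bar> * (norm u)\<^sup>2 \<le> norm (w + a *\<^sub>R v) * norm u"
      using Cauchy_Schwarz_ineq2[of "w + a *\<^sub>R v" u] by (simp add: abs_mult)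
    then show ?thesis using u0 by (simp add: power2_eq_square mult_ac)
  qed
  then show ?thesis using u0 by (intro exI[of _ "norm u"]) auto
qed

lemma finite_uniform_positive:
  fixes P :: "real \<Rightarrow> 'a \<Rightarrow> bool"
  assumes "finite A" "\<And>x. x \<in> A \<Longrightarrow> \<exists>\<kappa>>0. P \<kappa> x"
    and mono: "\<And>\<kappa> \<kappa>' x. P \<kappa> x \<Longrightarrow> 0 < \<kappa>' \<Longrightarrow> \<kappa>' \<le> \<kappa> \<Longrightarrow> P \<kappa>' x"
  shows "\<exists>\<kappa>>0. \<forall>x\<in>A. P \<kappa> x"
  using assms(1,2)
proof (induction A rule: finite_induct)
  case empty
  then show ?case by (intro exI[of _ 1]) auto
next
  case (insert x A)
  then obtain \<kappa>1 \<kappa>2 where *: "\<kappa>1 > 0" "P \<kappa>1 x" "\<kappa>2 > 0" "\<forall>y\<in>A. P \<kappa>2 y"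
    by (metis insert_iff)
  then have "P (min \<kappa>1 \<kappa>2) y" if "y \<in> insert x A" for y
    using that mono[of \<kappa>1 x "min \<kappa>1 \<kappa>2"] mono[of \<kappa>2 y "min \<kappa>1 \<kappa>2"] by auto
  then show ?case using * by (intro exI[of _ "min \<kappa>1 \<kappa>2"]) auto
qed

text \<open>A single vector outside a subspace makes a positive angle with it, and finitely many vectors
  span only finitely many subspaces.\<close>

lemma uniform_norm_add_scaleR_ge:
  fixes V :: "'a::euclidean_space set"
  assumes "finite V"
  shows "\<exists>\<kappa>>0. \<forall>E\<subseteq>V. \<forall>v\<in>V. v \<notin> span E \<longrightarrow>
    (\<forall>w\<in>span E. \<forall>a. \<kappa> * \<bar>a\<bar> \<le> norm (w + a *\<^sub>R v))"
proof -
  have "\<exists>\<kappa>>0. \<forall>x\<in>{(E, v). E \<subseteq> V \<and> v \<in> V \<and> v \<notin> span E}.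
      \<forall>w\<in>span (fst x). \<forall>a. \<kappa> * \<bar>a\<bar> \<le> norm (w + a *\<^sub>R snd x)"
  proof (rule finite_uniform_positive)
    show "finite {(E, v). E \<subseteq> V \<and> v \<in> V \<and> v \<notin> span E}"
      by (rule finite_subset[of _ "Pow V \<times> V"]) (use assms in auto)
    show "\<exists>\<kappa>>0. \<forall>w\<in>span (fst x). \<forall>a. \<kappa> * \<bar>a\<bar> \<le> norm (w + a *\<^sub>R snd x)"
      if "x \<in> {(E, v). E \<subseteq> V \<and> v \<in> V \<and> v \<notin> span E}" for x
      using that norm_add_scaleR_ge[OF subspace_span] by (auto split: prod.splits)
    show "\<forall>w\<in>span (fst x). \<forall>a. \<kappa>' * \<bar>a\<bar> \<le> norm (w + a *\<^sub>R snd x)"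
      if "\<forall>w\<in>span (fst x). \<forall>a. \<kappa> * \<bar>a\<bar> \<le> norm (w + a *\<^sub>R snd x)" "\<kappa>' \<le> \<kappa>" for \<kappa> \<kappa>' x
      using that by (meson abs_ge_zero mult_right_mono order_trans)
  qed
  then show ?thesis by auto
qed

text \<open>Here \<open>V\<close> is the set of short steps, \<open>k0 + W\<close> cuts out a set of points of \<open>A\<close> that no short step
  leaves, and the section of the sphere by \<open>k0 + W\<close> is small. To find \<open>W\<close>, start from the zero
  subspace and, as long as some short step \<open>v\<close> between points of \<open>A\<close> starts in \<open>k0 + W\<close> and
  leaves it, add \<open>v\<close> to \<open>W\<close>. Both ends of the step have the same norm, so the starting point has
  inner product \<open>- |v|\<^sup>2 / 2\<close> with \<open>v\<close>. By \<open>uniform_norm_add_scaleR_ge\<close> a bound for its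
  projection to \<open>W\<close> then yields a bound for its projection to the enlarged space, with constants
  that only depend on \<open>V\<close>. The dimension grows at every step, so the process stops.\<close>

lemma sphere_cluster_bound:
  fixes V :: "'a::euclidean_space set"
  assumes "finite V"
  shows "\<exists>D. \<forall>A r k0. (\<forall>x\<in>A. norm x = r) \<and> k0 \<in> A \<longrightarrow>
    (\<exists>W. subspace W \<and> W \<subseteq> span {x - y |x y. x \<in> A \<and> y \<in> A} \<and>
       (\<forall>x\<in>A. \<forall>y\<in>A. x - k0 \<in> W \<and> y - x \<in> V \<longrightarrow> y - x \<in> W) \<and>
       (\<forall>y. norm y = r \<and> y - k0 \<in> W \<longrightarrow> norm (y - k0) \<le> D))"
proof -
  obtain \<kappa> where \<kappa>: "\<kappa> > 0" and all: "\<forall>E\<subseteq>V. \<forall>v\<in>V. v \<notin> span E \<longrightarrow>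
      (\<forall>w\<in>span E. \<forall>a. \<kappa> * \<bar>a\<bar> \<le> norm (w + a *\<^sub>R v))"
    using uniform_norm_add_scaleR_ge[OF assms] by (elim exE conjE)
  have \<kappa>V: "\<kappa> * \<bar>a\<bar> \<le> norm (w + a *\<^sub>R v)"
    if "E \<subseteq> V" "v \<in> V" "v \<notin> span E" "w \<in> span E" for E v w a
    using all that by simp
  obtain R where R: "R \<ge> 0" "\<And>v. v \<in> V \<Longrightarrow> norm v \<le> R"
    using finite_imp_bounded[OF assms] unfolding bounded_pos by (blast intro: less_imp_le)
  \<comment> \<open>\<open>D m\<close> bounds the projection to a subspace of dimension \<open>m\<close>.\<close>
  define D where "D = rec_nat 0 (\<lambda>_ t. t * (1 + R / \<kappa>) + R\<^sup>2 / (2 * \<kappa>))"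
  have D_Suc: "D (Suc m) = D m * (1 + R / \<kappa>) + R\<^sup>2 / (2 * \<kappa>)" for m by (simp add: D_def)
  have D0: "D m \<ge> 0" for m
  proof (induction m)
    case (Suc m)
    then show ?case using \<kappa> R(1) by (simp add: D_Suc)
  qed (simp add: D_def)
  have "D m \<le> D (Suc m)" for m
    using D0[of m] \<kappa> R by (simp add: D_Suc algebra_simps)
  then have Dmono: "D m \<le> D n" if "m \<le> n" for m n
    using that by (rule lift_Suc_mono_le)
  show ?thesis
  proof (intro exI[of _ "2 * D DIM('a)"] allI impI)
    fix A :: "'a set" and r k0 assume A: "(\<forall>x\<in>A. norm x = r) \<and> k0 \<in> A"
    define \<Delta> where "\<Delta> = {x - y |x y. x \<in> A \<and> y \<in> A}"
    define P where "P E \<longleftrightarrow> E \<subseteq> V \<inter> \<Delta> \<and> (\<forall>w\<in>span E. \<bar>k0 \<bullet> w\<bar> \<le> D (dim E) * norm w)" for E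
    have "P {}" by (simp add: P_def)
    moreover have "\<forall>E. P E \<longrightarrow> dim E < Suc DIM('a)"
      by (intro allI impI le_imp_less_Suc dim_subset_UNIV)
    ultimately have "\<exists>E. P E \<and> (\<forall>E'. P E' \<longrightarrow> dim E' \<le> dim E)"
      by (rule ex_has_greatest_nat)
    then obtain E where E: "P E" and max: "\<And>E'. P E' \<Longrightarrow> dim E' \<le> dim E"
      by blast
    have EV: "E \<subseteq> V" "E \<subseteq> \<Delta>" using E by (auto simp: P_def)
    have closed: "y - x \<in> span E" if xy: "x \<in> A" "y \<in> A" "x - k0 \<in> span E" "y - x \<in> V" for x y
    proof (rule ccontr)
      define v where "v = y - x"
      assume "y - x \<notin> span E"
      then have v: "v \<notin> span E" "v \<in> V" "v \<in> \<Delta>" using xy by (auto simp: v_def \<Delta>_def)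
      have dimE: "dim (insert v E) = Suc (dim E)"
        using v by (simp add: dim_insert)
      have xE: "\<bar>x \<bullet> w\<bar> \<le> D (dim E) * norm w" if "w \<in> span E" for w
        using inner_bound_coset_invariant[of "span E" k0 "D (dim E)" x w] E xy A that by (auto simp: P_def)
      have "(norm y)\<^sup>2 = (norm x)\<^sup>2 + 2 * (x \<bullet> v) + (norm v)\<^sup>2"
        by (simp add: v_def power2_norm_eq_inner inner_diff_left inner_diff_right inner_commute algebra_simps)
      then have "x \<bullet> v = - ((norm v)\<^sup>2 / 2)" using A xy by simp
      then have "\<bar>x \<bullet> v\<bar> = (norm v)\<^sup>2 / 2" by simp
      also have "\<dots> \<le> R\<^sup>2 / 2" using R v by (simp add: power_mono)
      finally have xv: "\<bar>x \<bullet> v\<bar> \<le> R\<^sup>2 / 2" .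
      have xE': "\<bar>x \<bullet> u\<bar> \<le> D (Suc (dim E)) * norm u" if uE: "u \<in> span (insert v E)" for u
      proof -
        obtain a where a: "u - a *\<^sub>R v \<in> span E"
          using uE unfolding span_breakdown_eq by blast
        define w where "w = u - a *\<^sub>R v"
        have w: "w \<in> span E" and u: "u = w + a *\<^sub>R v" using a by (auto simp: w_def)
        have a_le: "\<bar>a\<bar> \<le> norm u / \<kappa>"
          using \<kappa>V[OF EV(1) v(2,1) w, of a] \<kappa> by (simp add: u field_simps)
        have "norm w \<le> norm u + \<bar>a\<bar> * norm v"
          using norm_triangle_ineq4[of u "a *\<^sub>R v"] by (simp add: w_def)
        also have "\<dots> \<le> norm u + norm u / \<kappa> * R"
          using a_le R v \<kappa> by (intro add_left_mono mult_mono) auto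
        finally have w_le: "norm w \<le> norm u * (1 + R / \<kappa>)" by (simp add: algebra_simps)
        have "\<bar>x \<bullet> u\<bar> \<le> \<bar>x \<bullet> w\<bar> + \<bar>a\<bar> * \<bar>x \<bullet> v\<bar>"
          using abs_triangle_ineq[of "x \<bullet> w" "a * (x \<bullet> v)"] by (simp add: u inner_add_right abs_mult)
        also have "\<dots> \<le> D (dim E) * (norm u * (1 + R / \<kappa>)) + norm u / \<kappa> * (R\<^sup>2 / 2)"
        proof (rule add_mono)
          show "\<bar>x \<bullet> w\<bar> \<le> D (dim E) * (norm u * (1 + R / \<kappa>))"
            by (rule order_trans[OF xE[OF w] mult_left_mono[OF w_le D0]])
          show "\<bar>a\<bar> * \<bar>x \<bullet> v\<bar> \<le> norm u / \<kappa> * (R\<^sup>2 / 2)"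
            using a_le xv \<kappa> by (intro mult_mono) auto
        qed
        finally show ?thesis by (simp add: D_Suc algebra_simps)
      qed
      have "P (insert v E)"
        unfolding P_def dimE
      proof (intro conjI ballI)
        show "insert v E \<subseteq> V \<inter> \<Delta>" using v EV by auto
        fix w assume w: "w \<in> span (insert v E)"
        have "k0 - x \<in> span (insert v E)"
          using span_neg[OF xy(3)] span_mono[of E "insert v E"] by (auto simp: algebra_simps)
        then show "\<bar>k0 \<bullet> w\<bar> \<le> D (Suc (dim E)) * norm w"
          using inner_bound_coset_invariant[OF subspace_span xE' _ _ w, of k0] A xy by auto
      qed
      from max[OF this] show False using dimE by simp
    qed
    show "\<exists>W. subspace W \<and> W \<subseteq> span {x - y |x y. x \<in> A \<and> y \<in> A} \<and>
       (\<forall>x\<in>A. \<forall>y\<in>A. x - k0 \<in> W \<and> y - x \<in> V \<longrightarrow> y - x \<in> W) \<and>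
       (\<forall>y. norm y = r \<and> y - k0 \<in> W \<longrightarrow> norm (y - k0) \<le> 2 * D DIM('a))"
    proof (intro exI[of _ "span E"] conjI ballI allI impI)
      show "subspace (span E)" by simp
      show "span E \<subseteq> span {x - y |x y. x \<in> A \<and> y \<in> A}"
        using EV(2) unfolding \<Delta>_def by (rule span_mono)
      show "y - x \<in> span E" if "x \<in> A" "y \<in> A" "x - k0 \<in> span E \<and> y - x \<in> V" for x y
        using closed that by auto
      fix y assume y: "norm y = r \<and> y - k0 \<in> span E"
      have "norm (y - k0) \<le> 2 * D (dim E)"
        using y A E D0 by (intro dist_le_of_inner_bound) (auto simp: P_def)
      also have "\<dots> \<le> 2 * D DIM('a)"
        using Dmono[OF dim_subset_UNIV, of E] by simp
      finally show "norm (y - k0) \<le> 2 * D DIM('a)" .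
    qed
  qed
qed

section \<open>Trigonometric polynomials on the torus\<close>

lemma torus_char_proj: "torus_char k (torus_proj x) = cis (2 * pi * (int_vec k \<bullet> x))"
  by (simp add: torus_char.abs_eq cis_conv_exp mult_ac)

lemma torus_proj_surj: obtains x where "p = torus_proj x"
  by (metis Quotient_torus Quotient_abs_rep)

lemma int_vec_diff: "int_vec (k - l) = int_vec k - int_vec l"
  using int_vec_add[of k "- l"] by (simp add: int_vec_uminus)

lemma torus_char_0 [simp]: "torus_char 0 p = 1"
  by (rule torus_proj_surj[of p]) (simp add: torus_char_proj int_vec_0)

lemma torus_char_add: "torus_char (k + l) p = torus_char k p * torus_char l p"
  by (rule torus_proj_surj[of p]) (simp add: torus_char_proj int_vec_add inner_add_left cis_mult distrib_left)

lemma torus_char_uminus: "torus_char (- k) p = cnj (torus_char k p)"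
  by (rule torus_proj_surj[of p]) (simp add: torus_char_proj int_vec_uminus cis_cnj)

lemma norm_torus_char [simp]: "cmod (torus_char k p) = 1"
  by (rule torus_proj_surj[of p]) (simp add: torus_char_proj)

lemma torus_char_mult_cnj: "torus_char k p * cnj (torus_char l p) = torus_char (k - l) p"
  using torus_char_add[of k "- l" p] by (simp add: torus_char_uminus)

lemma torus_char_measurable [measurable]: "torus_char k \<in> borel_measurable borel"
proof (rule borel_measurable_continuous_onI)
  have "continuous_on UNIV (\<lambda>x. torus_char k (torus_proj x))"
    unfolding torus_char_proj by (intro continuous_intros)
  then show "continuous_on UNIV (torus_char k)"
    by (simp add: continuous_on_open_vimage open_torus_def vimage_def)
qed

definition trig_poly :: "(int ^ 'n) set \<Rightarrow> (int ^ 'n \<Rightarrow> complex) \<Rightarrow> ('n::finite) torus \<Rightarrow> complex" where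
  "trig_poly A b p = (\<Sum>k\<in>A. b k * torus_char k p)"

lemma trig_poly_measurable [measurable]: "trig_poly A b \<in> borel_measurable borel"
  unfolding trig_poly_def by measurable

definition energy :: "('n::finite) torus measure \<Rightarrow> (int ^ 'n) set \<Rightarrow> (int ^ 'n \<Rightarrow> complex) \<Rightarrow> real" where
  "energy M A b = (\<integral>p. (cmod (trig_poly A b p))\<^sup>2 \<partial>M)"

lemma energy_nonneg: "energy M A b \<ge> 0"
  by (simp add: energy_def)

locale torus_prob = prob_space M for M :: "('n::finite) torus measure" +
  assumes sets_M [measurable_cong]: "sets M = sets borel"
begin

lemma integrable_torus_char: "integrable M (torus_char k)"
  by (rule integrable_const_bound[where B = 1]) (auto simp: measurable_cong_sets[OF sets_M refl])

lemma integral_torus_char: "(\<integral>p. torus_char k p \<partial>M) = fourier_coeff M (- k)"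
  by (simp add: fourier_coeff_def)

lemma fourier_coeff_0: "fourier_coeff M 0 = 1"
  by (simp add: fourier_coeff_def prob_space)

lemma fourier_coeff_uminus: "fourier_coeff M (- k) = cnj (fourier_coeff M k)"
proof -
  have "fourier_coeff M (- k) = (\<integral>p. cnj (torus_char (- k) p) \<partial>M)"
    by (simp add: fourier_coeff_def torus_char_uminus)
  then show ?thesis unfolding fourier_coeff_def by simp
qed

lemma norm_fourier_coeff_commute: "cmod (fourier_coeff M (k - l)) = cmod (fourier_coeff M (l - k))"
  using fourier_coeff_uminus[of "l - k"] by simp

lemma norm_square_trig_poly:
  "of_real ((cmod (trig_poly A b p))\<^sup>2) = (\<Sum>k\<in>A. \<Sum>l\<in>A. b k * cnj (b l) * torus_char (k - l) p)"
proof -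
  have "of_real ((cmod (trig_poly A b p))\<^sup>2) = trig_poly A b p * cnj (trig_poly A b p)"
    by (rule complex_norm_square)
  also have "\<dots> = (\<Sum>k\<in>A. \<Sum>l\<in>A. (b k * torus_char k p) * cnj (b l * torus_char l p))"
    by (simp add: trig_poly_def sum_product)
  also have "\<dots> = (\<Sum>k\<in>A. \<Sum>l\<in>A. b k * cnj (b l) * torus_char (k - l) p)"
    by (intro sum.cong refl) (simp add: torus_char_mult_cnj[symmetric] mult_ac)
  finally show ?thesis .
qed

lemma energy_eq:
  "of_real (energy M A b) = (\<Sum>k\<in>A. \<Sum>l\<in>A. b k * cnj (b l) * fourier_coeff M (l - k))"
proof -
  have "complex_of_real (energy M A b) = (\<integral>p. of_real ((cmod (trig_poly A b p))\<^sup>2) \<partial>M)"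
    unfolding energy_def by (rule integral_complex_of_real[symmetric])
  also have "\<dots> = (\<integral>p. (\<Sum>k\<in>A. \<Sum>l\<in>A. b k * cnj (b l) * torus_char (k - l) p) \<partial>M)"
    by (simp only: norm_square_trig_poly)
  also have "\<dots> = (\<Sum>k\<in>A. \<Sum>l\<in>A. b k * cnj (b l) * fourier_coeff M (l - k))"
    by (simp add: Bochner_Integration.integral_sum integrable_torus_char integral_torus_char)
  finally show ?thesis .
qed

lemma energy_eq_Re:
  "energy M A b = (\<Sum>k\<in>A. \<Sum>l\<in>A. Re (b k * cnj (b l) * fourier_coeff M (l - k)))"
  using arg_cong[OF energy_eq[of A b], of Re] by simp

end

lemma integral_cis_unit_interval:
  "integrable lborel (\<lambda>t. indicator {0..<1} t *\<^sub>R cis (2 * pi * real_of_int m * t))" (is ?int)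
  "(\<integral>t. indicator {0..<1} t *\<^sub>R cis (2 * pi * real_of_int m * t) \<partial>lborel) = (if m = 0 then 1 else 0)" (is ?eq)
proof -
  let ?f = "\<lambda>t. cis (2 * pi * real_of_int m * t)"
  define F where "F t = (if m = 0 then complex_of_real t else ?f t / (2 * pi * real_of_int m * \<i>))" for t
  have deriv: "(F has_vector_derivative ?f t) (at t within {0..1})" for t
  proof (cases "m = 0")
    case True
    then show ?thesis
      unfolding F_def[abs_def] by (auto intro!: derivative_eq_intros)
  next
    case False
    define z where "z = 2 * complex_of_real pi * of_int m * \<i>"
    have "z \<noteq> 0" using False by (simp add: z_def)
    have f: "?f = (\<lambda>t. exp (t *\<^sub>R z))"
      by (simp add: fun_eq_iff cis_conv_exp z_def scaleR_conv_of_real mult_ac)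
    have "F = (\<lambda>t. exp (t *\<^sub>R z) / z)"
      using False fun_cong[OF f] by (simp add: fun_eq_iff F_def z_def)
    moreover have "((\<lambda>t. exp (t *\<^sub>R z) / z) has_vector_derivative exp (t *\<^sub>R z) * z / z) (at t within {0..1})"
      by (intro has_vector_derivative_divide exp_scaleR_has_vector_derivative_right)
    ultimately show ?thesis
      using \<open>z \<noteq> 0\<close> fun_cong[OF f, of t] by simp
  qed
  have [measurable]: "?f \<in> borel_measurable borel"
    by (intro borel_measurable_continuous_onI continuous_intros)
  have "(\<integral>t. indicator {0..<1} t *\<^sub>R ?f t \<partial>lborel) = (\<integral>t. indicator {0..1} t *\<^sub>R ?f t \<partial>lborel)"
    using AE_lborel_singleton[of "1::real"] by (intro integral_cong_AE) (auto elim!: eventually_mono split: split_indicator)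
  also have "\<dots> = F 1 - F 0"
    by (intro integral_FTC_Icc deriv continuous_intros) auto
  also have "\<dots> = (if m = 0 then 1 else 0)"
    by (simp add: F_def cis_multiple_2pi)
  finally show ?eq .
  show ?int
    by (rule Bochner_Integration.integrable_bound[where f = "indicator {0..<1} :: real \<Rightarrow> real"])
      (auto split: split_indicator)
qed

lemma unit_cube_measurable [measurable]: "{x :: real ^ 'n. \<forall>i. 0 \<le> x $ i \<and> x $ i < 1} \<in> sets borel"
proof -
  have [measurable]: "(\<lambda>x :: real ^ 'n. x $ i) \<in> borel_measurable borel" for i
    by (intro borel_measurable_continuous_onI continuous_intros)
  have "{x \<in> space borel. \<forall>i\<in>UNIV. 0 \<le> x $ i \<and> x $ i < 1} \<in> sets (borel :: (real ^ 'n) measure)"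
    by (rule sets.sets_Collect_finite_All) measurable
  then show ?thesis by simp
qed

text \<open>The half-open unit cube lies between the open and the closed one, which have volume \<open>1\<close>.\<close>

lemma torus_lebesgue_prob: "torus_prob (torus_lebesgue :: ('n::finite) torus measure)"
proof -
  let ?Q = "{x :: real ^ 'n. \<forall>i. 0 \<le> x $ i \<and> x $ i < 1}"
  define v :: "real ^ 'n" where "v = (\<chi> i. 1)"
  have v: "v \<bullet> b = 1" if "b \<in> Basis" for b
    using that by (auto simp: Basis_vec_def v_def inner_axis)
  have "box 0 v \<subseteq> ?Q" "?Q \<subseteq> cbox 0 v"
    by (auto simp: mem_box_cart v_def less_imp_le)
  then have "emeasure lborel (box 0 v) \<le> emeasure lborel ?Q"
    "emeasure lborel ?Q \<le> emeasure lborel (cbox 0 v)"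
    by (intro emeasure_mono; simp)+
  then have "emeasure lborel ?Q = 1"
    by (simp add: emeasure_lborel_box_eq emeasure_lborel_cbox_eq v)
  then have "prob_space (restrict_space lborel ?Q)"
    by (intro prob_spaceI) (simp add: space_restrict_space emeasure_restrict_space)
  then have "prob_space (torus_lebesgue :: 'n torus measure)"
    unfolding torus_lebesgue_def by (intro prob_space.prob_space_distr measurable_restrict_space1) auto
  then show ?thesis
    by (simp add: torus_prob_def torus_prob_axioms_def torus_lebesgue_def)
qed

text \<open>In coordinates the character is a product of functions of one variable, and the integral over
  the cube factors accordingly.\<close>

lemma fourier_coeff_torus_lebesgue:
  "fourier_coeff torus_lebesgue (k :: int ^ 'n::finite) = (if k = 0 then 1 else 0)"
proof -
  let ?Q = "{x :: real ^ 'n. \<forall>i. 0 \<le> x $ i \<and> x $ i < 1}"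
  define m where "m b = \<lfloor>int_vec (- k) \<bullet> b\<rfloor>" for b :: "real ^ 'n"
  have axis: "int_vec (- k) \<bullet> axis i 1 = real_of_int (- k $ i)" for i
    by (simp add: inner_axis int_vec_def)
  have Basis: "(Basis :: (real ^ 'n) set) = range (\<lambda>i. axis i 1)"
    by (auto simp: Basis_vec_def)
  have m: "int_vec (- k) \<bullet> b = real_of_int (m b)" if "b \<in> Basis" for b :: "real ^ 'n"
    using that by (auto simp: Basis m_def axis)
  let ?g = "\<lambda>b t. indicator {0..<1} t *\<^sub>R cis (2 * pi * real_of_int (m b) * t)"
  have prod: "indicator ?Q (\<Sum>b\<in>Basis. f b *\<^sub>R b) *\<^sub>R cis (2 * pi * (int_vec (- k) \<bullet> (\<Sum>b\<in>Basis. f b *\<^sub>R b)))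
      = (\<Prod>b\<in>Basis. ?g b (f b))" for f :: "real ^ 'n \<Rightarrow> real"
  proof -
    define x where "x = (\<Sum>b\<in>Basis. f b *\<^sub>R b)"
    have xb: "x \<bullet> b = f b" if "b \<in> Basis" for b
      using that by (simp add: x_def inner_sum_left_Basis)
    have "x \<in> ?Q \<longleftrightarrow> (\<forall>b\<in>Basis. x \<bullet> b \<in> {0..<1})"
      by (auto simp: Basis inner_axis)
    also have "\<dots> \<longleftrightarrow> (\<forall>b\<in>Basis. f b \<in> {0..<1})"
      using xb by simp
    finally have "indicator ?Q x = (\<Prod>b\<in>Basis. indicator {0..<1} (f b) :: real)"
      by (auto simp: indicator_def intro!: prod_zero[symmetric])
    moreover have "cis (2 * pi * (int_vec (- k) \<bullet> x)) = (\<Prod>b\<in>Basis. cis (2 * pi * real_of_int (m b) * f b))"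
    proof -
      have "int_vec (- k) \<bullet> x = (\<Sum>b\<in>Basis. real_of_int (m b) * f b)"
        by (simp add: x_def inner_sum_right m mult.commute)
      then have "\<i> * complex_of_real (2 * pi * (int_vec (- k) \<bullet> x))
          = (\<Sum>b\<in>Basis. \<i> * complex_of_real (2 * pi * real_of_int (m b) * f b))"
        by (simp add: sum_distrib_left mult_ac)
      then show ?thesis unfolding cis_conv_exp by (simp only: exp_sum[OF finite_Basis])
    qed
    ultimately show ?thesis
      unfolding x_def by (simp add: scaleR_conv_of_real prod.distrib)
  qed
  interpret product_sigma_finite "\<lambda>_::real ^ 'n. lborel :: real measure"
    by standard
  have "fourier_coeff torus_lebesgue k = (\<integral>x. torus_char (- k) (torus_proj x) \<partial>restrict_space lborel ?Q)"
    unfolding fourier_coeff_def torus_lebesgue_def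
    by (intro integral_distr measurable_restrict_space1) auto
  also have "\<dots> = (\<integral>x. indicator ?Q x *\<^sub>R cis (2 * pi * (int_vec (- k) \<bullet> x)) \<partial>lborel)"
    by (subst integral_restrict_space) (auto simp: torus_char_proj)
  also have "\<dots> = (\<integral>f. (\<Prod>b\<in>Basis. ?g b (f b)) \<partial>Pi\<^sub>M Basis (\<lambda>_. lborel))"
  proof -
    have "(\<lambda>f. \<Sum>b\<in>Basis. f b *\<^sub>R b) \<in> measurable (Pi\<^sub>M Basis (\<lambda>_. lborel)) (borel :: (real ^ 'n) measure)"
      by measurable
    moreover have "(\<lambda>x. indicator ?Q x *\<^sub>R cis (2 * pi * (int_vec (- k) \<bullet> x))) \<in> borel_measurable borel"
    proof -
      have "(\<lambda>x. cis (2 * pi * (int_vec (- k) \<bullet> x))) \<in> borel_measurable borel"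
        by (intro borel_measurable_continuous_onI continuous_intros)
      then show ?thesis by (intro borel_measurable_scaleR borel_measurable_indicator unit_cube_measurable)
    qed
    ultimately show ?thesis
      unfolding lborel_eq[where 'a = "real ^ 'n"] by (subst integral_distr) (simp_all only: prod)
  qed
  also have "\<dots> = (\<Prod>b\<in>Basis. \<integral>t. ?g b t \<partial>lborel)"
    by (intro product_integral_prod integral_cis_unit_interval) auto
  also have "\<dots> = (\<Prod>b\<in>Basis. if m b = 0 then 1 else 0)"
    by (intro prod.cong refl integral_cis_unit_interval)
  also have "\<dots> = (if \<forall>b\<in>Basis. m b = 0 then 1 else 0)"
    by auto
  also have "(\<forall>b\<in>Basis. m b = 0) \<longleftrightarrow> k = 0"
    by (auto simp: Basis m_def axis vec_eq_iff)
  finally show ?thesis .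
qed

lemma energy_torus_lebesgue:
  assumes "finite A"
  shows "energy torus_lebesgue A b = (\<Sum>k\<in>A. (cmod (b k))\<^sup>2)"
proof -
  interpret torus_prob torus_lebesgue by (rule torus_lebesgue_prob)
  have "complex_of_real (energy torus_lebesgue A b) = (\<Sum>k\<in>A. \<Sum>l\<in>A. if k = l then b k * cnj (b k) else 0)"
    unfolding energy_eq by (intro sum.cong refl) (simp add: fourier_coeff_torus_lebesgue)
  also have "\<dots> = of_real (\<Sum>k\<in>A. (cmod (b k))\<^sup>2)"
    unfolding of_real_sum complex_norm_square using assms by simp
  finally show ?thesis by (simp only: of_real_eq_iff)
qed

section \<open>Frequency sets with a lower bound, and their gluing\<close>

context torus_prob
begin

definition observes :: "real \<Rightarrow> (int ^ 'n) set \<Rightarrow> bool" where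
  "observes c A \<longleftrightarrow> (\<forall>b. c * (\<Sum>k\<in>A. (cmod (b k))\<^sup>2) \<le> energy M A b)"

lemma observes_subset:
  assumes "observes c A" "finite A" "B \<subseteq> A"
  shows "observes c B"
  unfolding observes_def
proof
  fix b :: "int ^ 'n \<Rightarrow> complex"
  define b' where "b' k = (if k \<in> B then b k else 0)" for k
  have "(\<Sum>k\<in>A. (cmod (b' k))\<^sup>2) = (\<Sum>k\<in>B. (cmod (b k))\<^sup>2)"
    using assms by (intro sum.mono_neutral_cong_right) (auto simp: b'_def)
  moreover have "trig_poly A b' = trig_poly B b"
    unfolding trig_poly_def using assms by (intro ext sum.mono_neutral_cong_right) (auto simp: b'_def)
  ultimately show "c * (\<Sum>k\<in>B. (cmod (b k))\<^sup>2) \<le> energy M B b"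
    using assms(1)[unfolded observes_def, rule_format, of b'] by (simp add: energy_def)
qed

lemma observes_mono:
  assumes "observes c A" "c' \<le> c"
  shows "observes c' A"
  unfolding observes_def
proof
  fix b
  have "c' * (\<Sum>k\<in>A. (cmod (b k))\<^sup>2) \<le> c * (\<Sum>k\<in>A. (cmod (b k))\<^sup>2)"
    using assms(2) by (intro mult_right_mono sum_nonneg) auto
  then show "c' * (\<Sum>k\<in>A. (cmod (b k))\<^sup>2) \<le> energy M A b"
    using assms(1)[unfolded observes_def, rule_format, of b] by linarith
qed

lemma observes_translate:
  assumes "observes c A"
  shows "observes c ((+) k0 ` A)"
  unfolding observes_def
proof
  fix b
  have inj: "inj_on ((+) k0) A" by simp
  have "energy M ((+) k0 ` A) b = energy M A (\<lambda>k. b (k0 + k))"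
    by (simp add: energy_eq_Re sum.reindex[OF inj])
  moreover have "(\<Sum>k\<in>(+) k0 ` A. (cmod (b k))\<^sup>2) = (\<Sum>k\<in>A. (cmod (b (k0 + k)))\<^sup>2)"
    by (simp add: sum.reindex[OF inj])
  ultimately show "c * (\<Sum>k\<in>(+) k0 ` A. (cmod (b k))\<^sup>2) \<le> energy M ((+) k0 ` A) b"
    using assms[unfolded observes_def, rule_format, of "\<lambda>k. b (k0 + k)"] by simp
qed

definition far_sum :: "real \<Rightarrow> (int ^ 'n) set \<Rightarrow> (int ^ 'n \<Rightarrow> complex) \<Rightarrow> real" where
  "far_sum \<rho> A b = (\<Sum>k\<in>A. \<Sum>l\<in>A. if \<rho> \<le> norm (int_vec l - int_vec k)
     then cmod (b k) * cmod (b l) * cmod (fourier_coeff M (l - k)) else 0)"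

text \<open>Schur's test for a symmetric kernel: bound \<open>|b k| * |b l|\<close> by the mean of the squares and use the
  row sums.\<close>

lemma far_sum_le:
  assumes A: "finite A"
    and \<delta>: "\<And>k. k \<in> A \<Longrightarrow> (\<Sum>l | l \<in> A \<and> \<rho> \<le> norm (int_vec l - int_vec k). cmod (fourier_coeff M (l - k))) \<le> \<delta>"
  shows "far_sum \<rho> A b \<le> \<delta> * (\<Sum>k\<in>A. (cmod (b k))\<^sup>2)"
proof -
  define m where "m k l = (if \<rho> \<le> norm (int_vec l - int_vec k) then cmod (fourier_coeff M (l - k)) else 0)" for k l
  have m_nonneg: "m k l \<ge> 0" for k l by (simp add: m_def)
  have m_sym: "m k l = m l k" for k l
    by (simp add: m_def norm_fourier_coeff_commute[of k l] norm_minus_commute)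
  have m_sum: "(\<Sum>l\<in>A. m k l) \<le> \<delta>" if "k \<in> A" for k
    using \<delta>[OF that] unfolding m_def by (simp only: sum.inter_filter[OF A])
  have "far_sum \<rho> A b = (\<Sum>k\<in>A. \<Sum>l\<in>A. cmod (b k) * cmod (b l) * m k l)"
    unfolding far_sum_def by (intro sum.cong refl) (simp add: m_def)
  also have "\<dots> \<le> (\<Sum>k\<in>A. \<Sum>l\<in>A. (cmod (b k))\<^sup>2 / 2 * m k l + (cmod (b l))\<^sup>2 / 2 * m l k)"
  proof (intro sum_mono)
    fix k l
    have "cmod (b k) * cmod (b l) \<le> (cmod (b k))\<^sup>2 / 2 + (cmod (b l))\<^sup>2 / 2"
      using sum_squares_bound[of "cmod (b k)" "cmod (b l)"] by simp
    then have "cmod (b k) * cmod (b l) * m k l \<le> ((cmod (b k))\<^sup>2 / 2 + (cmod (b l))\<^sup>2 / 2) * m k l"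
      by (intro mult_right_mono m_nonneg)
    then show "cmod (b k) * cmod (b l) * m k l \<le> (cmod (b k))\<^sup>2 / 2 * m k l + (cmod (b l))\<^sup>2 / 2 * m l k"
      by (simp only: distrib_right m_sym[of l k])
  qed
  also have "\<dots> = (\<Sum>k\<in>A. \<Sum>l\<in>A. (cmod (b k))\<^sup>2 / 2 * m k l) + (\<Sum>k\<in>A. \<Sum>l\<in>A. (cmod (b l))\<^sup>2 / 2 * m l k)"
    by (simp add: sum.distrib)
  also have "(\<Sum>k\<in>A. \<Sum>l\<in>A. (cmod (b l))\<^sup>2 / 2 * m l k) = (\<Sum>k\<in>A. \<Sum>l\<in>A. (cmod (b k))\<^sup>2 / 2 * m k l)"
    by (rule sum.swap)
  also have "(\<Sum>k\<in>A. \<Sum>l\<in>A. (cmod (b k))\<^sup>2 / 2 * m k l) + (\<Sum>k\<in>A. \<Sum>l\<in>A. (cmod (b k))\<^sup>2 / 2 * m k l)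
      = (\<Sum>k\<in>A. (cmod (b k))\<^sup>2 * (\<Sum>l\<in>A. m k l))"
    unfolding sum.distrib[symmetric] sum_distrib_left by (intro sum.cong refl) (auto simp: field_simps)
  also have "\<dots> \<le> (\<Sum>k\<in>A. (cmod (b k))\<^sup>2 * \<delta>)"
    by (intro sum_mono mult_left_mono m_sum) auto
  finally show ?thesis by (simp add: sum_distrib_left mult.commute)
qed

text \<open>Remove one isolated cluster \<open>B\<close> at a time. All terms that couple \<open>B\<close> to the rest are far terms,
  and what remains of any other cluster is still isolated in what remains of \<open>A\<close>, so no
  partition has to be fixed in advance.\<close>

lemma energy_ge_of_isolated_clusters:
  assumes "finite A"
    and "\<And>k. k \<in> A \<Longrightarrow> \<exists>B. k \<in> B \<and> B \<subseteq> A \<and> observes c B \<and>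
           (\<forall>x\<in>B. \<forall>y\<in>A - B. \<rho> \<le> norm (int_vec y - int_vec x))"
  shows "c * (\<Sum>k\<in>A. (cmod (b k))\<^sup>2) - far_sum \<rho> A b \<le> energy M A b"
  using assms
proof (induction A rule: finite_psubset_induct)
  case (psubset A)
  show ?case
  proof (cases "A = {}")
    case True
    then show ?thesis by (simp add: far_sum_def energy_nonneg)
  next
    case False
    then obtain k0 where "k0 \<in> A" by blast
    from psubset.prems[OF this] obtain B where B: "k0 \<in> B" "B \<subseteq> A" "observes c B"
      and iso: "\<forall>x\<in>B. \<forall>y\<in>A - B. \<rho> \<le> norm (int_vec y - int_vec x)"
      by blast
    define A' where "A' = A - B"
    have fin: "finite B" "finite A'" using psubset.hyps B by (auto simp: A'_def intro: finite_subset)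
    have AB: "A = B \<union> A'" "B \<inter> A' = {}" using B by (auto simp: A'_def)
    have "A' \<subset> A" using B \<open>k0 \<in> A\<close> by (auto simp: A'_def)
    then have IH: "c * (\<Sum>k\<in>A'. (cmod (b k))\<^sup>2) - far_sum \<rho> A' b \<le> energy M A' b"
    proof (rule psubset.IH)
      fix k assume k: "k \<in> A'"
      then have "k \<in> A" by (simp add: A'_def)
      from psubset.prems[OF this] obtain B' where B': "k \<in> B'" "B' \<subseteq> A" "observes c B'"
        and iso': "\<forall>x\<in>B'. \<forall>y\<in>A - B'. \<rho> \<le> norm (int_vec y - int_vec x)"
        by blast
      have "observes c (B' - B)"
        using B' psubset.hyps by (intro observes_subset[OF B'(3)]) (auto intro: finite_subset)
      then show "\<exists>B. k \<in> B \<and> B \<subseteq> A' \<and> observes c B \<and>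
           (\<forall>x\<in>B. \<forall>y\<in>A' - B. \<rho> \<le> norm (int_vec y - int_vec x))"
        using k B' iso' by (intro exI[of _ "B' - B"]) (auto simp: A'_def)
    qed
    define h where "h k l = Re (b k * cnj (b l) * fourier_coeff M (l - k))" for k l
    define g where "g k l = (if \<rho> \<le> norm (int_vec l - int_vec k)
      then cmod (b k) * cmod (b l) * cmod (fourier_coeff M (l - k)) else 0)" for k l
    have split: "(\<Sum>k\<in>A. \<Sum>l\<in>A. f k l) = (\<Sum>k\<in>B. \<Sum>l\<in>B. f k l) + (\<Sum>k\<in>A'. \<Sum>l\<in>A'. f k l)
        + ((\<Sum>k\<in>B. \<Sum>l\<in>A'. f k l) + (\<Sum>k\<in>A'. \<Sum>l\<in>B. f k l))" for f :: "int ^ 'n \<Rightarrow> int ^ 'n \<Rightarrow> real"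
      unfolding AB(1) using fin AB(2) by (simp add: sum.union_disjoint sum.distrib)
    have hg: "- g k l \<le> h k l" if "k \<in> B \<and> l \<in> A' \<or> k \<in> A' \<and> l \<in> B" for k l
    proof -
      have "\<rho> \<le> norm (int_vec l - int_vec k)"
        using that iso by (auto simp: A'_def norm_minus_commute)
      then have "g k l = cmod (b k * cnj (b l) * fourier_coeff M (l - k))"
        by (simp add: g_def norm_mult)
      then show ?thesis
        using abs_Re_le_cmod[of "b k * cnj (b l) * fourier_coeff M (l - k)"] unfolding h_def by linarith
    qed
    have "- (\<Sum>k\<in>B. \<Sum>l\<in>A'. g k l) \<le> (\<Sum>k\<in>B. \<Sum>l\<in>A'. h k l)"
      using hg unfolding sum_negf[symmetric] by (intro sum_mono) auto
    moreover have "- (\<Sum>k\<in>A'. \<Sum>l\<in>B. g k l) \<le> (\<Sum>k\<in>A'. \<Sum>l\<in>B. h k l)"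
      using hg unfolding sum_negf[symmetric] by (intro sum_mono) auto
    moreover have "energy M X b = (\<Sum>k\<in>X. \<Sum>l\<in>X. h k l)" "far_sum \<rho> X b = (\<Sum>k\<in>X. \<Sum>l\<in>X. g k l)" for X
      by (simp_all add: energy_eq_Re h_def far_sum_def g_def)
    moreover have "0 \<le> (\<Sum>k\<in>B. \<Sum>l\<in>B. g k l)"
      by (intro sum_nonneg) (simp add: g_def)
    moreover have "c * (\<Sum>k\<in>B. (cmod (b k))\<^sup>2) \<le> energy M B b"
      using B(3) by (simp add: observes_def)
    moreover have "(\<Sum>k\<in>A. (cmod (b k))\<^sup>2) = (\<Sum>k\<in>B. (cmod (b k))\<^sup>2) + (\<Sum>k\<in>A'. (cmod (b k))\<^sup>2)"
      unfolding AB(1) using fin AB(2) by (intro sum.union_disjoint)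
    ultimately show ?thesis
      using IH split[of h] split[of g] by (simp add: distrib_left)
  qed
qed

end

section \<open>Mass of the cells of a grid\<close>

lemma bij_betw_vec_nth_PiE:
  "bij_betw vec_nth {k :: 'a ^ 'n::finite. \<forall>i. k $ i \<in> S i} (PiE UNIV S)"
  by (rule bij_betw_byWitness[where f' = vec_lambda]) (auto simp: vec_lambda_eta)

lemma card_vec_box: "card {k :: 'a ^ 'n::finite. \<forall>i. k $ i \<in> S i} = (\<Prod>i\<in>UNIV. card (S i))"
  using bij_betw_same_card[OF bij_betw_vec_nth_PiE[of S]] by (simp add: card_PiE)

lemma finite_vec_box:
  assumes "\<And>i. finite (S i)"
  shows "finite {k :: 'a ^ 'n::finite. \<forall>i. k $ i \<in> S i}"
  using bij_betw_finite[OF bij_betw_vec_nth_PiE[of S]] assms by (simp add: finite_PiE)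

text \<open>A measurable choice of representatives in \<open>[-1/2, 1/2]^d\<close>.\<close>

definition coord :: "('n::finite) torus \<Rightarrow> real ^ 'n" where
  "coord p = (\<chi> i. Im (Ln (torus_char (axis i 1) p)) / (2 * pi))"

lemma coord_measurable [measurable]: "(\<lambda>p. coord p $ i) \<in> borel_measurable borel"
  unfolding coord_def vec_lambda_beta by measurable

lemma abs_coord_le: "\<bar>coord p $ i\<bar> \<le> 1 / 2"
proof -
  have nz: "torus_char (axis i 1) p \<noteq> 0"
    using norm_torus_char[of "axis i 1" p] by force
  have "\<bar>Im (Ln (torus_char (axis i 1) p))\<bar> \<le> pi"
    using mpi_less_Im_Ln[OF nz] Im_Ln_le_pi[OF nz] by linarith
  then show ?thesis
    by (simp add: coord_def field_simps)
qed

lemma torus_char_coord: "torus_char k p = cis (2 * pi * (int_vec k \<bullet> coord p))"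
proof -
  obtain x where p: "p = torus_proj x" by (rule torus_proj_surj)
  have "\<exists>m::int. x $ i - coord p $ i = of_int m" for i
  proof -
    have nz: "torus_char (axis i 1) p \<noteq> 0"
      using norm_torus_char[of "axis i 1" p] by force
    have "Ln (torus_char (axis i 1) p) = \<i> * of_real (2 * pi * coord p $ i)"
      using nz by (simp add: coord_def complex_eq_iff Re_Ln)
    then have "torus_char (axis i 1) p = cis (2 * pi * coord p $ i)"
      using exp_Ln[OF nz] by (simp add: cis_conv_exp)
    moreover have "int_vec (axis i 1) = axis i 1"
      by (simp add: int_vec_def axis_def vec_eq_iff)
    then have "torus_char (axis i 1) p = cis (2 * pi * x $ i)"
      by (simp add: p torus_char_proj inner_axis')
    ultimately have "cis (2 * pi * x $ i) = cis (2 * pi * coord p $ i)" by simp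
    then have "exp (\<i> * of_real (2 * pi * x $ i)) = exp (\<i> * of_real (2 * pi * coord p $ i))"
      by (simp only: cis_conv_exp)
    then obtain n :: int where "\<i> * complex_of_real (2 * pi * x $ i)
        = \<i> * complex_of_real (2 * pi * coord p $ i) + (of_int (2 * n) * pi) * \<i>"
      unfolding exp_eq by blast
    then have "2 * pi * x $ i = 2 * pi * coord p $ i + 2 * n * pi"
      by (simp add: complex_eq_iff)
    then have "2 * pi * (x $ i - coord p $ i) = 2 * pi * of_int n"
      by (simp add: algebra_simps)
    then show ?thesis by (intro exI[of _ n]) simp
  qed
  then obtain m where m: "\<And>i. x $ i - coord p $ i = of_int (m i)"
    by metis
  have "lattice_equiv x (coord p)"
    unfolding lattice_equiv_def
    by (rule exI[of _ "\<chi> i. m i"]) (simp add: vec_eq_iff int_vec_def m)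
  then have "p = torus_proj (coord p)"
    by (simp add: p torus.abs_eq_iff)
  then show ?thesis
    by (metis torus_char_proj)
qed

definition cell :: "nat \<Rightarrow> ('n::finite) torus \<Rightarrow> int ^ 'n" where
  "cell H p = (\<chi> i. \<lfloor>real H * coord p $ i\<rfloor>)"

lemma cell_bound: "\<bar>cell H p $ i\<bar> \<le> int H"
proof -
  have "\<bar>real H * coord p $ i\<bar> \<le> real H * (1 / 2)"
    unfolding abs_mult using abs_coord_le[of p i] by (intro mult_mono) auto
  then show ?thesis
    by (simp add: cell_def abs_le_iff) linarith
qed

lemma finite_range_cell: "finite (range (cell H :: 'n::finite torus \<Rightarrow> _))"
proof (rule finite_subset)
  show "range (cell H :: 'n torus \<Rightarrow> _) \<subseteq> {k. \<forall>i. k $ i \<in> {- int H..int H}}"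
    using cell_bound by (auto simp: abs_le_iff minus_le_iff)
  show "finite {k :: int ^ 'n. \<forall>i. k $ i \<in> {- int H..int H}}"
    by (rule finite_vec_box) simp
qed

lemma cell_measurable: "{p. cell H p = c} \<in> sets borel"
proof -
  have "{p \<in> space borel. \<forall>i\<in>UNIV. \<lfloor>real H * coord p $ i\<rfloor> = c $ i} \<in> sets borel"
    by (rule sets.sets_Collect_finite_All) measurable
  then show ?thesis by (simp add: cell_def vec_eq_iff)
qed

lemma same_cell_imp_close:
  assumes "H > 0" "cell H p $ i = cell H q $ i"
  shows "\<bar>coord q $ i - coord p $ i\<bar> \<le> 1 / real H"
proof -
  have "\<bar>real H * coord q $ i - real H * coord p $ i\<bar> \<le> 1"
    using assms(2) unfolding cell_def vec_lambda_beta by linarith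
  then have "real H * \<bar>coord q $ i - coord p $ i\<bar> \<le> 1"
    by (simp add: right_diff_distrib[symmetric] abs_mult)
  then show ?thesis using assms(1) by (simp add: field_simps)
qed

definition corner_box :: "nat \<Rightarrow> (int ^ 'n) set" where
  "corner_box N = {k. \<forall>i. k $ i \<in> {0..<int N}}"

definition symm_box :: "nat \<Rightarrow> (int ^ 'n) set" where
  "symm_box N = {k. \<forall>i. k $ i \<in> {- int N<..<int N}}"

lemma card_corner_box: "finite (corner_box N :: (int ^ 'n::finite) set)" "card (corner_box N :: (int ^ 'n) set) = N ^ CARD('n)"
  unfolding corner_box_def card_vec_box by (rule finite_vec_box) simp_all

lemma finite_symm_box: "finite (symm_box N :: (int ^ 'n::finite) set)"
  unfolding symm_box_def by (rule finite_vec_box) simp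

text \<open>The mesh is chosen so small that for frequencies below \<open>N\<close> the phases at two points of one cell
  differ by less than \<open>pi / 3\<close>: there is no cancellation in this Dirichlet kernel.\<close>

lemma trig_poly_kernel_ge:
  fixes p q :: "('n::finite) torus"
  assumes N: "N > 0" and cell: "cell (8 * CARD('n) * N) p = cell (8 * CARD('n) * N) q"
  shows "real N ^ CARD('n) / 2 \<le> cmod (trig_poly (corner_box N) (\<lambda>k. cnj (torus_char k p)) q)"
proof -
  define H where "H = 8 * CARD('n) * N"
  have H: "H > 0" using N by (simp add: H_def)
  have Re: "1 / 2 \<le> Re (cnj (torus_char k p) * torus_char k q)" if k: "k \<in> corner_box N" for k
  proof -
    define t where "t = 2 * pi * (int_vec k \<bullet> (coord q - coord p))"
    have "\<bar>int_vec k \<bullet> (coord q - coord p)\<bar> \<le> (\<Sum>i\<in>UNIV. \<bar>int_vec k $ i * (coord q - coord p) $ i\<bar>)"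
      by (simp add: inner_vec_def sum_abs)
    also have "\<dots> \<le> (\<Sum>i\<in>(UNIV :: 'n set). real N * (1 / real H))"
    proof (rule sum_mono)
      fix i
      have "k $ i \<in> {0..<int N}" using k by (simp add: corner_box_def)
      then have "\<bar>int_vec k $ i\<bar> \<le> real N"
        by (simp add: int_vec_def)
      moreover have "\<bar>(coord q - coord p) $ i\<bar> \<le> 1 / real H"
        using same_cell_imp_close[OF H, of p i q] cell by (simp add: H_def)
      ultimately show "\<bar>int_vec k $ i * (coord q - coord p) $ i\<bar> \<le> real N * (1 / real H)"
        unfolding abs_mult by (intro mult_mono) auto
    qed
    also have "\<dots> = 1 / 8" using N by (simp add: H_def)
    finally have "\<bar>t\<bar> \<le> 2 * pi * (1 / 8)"
      unfolding t_def abs_mult by (intro mult_mono) auto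
    then have "\<bar>t\<bar> \<le> pi / 3" using pi_gt_zero by linarith
    then have "cos (pi / 3) \<le> cos \<bar>t\<bar>"
      by (intro cos_monotone_0_pi_le) (use pi_gt_zero in linarith)+
    then have "1 / 2 \<le> cos t" by (simp add: cos_60)
    moreover have "cnj (torus_char k p) * torus_char k q = cis t"
      by (simp add: torus_char_coord cis_cnj cis_mult t_def inner_diff_right algebra_simps)
    ultimately show ?thesis by simp
  qed
  have "real N ^ CARD('n) / 2 = (\<Sum>k\<in>(corner_box N :: (int ^ 'n) set). 1 / 2)"
    by (simp add: card_corner_box)
  also have "\<dots> \<le> (\<Sum>k\<in>corner_box N. Re (cnj (torus_char k p) * torus_char k q))"
    by (intro sum_mono Re)
  also have "\<dots> = Re (trig_poly (corner_box N) (\<lambda>k. cnj (torus_char k p)) q)"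
    by (simp add: trig_poly_def)
  also have "\<dots> \<le> cmod (trig_poly (corner_box N) (\<lambda>k. cnj (torus_char k p)) q)"
    by (rule complex_Re_le_cmod)
  finally show ?thesis .
qed

context torus_prob
begin

text \<open>Both integrations act on finite sums of characters, so that the double integral of the squared
  Dirichlet kernel is computed without an appeal to Fubini's theorem.\<close>

lemma integral_energy_kernel:
  assumes "finite A"
  shows "integrable M (\<lambda>p. energy M A (\<lambda>k. cnj (torus_char k p)))" (is ?int)
    and "(\<integral>p. energy M A (\<lambda>k. cnj (torus_char k p)) \<partial>M)
       = (\<Sum>k\<in>A. \<Sum>l\<in>A. (cmod (fourier_coeff M (l - k)))\<^sup>2)" (is ?eq)
proof -
  have e: "energy M A (\<lambda>k. cnj (torus_char k p))
      = (\<Sum>k\<in>A. \<Sum>l\<in>A. Re (torus_char (l - k) p * fourier_coeff M (l - k)))" for p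
    unfolding energy_eq_Re by (simp add: torus_char_mult_cnj[symmetric] mult.commute)
  have i: "integrable M (\<lambda>p. torus_char k p * c)" for k c
    by (simp add: integrable_torus_char)
  have r: "integrable M (\<lambda>p. Re (torus_char k p * c))" for k c
    using i by (rule integrable_Re)
  show ?int unfolding e by (intro Bochner_Integration.integrable_sum r)
  have "(\<integral>p. energy M A (\<lambda>k. cnj (torus_char k p)) \<partial>M)
      = (\<Sum>k\<in>A. \<Sum>l\<in>A. \<integral>p. Re (torus_char (l - k) p * fourier_coeff M (l - k)) \<partial>M)"
    unfolding e
    by (simp only: Bochner_Integration.integral_sum Bochner_Integration.integrable_sum r)
  also have "\<dots> = (\<Sum>k\<in>A. \<Sum>l\<in>A. (cmod (fourier_coeff M (l - k)))\<^sup>2)"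
  proof (intro sum.cong refl)
    fix k l
    have "(\<integral>p. Re (torus_char (l - k) p * fourier_coeff M (l - k)) \<partial>M)
        = Re (fourier_coeff M (- (l - k)) * fourier_coeff M (l - k))"
      using i[of "l - k" "fourier_coeff M (l - k)"] by (subst integral_Re) (simp_all add: integral_torus_char)
    also have "fourier_coeff M (- (l - k)) * fourier_coeff M (l - k) = of_real ((cmod (fourier_coeff M (l - k)))\<^sup>2)"
      unfolding fourier_coeff_uminus complex_norm_square by (rule mult.commute)
    finally show "(\<integral>p. Re (torus_char (l - k) p * fourier_coeff M (l - k)) \<partial>M) = (cmod (fourier_coeff M (l - k)))\<^sup>2"
      by (simp only: Re_complex_of_real)
  qed
  finally show ?eq .
qed

text \<open>The sum of the squared masses is the product measure of the pairs of points that share a cell.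
  On such pairs the squared Dirichlet kernel is at least \<open>(N ^ d / 2)\<^sup>2\<close>, and its double integral is
  at most \<open>N ^ d\<close> times the sum of the squared Fourier coefficients.\<close>

lemma sum_square_measure_cell_le:
  assumes N: "N > 0"
  shows "(\<Sum>c\<in>range (cell (8 * CARD('n) * N)). (measure M {p. cell (8 * CARD('n) * N) p = c})\<^sup>2)
    \<le> 4 / real N ^ CARD('n) * (\<Sum>k\<in>symm_box N. (cmod (fourier_coeff M k))\<^sup>2)"
proof -
  define H where "H = 8 * CARD('n) * N"
  define X where "X c = {p :: 'n torus. cell H p = c}" for c
  define E where "E p = energy M (corner_box N) (\<lambda>k. cnj (torus_char k p))" for p
  define \<nu> where "\<nu> = real N ^ CARD('n)"
  have \<nu>: "\<nu> > 0" using N by (simp add: \<nu>_def)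
  have X [measurable]: "X c \<in> sets M" for c
    by (simp add: X_def sets_M cell_measurable)
  have E_ge: "(\<nu> / 2)\<^sup>2 * measure M (X (cell H p)) \<le> E p" for p
  proof -
    have "(\<nu> / 2)\<^sup>2 * measure M (X (cell H p)) = (\<integral>q. (\<nu> / 2)\<^sup>2 * indicator (X (cell H p)) q \<partial>M)"
      by simp
    also have "\<dots> \<le> (\<integral>q. (cmod (trig_poly (corner_box N) (\<lambda>k. cnj (torus_char k p)) q))\<^sup>2 \<partial>M)"
    proof (rule integral_mono)
      show "integrable M (\<lambda>q. (\<nu> / 2)\<^sup>2 * indicat_real (X (cell H p)) q)"
        by (intro integrable_mult_right integrable_real_indicator) (auto simp: emeasure_eq_measure)
      show "integrable M (\<lambda>q. (cmod (trig_poly (corner_box N) (\<lambda>k. cnj (torus_char k p)) q))\<^sup>2)"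
      proof (rule integrable_const_bound)
        show "AE q in M. norm ((cmod (trig_poly (corner_box N) (\<lambda>k. cnj (torus_char k p)) q))\<^sup>2) \<le> \<nu>\<^sup>2"
        proof (rule AE_I2)
          fix q
          have "cmod (trig_poly (corner_box N) (\<lambda>k. cnj (torus_char k p)) q)
             \<le> (\<Sum>k\<in>(corner_box N :: (int ^ 'n) set). 1)"
            unfolding trig_poly_def by (rule sum_norm_le) (simp add: norm_mult)
          then show "norm ((cmod (trig_poly (corner_box N) (\<lambda>k. cnj (torus_char k p)) q))\<^sup>2) \<le> \<nu>\<^sup>2"
            by (simp add: card_corner_box \<nu>_def power_mono)
        qed
        show "(\<lambda>q. (cmod (trig_poly (corner_box N) (\<lambda>k. cnj (torus_char k p)) q))\<^sup>2) \<in> borel_measurable M"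
          by measurable
      qed
      fix q
      show "(\<nu> / 2)\<^sup>2 * indicat_real (X (cell H p)) q
          \<le> (cmod (trig_poly (corner_box N) (\<lambda>k. cnj (torus_char k p)) q))\<^sup>2"
      proof (cases "q \<in> X (cell H p)")
        case True
        then have "\<nu> / 2 \<le> cmod (trig_poly (corner_box N) (\<lambda>k. cnj (torus_char k p)) q)"
          using trig_poly_kernel_ge[OF N, of p q] by (simp add: X_def H_def \<nu>_def)
        then show ?thesis using True \<nu> by (simp add: power_mono)
      qed simp
    qed
    finally show ?thesis by (simp add: E_def energy_def)
  qed
  have fin: "finite (range (cell H :: 'n torus \<Rightarrow> _))" by (rule finite_range_cell)
  have "(\<nu> / 2)\<^sup>2 * (\<Sum>c\<in>range (cell H). (measure M (X c))\<^sup>2)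
      = (\<integral>p. (\<Sum>c\<in>range (cell H). (\<nu> / 2)\<^sup>2 * measure M (X c) * indicator (X c) p) \<partial>M)"
    by (subst Bochner_Integration.integral_sum)
       (auto simp: sum_distrib_left power2_eq_square emeasure_eq_measure mult_ac)
  also have "\<dots> \<le> (\<integral>p. E p \<partial>M)"
  proof (rule integral_mono)
    show "integrable M (\<lambda>p. \<Sum>c\<in>range (cell H). (\<nu> / 2)\<^sup>2 * measure M (X c) * indicat_real (X c) p)"
      by (intro Bochner_Integration.integrable_sum integrable_mult_right integrable_real_indicator)
        (auto simp: emeasure_eq_measure)
    show "integrable M E"
      unfolding E_def by (rule integral_energy_kernel) (rule card_corner_box)
    fix p
    have "(\<Sum>c\<in>range (cell H). (\<nu> / 2)\<^sup>2 * measure M (X c) * indicat_real (X c) p)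
        = (\<Sum>c\<in>range (cell H). if c = cell H p then (\<nu> / 2)\<^sup>2 * measure M (X c) else 0)"
      by (intro sum.cong refl) (auto simp: X_def)
    also have "\<dots> = (\<nu> / 2)\<^sup>2 * measure M (X (cell H p))"
      using fin by simp
    also have "\<dots> \<le> E p" by (rule E_ge)
    finally show "(\<Sum>c\<in>range (cell H). (\<nu> / 2)\<^sup>2 * measure M (X c) * indicat_real (X c) p) \<le> E p" .
  qed
  also have "\<dots> = (\<Sum>k\<in>corner_box N. \<Sum>l\<in>corner_box N. (cmod (fourier_coeff M (l - k)))\<^sup>2)"
    unfolding E_def by (rule integral_energy_kernel) (rule card_corner_box)
  also have "\<dots> \<le> (\<Sum>k\<in>(corner_box N :: (int ^ 'n) set). \<Sum>l\<in>symm_box N. (cmod (fourier_coeff M l))\<^sup>2)"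
  proof (rule sum_mono)
    fix k :: "int ^ 'n" assume k: "k \<in> corner_box N"
    have "(\<Sum>l\<in>corner_box N. (cmod (fourier_coeff M (l - k)))\<^sup>2)
        = (\<Sum>l\<in>(\<lambda>l. l - k) ` corner_box N. (cmod (fourier_coeff M l))\<^sup>2)"
      by (subst sum.reindex) (auto simp: inj_on_def)
    also have "\<dots> \<le> (\<Sum>l\<in>symm_box N. (cmod (fourier_coeff M l))\<^sup>2)"
    proof (rule sum_mono2[OF finite_symm_box])
      show "(\<lambda>l. l - k) ` corner_box N \<subseteq> symm_box N"
      proof (rule image_subsetI)
        fix l :: "int ^ 'n" assume l: "l \<in> corner_box N"
        have "- int N < l $ i - k $ i \<and> l $ i - k $ i < int N" for i
        proof -
          have "k $ i \<in> {0..<int N}" "l $ i \<in> {0..<int N}" using k l by (auto simp: corner_box_def)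
          then show ?thesis by auto
        qed
        then show "l - k \<in> symm_box N" by (simp add: symm_box_def)
      qed
    qed simp
    finally show "(\<Sum>l\<in>corner_box N. (cmod (fourier_coeff M (l - k)))\<^sup>2)
        \<le> (\<Sum>l\<in>symm_box N. (cmod (fourier_coeff M l))\<^sup>2)" .
  qed
  also have "\<dots> = \<nu> * (\<Sum>l\<in>symm_box N. (cmod (fourier_coeff M l))\<^sup>2)"
    by (simp add: card_corner_box \<nu>_def)
  finally have "\<nu> * (\<nu> * (\<Sum>c\<in>range (cell H). (measure M (X c))\<^sup>2))
      \<le> \<nu> * (4 * (\<Sum>l\<in>symm_box N. (cmod (fourier_coeff M l))\<^sup>2))"
    by (simp add: power2_eq_square)
  then have "\<nu> * (\<Sum>c\<in>range (cell H). (measure M (X c))\<^sup>2) \<le> 4 * (\<Sum>l\<in>symm_box N. (cmod (fourier_coeff M l))\<^sup>2)"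
    using \<nu> by simp
  then have "(\<Sum>c\<in>range (cell H). (measure M (X c))\<^sup>2) \<le> 4 / \<nu> * (\<Sum>l\<in>symm_box N. (cmod (fourier_coeff M l))\<^sup>2)"
    using \<nu> by (simp add: pos_le_divide_eq mult.commute)
  then show ?thesis
    by (simp only: H_def \<nu>_def X_def)
qed

end

section \<open>Zero sets of trigonometric polynomials\<close>

definition deriv_coeff :: "'n \<Rightarrow> (int ^ 'n \<Rightarrow> complex) \<Rightarrow> int ^ 'n \<Rightarrow> complex" where
  "deriv_coeff i b k = 2 * pi * \<i> * of_int (k $ i) * b k"

lemma cmod_cis_minus_one_le: "cmod (cis t - 1) \<le> \<bar>t\<bar>"
  using iexp_approx1[of t 0] by (simp add: cis_conv_exp)

lemma cmod_cis_minus_linear_le: "cmod (cis t - 1 - \<i> * t) \<le> t\<^sup>2"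
proof -
  have "cmod (cis t - 1 - \<i> * t) \<le> t\<^sup>2 / 2"
    using iexp_approx1[of t 1] by (simp add: cis_conv_exp power2_eq_square diff_diff_eq add.commute)
  then show ?thesis using zero_le_power2[of t] by linarith
qed

text \<open>Second-order Taylor expansion in the \<open>i\<close>-th coordinate, and merely Lipschitz in the others. The
  coordinates of the two points are compared as real numbers, so the statement does not
  wrap around the torus.\<close>

lemma trig_poly_taylor:
  fixes F :: "(int ^ 'n::finite) set"
  assumes "finite F"
  obtains B1 B2 where "B1 \<ge> 0" "B2 \<ge> 0"
    "\<And>p q h. (\<And>j. j \<noteq> i \<Longrightarrow> \<bar>coord q $ j - coord p $ j\<bar> \<le> h) \<Longrightarrow>
      cmod (trig_poly F b q - trig_poly F b p
        - of_real (coord q $ i - coord p $ i) * trig_poly F (deriv_coeff i b) p)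
      \<le> B1 * h + B2 * (coord q $ i - coord p $ i)\<^sup>2"
proof (rule that)
  define \<beta> where "\<beta> k = 2 * pi * (\<Sum>j\<in>UNIV - {i}. \<bar>real_of_int (k $ j)\<bar>)" for k :: "int ^ 'n"
  define B1 where "B1 = (\<Sum>k\<in>F. cmod (b k) * \<beta> k)"
  define B2 where "B2 = (\<Sum>k\<in>F. cmod (b k) * (2 * pi * real_of_int (k $ i))\<^sup>2)"
  show "B1 \<ge> 0" "B2 \<ge> 0"
    by (auto simp: B1_def B2_def \<beta>_def intro!: sum_nonneg mult_nonneg_nonneg)
  fix p q :: "'n torus" and h
  assume h: "\<And>j. j \<noteq> i \<Longrightarrow> \<bar>coord q $ j - coord p $ j\<bar> \<le> h"
  define t where "t = coord q $ i - coord p $ i"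
  define r where "r k = cis (2 * pi * (int_vec k \<bullet> (coord q - coord p))) - 1 - \<i> * of_real (2 * pi * of_int (k $ i) * t)" for k
  have q: "torus_char k q = torus_char k p * cis (2 * pi * (int_vec k \<bullet> (coord q - coord p)))" for k
    by (simp add: torus_char_coord cis_mult inner_diff_right algebra_simps)
  have "trig_poly F b q - trig_poly F b p - of_real t * trig_poly F (deriv_coeff i b) p
      = (\<Sum>k\<in>F. b k * torus_char k p * r k)"
    unfolding trig_poly_def deriv_coeff_def q r_def
    by (simp add: sum_distrib_left sum_subtractf[symmetric] algebra_simps)
  also have "cmod \<dots> \<le> (\<Sum>k\<in>F. cmod (b k) * (\<beta> k * h + (2 * pi * real_of_int (k $ i))\<^sup>2 * t\<^sup>2))"
  proof (rule sum_norm_le)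
    fix k
    define u where "u = 2 * pi * of_int (k $ i) * t"
    define v where "v = 2 * pi * (\<Sum>j\<in>UNIV - {i}. of_int (k $ j) * (coord q $ j - coord p $ j))"
    have "int_vec k \<bullet> (coord q - coord p) = of_int (k $ i) * t + (\<Sum>j\<in>UNIV - {i}. of_int (k $ j) * (coord q $ j - coord p $ j))"
      unfolding inner_vec_def by (subst sum.remove[of _ i]) (auto simp: int_vec_def t_def)
    then have uv: "2 * pi * (int_vec k \<bullet> (coord q - coord p)) = u + v"
      by (simp add: u_def v_def algebra_simps)
    have v: "\<bar>v\<bar> \<le> \<beta> k * h"
    proof -
      have "\<bar>\<Sum>j\<in>UNIV - {i}. of_int (k $ j) * (coord q $ j - coord p $ j)\<bar>
          \<le> (\<Sum>j\<in>UNIV - {i}. \<bar>of_int (k $ j)\<bar> * h)"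
        by (rule order_trans[OF sum_abs]) (auto intro!: sum_mono mult_left_mono h simp: abs_mult)
      then show ?thesis
        by (simp add: v_def \<beta>_def abs_mult sum_distrib_right[symmetric] mult.assoc)
    qed
    have "r k = cis u * (cis v - 1) + (cis u - 1 - \<i> * u)"
      unfolding r_def uv u_def[symmetric] by (simp add: cis_mult[symmetric] algebra_simps)
    also have "cmod \<dots> \<le> cmod (cis u * (cis v - 1)) + cmod (cis u - 1 - \<i> * u)"
      by (rule norm_triangle_ineq)
    also have "\<dots> \<le> \<beta> k * h + u\<^sup>2"
      using cmod_cis_minus_one_le[of v] cmod_cis_minus_linear_le[of u] v by (simp add: norm_mult)
    finally have "cmod (r k) \<le> \<beta> k * h + (2 * pi * real_of_int (k $ i))\<^sup>2 * t\<^sup>2"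
      by (simp add: u_def power_mult_distrib)
    then show "cmod (b k * torus_char k p * r k) \<le> cmod (b k) * (\<beta> k * h + (2 * pi * real_of_int (k $ i))\<^sup>2 * t\<^sup>2)"
      by (simp add: norm_mult mult_left_mono)
  qed
  also have "\<dots> = B1 * h + B2 * t\<^sup>2"
    by (simp add: B1_def B2_def sum_distrib_right sum.distrib distrib_left mult.assoc)
  finally show "cmod (trig_poly F b q - trig_poly F b p - of_real (coord q $ i - coord p $ i) * trig_poly F (deriv_coeff i b) p)
      \<le> B1 * h + B2 * (coord q $ i - coord p $ i)\<^sup>2" by (simp add: t_def)
qed

text \<open>Consider two points of the set in the same column of cells in direction \<open>i\<close>. The expansion forces their
  distance \<open>t\<close> in that direction to satisfy \<open>c * t \<le> B1 / H + B2 * t\<^sup>2\<close>, so it is either \<open>O(1 / H)\<close> or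
  bounded below. Hence the set meets a bounded number of cells of a column: the position of such a
  point up to \<open>1 / m\<close> and its cell index modulo \<open>q\<close> determine the cell.\<close>

lemma card_cells_of_transversal_zero_set:
  fixes F :: "(int ^ 'n::finite) set"
  assumes F: "finite F" and c: "c > 0"
  obtains Q :: nat where "\<And>H. H > 0 \<Longrightarrow>
    card (cell H ` {p. trig_poly F b p = 0 \<and> c \<le> cmod (trig_poly F (deriv_coeff i b) p)})
      \<le> Q * (2 * H + 1) ^ (CARD('n) - 1)"
proof -
  define K where "K = {p. trig_poly F b p = 0 \<and> c \<le> cmod (trig_poly F (deriv_coeff i b) p)}"
  obtain B1 B2 where B: "B1 \<ge> 0" "B2 \<ge> 0" and taylor:
    "\<And>p q h. (\<And>j. j \<noteq> i \<Longrightarrow> \<bar>coord q $ j - coord p $ j\<bar> \<le> h) \<Longrightarrow>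
      cmod (trig_poly F b q - trig_poly F b p
        - of_real (coord q $ i - coord p $ i) * trig_poly F (deriv_coeff i b) p)
      \<le> B1 * h + B2 * (coord q $ i - coord p $ i)\<^sup>2"
    using trig_poly_taylor[OF F, of i b] by blast
  \<comment> \<open>With \<open>|t| \<le> 1 / m\<close> the quadratic term is absorbed into the left-hand side; the index difference is then below \<open>q\<close>.\<close>
  define m where "m = nat \<lceil>2 * B2 / c\<rceil> + 1"
  define q where "q = nat \<lceil>2 * B1 / c\<rceil> + 2"
  have m: "m > 0" "real m \<ge> 2 * B2 / c" unfolding m_def by linarith+
  have q: "q > 0" "real q \<ge> 2 * B1 / c + 2" unfolding q_def by linarith+
  define Q where "Q = (2 * m + 1) * q"
  show ?thesis
  proof (rule that[of Q])
    fix H :: nat assume H: "H > 0"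
    define S where "S j = (if j = i then {0} else {- int H..int H})" for j
    define T where "T = {k :: int ^ 'n. \<forall>j. k $ j \<in> S j} \<times> {- int m..int m} \<times> {0..<int q}"
    define \<psi> where "\<psi> p = (\<chi> j. if j = i then 0 else cell H p $ j, \<lfloor>real m * coord p $ i\<rfloor>, cell H p $ i mod int q)" for p
    define pt where "pt \<gamma> = (SOME p. p \<in> K \<and> cell H p = \<gamma>)" for \<gamma>
    have pt: "pt \<gamma> \<in> K" "cell H (pt \<gamma>) = \<gamma>" if "\<gamma> \<in> cell H ` K" for \<gamma>
      using someI_ex[of "\<lambda>p. p \<in> K \<and> cell H p = \<gamma>"] that unfolding pt_def by blast+
    have \<psi>_inj: "cell H p1 = cell H p2" if K: "p1 \<in> K" "p2 \<in> K" and eq: "\<psi> p1 = \<psi> p2" for p1 p2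
    proof -
      have off: "cell H p1 $ j = cell H p2 $ j" if "j \<noteq> i" for j
        using arg_cong[OF eq, of "\<lambda>x. fst x $ j"] that by (simp add: \<psi>_def)
      have fl: "\<lfloor>real m * coord p1 $ i\<rfloor> = \<lfloor>real m * coord p2 $ i\<rfloor>"
        and md: "cell H p1 $ i mod int q = cell H p2 $ i mod int q"
        using eq by (auto simp: \<psi>_def)
      define t where "t = coord p2 $ i - coord p1 $ i"
      have mt: "real m * \<bar>t\<bar> \<le> 1"
      proof -
        have "\<bar>real m * coord p2 $ i - real m * coord p1 $ i\<bar> \<le> 1" using fl by linarith
        then show ?thesis by (simp add: t_def right_diff_distrib[symmetric] abs_mult)
      qed
      have close: "\<bar>coord p2 $ j - coord p1 $ j\<bar> \<le> 1 / real H" if "j \<noteq> i" for j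
        using same_cell_imp_close[OF H off[OF that]] .
      have "c * \<bar>t\<bar> \<le> cmod (trig_poly F (deriv_coeff i b) p1) * \<bar>t\<bar>"
        using K(1) by (intro mult_right_mono) (auto simp: K_def)
      also have "\<dots> = cmod (trig_poly F b p2 - trig_poly F b p1 - of_real t * trig_poly F (deriv_coeff i b) p1)"
        using K by (simp add: K_def norm_mult)
      also have "\<dots> \<le> B1 * (1 / real H) + B2 * t\<^sup>2"
        unfolding t_def by (rule taylor) (rule close)
      also have "B2 * t\<^sup>2 \<le> c / 2 * \<bar>t\<bar>"
      proof -
        have "B2 \<le> c / 2 * real m" using m(2) c by (simp add: field_simps)
        then have "B2 * t\<^sup>2 \<le> c / 2 * real m * t\<^sup>2" by (rule mult_right_mono) simp
        also have "\<dots> = c / 2 * \<bar>t\<bar> * (real m * \<bar>t\<bar>)"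
          by (simp add: power2_eq_square)
        also have "\<dots> \<le> c / 2 * \<bar>t\<bar> * 1"
          using mt c by (intro mult_left_mono) auto
        finally show ?thesis by simp
      qed
      finally have "real H * \<bar>t\<bar> \<le> 2 * B1 / c"
        using H c by (simp add: field_simps)
      then have "\<bar>real H * coord p2 $ i - real H * coord p1 $ i\<bar> \<le> 2 * B1 / c"
        by (simp add: t_def right_diff_distrib[symmetric] abs_mult)
      then have "\<bar>real_of_int (cell H p2 $ i) - real_of_int (cell H p1 $ i)\<bar> < 2 * B1 / c + 2"
        unfolding cell_def vec_lambda_beta by linarith
      then have "\<bar>cell H p2 $ i - cell H p1 $ i\<bar> < int q" using q(2) by linarith
      moreover have "int q dvd cell H p2 $ i - cell H p1 $ i"
        using md by (metis mod_eq_dvd_iff)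
      ultimately have "cell H p2 $ i = cell H p1 $ i"
        using dvd_imp_le_int[of "cell H p2 $ i - cell H p1 $ i" "int q"] by linarith
      then have "cell H p1 $ j = cell H p2 $ j" for j
        using off by (cases "j = i") auto
      then show ?thesis by (simp add: vec_eq_iff)
    qed
    have "card (cell H ` K) \<le> card T"
    proof (rule card_inj_on_le)
      show "inj_on (\<lambda>\<gamma>. \<psi> (pt \<gamma>)) (cell H ` K)"
      proof (rule inj_onI)
        fix \<gamma> \<gamma>' assume g: "\<gamma> \<in> cell H ` K" "\<gamma>' \<in> cell H ` K" "\<psi> (pt \<gamma>) = \<psi> (pt \<gamma>')"
        then have "cell H (pt \<gamma>) = cell H (pt \<gamma>')"
          by (intro \<psi>_inj pt(1))
        then show "\<gamma> = \<gamma>'" using pt(2) g by simp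
      qed
      show "(\<lambda>\<gamma>. \<psi> (pt \<gamma>)) ` cell H ` K \<subseteq> T"
      proof (rule image_subsetI)
        fix \<gamma>
        let ?p = "pt \<gamma>"
        have "(if j = i then 0 else cell H ?p $ j) \<in> S j" for j
          using cell_bound[of H ?p j] by (auto simp: S_def abs_le_iff)
        moreover have "\<bar>real m * coord ?p $ i\<bar> \<le> real m * (1 / 2)"
          unfolding abs_mult using abs_coord_le[of ?p i] by (intro mult_mono) auto
        then have "- int m \<le> \<lfloor>real m * coord ?p $ i\<rfloor>" "\<lfloor>real m * coord ?p $ i\<rfloor> \<le> int m"
          by linarith+
        moreover have "0 \<le> cell H ?p $ i mod int q" "cell H ?p $ i mod int q < int q"
          using q(1) by auto
        ultimately show "\<psi> ?p \<in> T"
          by (simp add: \<psi>_def T_def)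
      qed
      show "finite T" unfolding T_def by (intro finite_cartesian_product finite_vec_box) (auto simp: S_def)
    qed
    also have "card T = (2 * H + 1) ^ (CARD('n) - 1) * Q"
    proof -
      have "(\<Prod>j\<in>UNIV. card (S j)) = card (S i) * (\<Prod>j\<in>UNIV - {i}. card (S j))"
        by (rule prod.remove) auto
      also have "(\<Prod>j\<in>UNIV - {i}. card (S j)) = (\<Prod>j\<in>UNIV - {i}. 2 * H + 1)"
        by (intro prod.cong) (auto simp: S_def)
      finally have "(\<Prod>j\<in>UNIV. card (S j)) = (2 * H + 1) ^ (CARD('n) - 1)"
        by (simp add: S_def card_Diff_subset)
      then show ?thesis
        by (simp add: T_def card_cartesian_product card_vec_box Q_def nat_add_distrib nat_mult_distrib)
    qed
    finally show "card (cell H ` {p. trig_poly F b p = 0 \<and> c \<le> cmod (trig_poly F (deriv_coeff i b) p)})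
      \<le> Q * (2 * H + 1) ^ (CARD('n) - 1)" by (simp add: K_def mult.commute)
  qed
qed

section \<open>Fourier decay and null sets\<close>

lemma cesaro_zero:
  fixes F :: "nat \<Rightarrow> real"
  assumes F: "F \<longlonglongrightarrow> 0" and nonneg: "\<And>m. F m \<ge> 0"
  shows "(\<lambda>N. (\<Sum>m<N. F m) / real N) \<longlonglongrightarrow> 0"
proof (rule LIMSEQ_I)
  fix e :: real assume e: "e > 0"
  then obtain M0 where M0: "\<And>m. m \<ge> M0 \<Longrightarrow> norm (F m - 0) < e / 2"
    using LIMSEQ_D[OF F, of "e / 2"] by auto
  define S where "S = (\<Sum>m<M0. F m)"
  have S: "S \<ge> 0" unfolding S_def by (intro sum_nonneg nonneg)
  have bound: "(\<Sum>m<N. F m) \<le> S + real N * (e / 2)" for N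
  proof -
    have "(\<Sum>m<N. F m) \<le> (\<Sum>m<N. (if m < M0 then F m else 0) + e / 2)"
    proof (rule sum_mono)
      fix m show "F m \<le> (if m < M0 then F m else 0) + e / 2"
        using M0[of m] e by auto
    qed
    also have "\<dots> = (\<Sum>m\<in>{..<N} \<inter> {..<M0}. F m) + real N * (e / 2)"
      by (simp add: sum.distrib sum.If_cases Int_def lessThan_def)
    also have "(\<Sum>m\<in>{..<N} \<inter> {..<M0}. F m) \<le> S"
      unfolding S_def by (intro sum_mono2 nonneg) auto
    finally show ?thesis by simp
  qed
  show "\<exists>no. \<forall>n\<ge>no. norm ((\<Sum>m<n. F m) / real n - 0) < e"
  proof (intro exI allI impI)
    fix n assume n: "n \<ge> nat \<lceil>2 * S / e\<rceil> + 1"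
    then have n0: "real n > 0" and "real n > 2 * S / e" by linarith+
    then have "S < real n * (e / 2)" using e by (simp add: field_simps)
    then have "(\<Sum>m<n. F m) < e * real n" using bound[of n] by (simp add: field_simps)
    moreover have "(\<Sum>m<n. F m) \<ge> 0" by (intro sum_nonneg nonneg)
    ultimately show "norm ((\<Sum>m<n. F m) / real n - 0) < e"
      using n0 by (simp add: field_simps)
  qed
qed

definition sup_norm :: "int ^ 'n::finite \<Rightarrow> nat" where
  "sup_norm k = Max (range (\<lambda>i. nat \<bar>k $ i\<bar>))"

lemma sup_norm_less_iff: "sup_norm k < N \<longleftrightarrow> k \<in> symm_box N"
  by (auto simp: sup_norm_def symm_box_def abs_less_iff minus_less_iff nat_less_iff)

lemma sup_norm_attained: obtains i where "\<bar>k $ i\<bar> = int (sup_norm k)"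
proof -
  have "sup_norm k \<in> range (\<lambda>i. nat \<bar>k $ i\<bar>)"
    unfolding sup_norm_def by (rule Max_in) auto
  then obtain i where "sup_norm k = nat \<bar>k $ i\<bar>" by blast
  then show ?thesis by (intro that[of i]) simp
qed

lemma abs_component_le_sup_norm: "\<bar>k $ i\<bar> \<le> int (sup_norm k)"
proof -
  have "nat \<bar>k $ i\<bar> \<le> sup_norm k"
    unfolding sup_norm_def by (rule Max_ge) auto
  then show ?thesis by simp
qed

lemma sup_norm_le_norm: "real (sup_norm k) \<le> norm (int_vec k)"
proof -
  obtain i where i: "\<bar>k $ i\<bar> = int (sup_norm k)" by (rule sup_norm_attained)
  have "real (sup_norm k) = \<bar>int_vec k $ i\<bar>"
    using i by (simp add: int_vec_def flip: of_int_abs)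
  then show ?thesis using component_le_norm_cart[of "int_vec k" i] by simp
qed

text \<open>Some coordinate is \<open>m\<close> or \<open>- m\<close>, and the others range over \<open>2 * m + 1\<close> values.\<close>

lemma card_sup_norm_eq:
  "card {k :: int ^ 'n::finite. sup_norm k = m} \<le> CARD('n) * (2 * (2 * m + 1) ^ (CARD('n) - 1))"
  and finite_sup_norm_eq: "finite {k :: int ^ 'n::finite. sup_norm k = m}"
proof -
  define S where "S i j = (if j = i then {- int m, int m} else {- int m..int m})" for i j :: 'n
  have fin: "finite {k :: int ^ 'n. \<forall>j. k $ j \<in> S i j}" for i
    by (rule finite_vec_box) (simp add: S_def)
  have sub: "{k :: int ^ 'n. sup_norm k = m} \<subseteq> (\<Union>i. {k. \<forall>j. k $ j \<in> S i j})"
  proof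
    fix k :: "int ^ 'n" assume "k \<in> {k. sup_norm k = m}"
    then have m: "sup_norm k = m" by simp
    obtain i where i: "\<bar>k $ i\<bar> = int (sup_norm k)" by (rule sup_norm_attained)
    have "k $ j \<in> S i j" for j
      using i m abs_component_le_sup_norm[of k j] by (auto simp: S_def abs_le_iff)
    then show "k \<in> (\<Union>i. {k. \<forall>j. k $ j \<in> S i j})" by blast
  qed
  show "finite {k :: int ^ 'n. sup_norm k = m}"
    by (rule finite_subset[OF sub]) (simp add: fin)
  have "card {k :: int ^ 'n. \<forall>j. k $ j \<in> S i j} \<le> 2 * (2 * m + 1) ^ (CARD('n) - 1)" for i
  proof -
    have "card {k :: int ^ 'n. \<forall>j. k $ j \<in> S i j} = (\<Prod>j\<in>UNIV. card (S i j))" by (rule card_vec_box)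
    also have "\<dots> = card (S i i) * (\<Prod>j\<in>UNIV - {i}. card (S i j))"
      by (rule prod.remove) auto
    also have "(\<Prod>j\<in>UNIV - {i}. card (S i j)) = (\<Prod>j\<in>UNIV - {i}. 2 * m + 1)"
      by (intro prod.cong) (auto simp: S_def)
    also have "card (S i i) \<le> 2" by (simp add: S_def card_insert_if)
    finally show ?thesis by (simp add: card_Diff_subset)
  qed
  then have "(\<Sum>i\<in>UNIV. card {k :: int ^ 'n. \<forall>j. k $ j \<in> S i j}) \<le> CARD('n) * (2 * (2 * m + 1) ^ (CARD('n) - 1))"
    using sum_bounded_above[of "UNIV :: 'n set" "\<lambda>i. card {k :: int ^ 'n. \<forall>j. k $ j \<in> S i j}"
        "2 * (2 * m + 1) ^ (CARD('n) - 1)"] by simp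
  then have "card (\<Union>i. {k :: int ^ 'n. \<forall>j. k $ j \<in> S i j}) \<le> CARD('n) * (2 * (2 * m + 1) ^ (CARD('n) - 1))"
    by (rule order_trans[OF card_UN_le[OF finite]])
  moreover have "card {k :: int ^ 'n. sup_norm k = m} \<le> card (\<Union>i. {k :: int ^ 'n. \<forall>j. k $ j \<in> S i j})"
    by (rule card_mono[OF _ sub]) (simp add: fin)
  ultimately show "card {k :: int ^ 'n. sup_norm k = m} \<le> CARD('n) * (2 * (2 * m + 1) ^ (CARD('n) - 1))"
    by (rule order_trans[rotated])
qed

locale torus_decay = torus_prob M for M :: "('n::finite) torus measure" +
  fixes \<epsilon> C :: real
  assumes dim: "CARD('n) \<ge> 3" and eps: "\<epsilon> > 0"
    and decay: "\<And>k :: int ^ 'n. k \<noteq> 0 \<Longrightarrow>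
           cmod (fourier_coeff M k) \<le> C * norm (int_vec k) powr (- (real CARD('n) - 2 + \<epsilon>))"
begin

text \<open>The shell has \<open>O(m ^ (d - 1))\<close> points, and \<open>2 * (d - 2) \<ge> d - 1\<close> because \<open>d \<ge> 3\<close>.\<close>

lemma sum_shell_fourier_coeff_le:
  assumes m: "m > 0"
  shows "(\<Sum>k | sup_norm k = m. (cmod (fourier_coeff M k))\<^sup>2)
    \<le> real CARD('n) * 2 * 3 ^ (CARD('n) - 1) * C\<^sup>2 * real m powr (- 2 * \<epsilon>)"
proof -
  define d where "d = CARD('n)"
  define s where "s = real d - 2 + \<epsilon>"
  have s: "s > 0" using dim eps by (simp add: s_def d_def)
  have term_le: "(cmod (fourier_coeff M k))\<^sup>2 \<le> C\<^sup>2 * real m powr (- (real (d - 1) + 2 * \<epsilon>))"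
    if k: "sup_norm k = m" for k
  proof -
    have "k \<noteq> 0"
    proof
      assume "k = 0"
      then have "sup_norm k = 0" by (simp add: sup_norm_def)
      then show False using k m by simp
    qed
    have "cmod (fourier_coeff M k) \<le> C * norm (int_vec k) powr (- s)"
      using decay[OF \<open>k \<noteq> 0\<close>] by (simp add: s_def d_def)
    also have "\<dots> \<le> \<bar>C\<bar> * norm (int_vec k) powr (- s)"
      by (intro mult_right_mono) auto
    also have "norm (int_vec k) powr (- s) \<le> real m powr (- s)"
      using sup_norm_le_norm[of k] k m s by (intro powr_mono2') auto
    finally have "cmod (fourier_coeff M k) \<le> \<bar>C\<bar> * real m powr (- s)"
      by (simp add: mult_left_mono)
    then have "(cmod (fourier_coeff M k))\<^sup>2 \<le> (\<bar>C\<bar> * real m powr (- s))\<^sup>2"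
      by (intro power_mono) auto
    also have "\<dots> = C\<^sup>2 * real m powr (- 2 * s)"
      unfolding power_mult_distrib by (simp add: power2_eq_square flip: powr_add)
    also have "real m powr (- 2 * s) \<le> real m powr (- (real (d - 1) + 2 * \<epsilon>))"
      using m dim by (intro powr_mono) (auto simp: s_def d_def of_nat_diff)
    finally show ?thesis by (simp add: mult_left_mono)
  qed
  have "(\<Sum>k | sup_norm k = m. (cmod (fourier_coeff M k))\<^sup>2)
      \<le> real (card {k :: int ^ 'n. sup_norm k = m}) * (C\<^sup>2 * real m powr (- (real (d - 1) + 2 * \<epsilon>)))"
    by (rule sum_bounded_above) (use term_le in blast)
  also have "\<dots> \<le> real d * 2 * 3 ^ (d - 1) * real m powr real (d - 1) * (C\<^sup>2 * real m powr (- (real (d - 1) + 2 * \<epsilon>)))"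
  proof (rule mult_right_mono)
    have "card {k :: int ^ 'n. sup_norm k = m} \<le> d * (2 * (2 * m + 1) ^ (d - 1))"
      unfolding d_def by (rule card_sup_norm_eq)
    also have "\<dots> \<le> d * (2 * (3 * m) ^ (d - 1))"
      using m by (intro mult_left_mono power_mono) auto
    finally have "real (card {k :: int ^ 'n. sup_norm k = m}) \<le> real (d * (2 * (3 * m) ^ (d - 1)))"
      by (simp only: of_nat_le_iff)
    then show "real (card {k :: int ^ 'n. sup_norm k = m}) \<le> real d * 2 * 3 ^ (d - 1) * real m powr real (d - 1)"
      using m by (simp add: power_mult_distrib powr_realpow)
  qed simp
  also have "\<dots> = real d * 2 * 3 ^ (d - 1) * C\<^sup>2 * (real m powr real (d - 1) * real m powr (- (real (d - 1) + 2 * \<epsilon>)))"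
    by simp
  also have "real m powr real (d - 1) * real m powr (- (real (d - 1) + 2 * \<epsilon>)) = real m powr (- 2 * \<epsilon>)"
    by (simp add: powr_add[symmetric])
  finally show ?thesis by (simp add: d_def)
qed

text \<open>The shells of the sup norm contribute \<open>O(m powr (- 2 * \<epsilon>))\<close> each, and Cesaro means of a null
  sequence tend to \<open>0\<close>.\<close>

lemma mean_square_fourier_coeff_tendsto_0:
  "(\<lambda>N. (\<Sum>k\<in>symm_box N. (cmod (fourier_coeff M k))\<^sup>2) / real N) \<longlonglongrightarrow> 0"
proof -
  define F where "F m = (\<Sum>k | sup_norm k = m. (cmod (fourier_coeff M k))\<^sup>2)" for m
  have nonneg: "F m \<ge> 0" for m unfolding F_def by (intro sum_nonneg) auto
  have "F \<longlonglongrightarrow> 0"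
  proof (rule real_tendsto_sandwich)
    define B where "B = real CARD('n) * 2 * 3 ^ (CARD('n) - 1) * C\<^sup>2"
    show "\<forall>\<^sub>F m in sequentially. 0 \<le> F m" using nonneg by simp
    show "\<forall>\<^sub>F m in sequentially. F m \<le> B * real m powr (- 2 * \<epsilon>)"
      using eventually_gt_at_top[of "0::nat"]
      by eventually_elim (simp only: F_def B_def sum_shell_fourier_coeff_le)
    have "(\<lambda>m. real m powr (- 2 * \<epsilon>)) \<longlonglongrightarrow> 0"
      using eps by (intro tendsto_neg_powr filterlim_real_sequentially) simp
    then show "(\<lambda>m. B * real m powr (- 2 * \<epsilon>)) \<longlonglongrightarrow> 0"
      by (rule tendsto_mult_right_zero)
  qed simp
  then have "(\<lambda>N. (\<Sum>m<N. F m) / real N) \<longlonglongrightarrow> 0"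
    using nonneg by (rule cesaro_zero)
  moreover have "(\<Sum>m<N. F m) = (\<Sum>k\<in>symm_box N. (cmod (fourier_coeff M k))\<^sup>2)" for N
  proof -
    have "(\<Sum>m<N. F m) = (\<Sum>m<N. \<Sum>k | k \<in> symm_box N \<and> sup_norm k = m. (cmod (fourier_coeff M k))\<^sup>2)"
      unfolding F_def by (intro sum.cong refl) (auto simp flip: sup_norm_less_iff)
    also have "\<dots> = (\<Sum>k\<in>symm_box N. (cmod (fourier_coeff M k))\<^sup>2)"
      by (rule sum.group) (auto simp: finite_symm_box sup_norm_less_iff)
    finally show ?thesis .
  qed
  ultimately show ?thesis by simp
qed

lemma trig_poly_zero_set_measurable [measurable]: "{p. trig_poly F b p = 0} \<in> sets M"
proof -
  have "{p \<in> space borel. trig_poly F b p = 0} \<in> sets borel" by measurable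
  then show ?thesis by (simp add: sets_M)
qed

text \<open>By the Cauchy-Schwarz inequality the squared mass of the set is at most the number of cells that
  it meets times the sum of their squared masses, that is, a constant times the quantity in
  \<open>mean_square_fourier_coeff_tendsto_0\<close>.\<close>

lemma transversal_zero_set_null:
  assumes F: "finite F" and c: "c > 0"
  shows "{p. trig_poly F b p = 0 \<and> c \<le> cmod (trig_poly F (deriv_coeff i b) p)} \<in> null_sets M"
proof -
  define K where "K = {p. trig_poly F b p = 0 \<and> c \<le> cmod (trig_poly F (deriv_coeff i b) p)}"
  have K: "K \<in> sets M"
  proof -
    have "{p \<in> space borel. trig_poly F b p = 0 \<and> c \<le> cmod (trig_poly F (deriv_coeff i b) p)} \<in> sets borel"
      by measurable
    then show ?thesis by (simp add: sets_M K_def)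
  qed
  obtain Q where Q: "\<And>H. H > 0 \<Longrightarrow> card (cell H ` K) \<le> Q * (2 * H + 1) ^ (CARD('n) - 1)"
    unfolding K_def by (rule card_cells_of_transversal_zero_set[OF F c]) blast
  define d where "d = CARD('n)"
  define S where "S N = (\<Sum>k\<in>symm_box N. (cmod (fourier_coeff M k))\<^sup>2)" for N
  define B where "B = real Q * (24 * real d) ^ (d - 1) * 4"
  have S: "S N \<ge> 0" for N unfolding S_def by (intro sum_nonneg) auto
  have d: "d > 0" by (simp add: d_def)
  have bound: "(measure M K)\<^sup>2 \<le> B * (S N / real N)" if N: "N > 0" for N
  proof -
    define H where "H = 8 * d * N"
    have H: "H > 0" using N d by (simp add: H_def)
    define X where "X \<gamma> = {p :: 'n torus. cell H p = \<gamma>}" for \<gamma>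
    have X: "X \<gamma> \<in> sets M" for \<gamma> by (simp add: X_def sets_M cell_measurable)
    have fin: "finite (cell H ` K)" by (rule finite_subset[OF _ finite_range_cell[of H]]) auto
    have "measure M K \<le> measure M (\<Union>\<gamma>\<in>cell H ` K. X \<gamma>)"
      using fin X by (intro finite_measure_mono sets.finite_UN) (auto simp: X_def)
    also have "\<dots> \<le> (\<Sum>\<gamma>\<in>cell H ` K. measure M (X \<gamma>))"
      using fin X by (intro finite_measure_subadditive_finite) auto
    finally have "(measure M K)\<^sup>2 \<le> (\<Sum>\<gamma>\<in>cell H ` K. measure M (X \<gamma>))\<^sup>2"
      by (intro power_mono) auto
    also have "\<dots> \<le> (\<Sum>\<gamma>\<in>cell H ` K. (measure M (X \<gamma>))\<^sup>2) * real (card (cell H ` K))"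
      by (rule sum_squared_le_sum_of_squares)
    also have "\<dots> \<le> (4 / real N ^ d * S N) * (real Q * (24 * real d * real N) ^ (d - 1))"
    proof (rule mult_mono)
      have "(\<Sum>\<gamma>\<in>cell H ` K. (measure M (X \<gamma>))\<^sup>2) \<le> (\<Sum>\<gamma>\<in>range (cell H). (measure M (X \<gamma>))\<^sup>2)"
        by (intro sum_mono2 finite_range_cell) auto
      also have "\<dots> \<le> 4 / real N ^ d * S N"
        unfolding X_def H_def d_def S_def by (rule sum_square_measure_cell_le[OF N])
      finally show "(\<Sum>\<gamma>\<in>cell H ` K. (measure M (X \<gamma>))\<^sup>2) \<le> 4 / real N ^ d * S N" .
      have "card (cell H ` K) \<le> Q * (2 * H + 1) ^ (d - 1)"
        using Q[OF H] by (simp add: d_def)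
      also have "\<dots> \<le> Q * (24 * d * N) ^ (d - 1)"
        using H by (intro mult_left_mono power_mono) (auto simp: H_def)
      finally have "real (card (cell H ` K)) \<le> real (Q * (24 * d * N) ^ (d - 1))"
        by (simp only: of_nat_le_iff)
      then show "real (card (cell H ` K)) \<le> real Q * (24 * real d * real N) ^ (d - 1)" by simp
    qed (use S in auto)
    also have "\<dots> = B * (S N / real N)"
    proof -
      have "real N ^ d = real N * real N ^ (d - 1)" using d by (cases d) auto
      then show ?thesis using N by (simp add: B_def power_mult_distrib)
    qed
    finally show ?thesis .
  qed
  have "(\<lambda>N. B * (S N / real N)) \<longlonglongrightarrow> 0"
    using mean_square_fourier_coeff_tendsto_0 unfolding S_def by (rule tendsto_mult_right_zero)
  then have "(measure M K)\<^sup>2 \<le> 0"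
  proof (rule tendsto_lowerbound)
    show "\<forall>\<^sub>F N in sequentially. (measure M K)\<^sup>2 \<le> B * (S N / real N)"
      using eventually_gt_at_top[of "0::nat"] by eventually_elim (rule bound)
  qed simp
  then have "emeasure M K = 0" by (simp add: emeasure_eq_measure)
  then show ?thesis using K by (simp add: null_sets_def K_def[symmetric])
qed

text \<open>Choose two frequencies \<open>k0\<close>, \<open>k1\<close> that differ in the \<open>i\<close>-th coordinate. Subtracting from the
  \<open>i\<close>-th partial derivative the multiple of the polynomial that cancels the frequency \<open>k1\<close> leaves a
  polynomial with fewer frequencies, nonzero because of \<open>k0\<close>. On the zero set it agrees with the
  partial derivative, so where the derivative vanishes the induction hypothesis applies, and
  elsewhere the zero set is transversal to direction \<open>i\<close>.\<close>

lemma trig_poly_zero_set_null: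
  assumes "finite F" "k0 \<in> F" "b k0 \<noteq> 0"
  shows "{p. trig_poly F b p = 0} \<in> null_sets M"
  using assms
proof (induction F arbitrary: b k0 rule: finite_psubset_induct)
  case (psubset F)
  show ?case
  proof (cases "\<exists>k1\<in>F. k1 \<noteq> k0")
    case False
    then have "F = {k0}" using psubset.prems by blast
    moreover have "torus_char k0 p \<noteq> 0" for p
      by (metis norm_torus_char norm_zero zero_neq_one)
    ultimately have "trig_poly F b p \<noteq> 0" for p
      using psubset.prems by (simp add: trig_poly_def)
    then show ?thesis by simp
  next
    case True
    then obtain k1 where k1: "k1 \<in> F" "k1 \<noteq> k0" by blast
    then obtain i where i: "k1 $ i \<noteq> k0 $ i" by (auto simp: vec_eq_iff)
    define w where "w k = 2 * pi * \<i> * of_int (k $ i - k1 $ i) * b k" for k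
    have "{p. trig_poly (F - {k1}) w p = 0} \<in> null_sets M"
      by (rule psubset.IH[of _ k0]) (use psubset.prems k1 i in \<open>auto simp: w_def\<close>)
    moreover have "(\<Union>n::nat. {p. trig_poly F b p = 0 \<and> 1 / real (Suc n) \<le> cmod (trig_poly F (deriv_coeff i b) p)}) \<in> null_sets M"
      by (intro null_sets_UN transversal_zero_set_null psubset.hyps) simp
    ultimately have null: "{p. trig_poly (F - {k1}) w p = 0} \<union>
        (\<Union>n::nat. {p. trig_poly F b p = 0 \<and> 1 / real (Suc n) \<le> cmod (trig_poly F (deriv_coeff i b) p)}) \<in> null_sets M"
      by (rule null_sets.Un)
    show ?thesis
    proof (rule null_sets_subset[OF null trig_poly_zero_set_measurable], rule subsetI)
      fix p assume "p \<in> {p. trig_poly F b p = 0}"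
      then have z: "trig_poly F b p = 0" by simp
      have "trig_poly (F - {k1}) w p = trig_poly F w p"
        unfolding trig_poly_def using psubset.hyps by (intro sum.mono_neutral_left) (auto simp: w_def)
      also have "\<dots> = trig_poly F (deriv_coeff i b) p - 2 * pi * \<i> * of_int (k1 $ i) * trig_poly F b p"
        by (simp add: trig_poly_def w_def deriv_coeff_def sum_distrib_left sum_subtractf[symmetric] algebra_simps)
      finally have w: "trig_poly (F - {k1}) w p = trig_poly F (deriv_coeff i b) p"
        using z by simp
      show "p \<in> {p. trig_poly (F - {k1}) w p = 0} \<union>
        (\<Union>n::nat. {p. trig_poly F b p = 0 \<and> 1 / real (Suc n) \<le> cmod (trig_poly F (deriv_coeff i b) p)})"
      proof (cases "trig_poly F (deriv_coeff i b) p = 0")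
        case False
        then obtain n where "inverse (real (Suc n)) < cmod (trig_poly F (deriv_coeff i b) p)"
          using reals_Archimedean[of "cmod (trig_poly F (deriv_coeff i b) p)"] by auto
        then show ?thesis using z by (auto simp: inverse_eq_divide intro: less_imp_le)
      qed (use w in simp)
    qed
  qed
qed

end

section \<open>Observability and trace inequalities\<close>

lemma finite_int_vec_ball: "finite {k :: int ^ 'n::finite. norm (int_vec k) \<le> D}"
proof (rule finite_subset)
  show "{k :: int ^ 'n. norm (int_vec k) \<le> D} \<subseteq> symm_box (nat \<lceil>D\<rceil> + 1)"
  proof
    fix k :: "int ^ 'n" assume "k \<in> {k. norm (int_vec k) \<le> D}"
    then have "real (sup_norm k) \<le> D" using sup_norm_le_norm[of k] by simp
    then have "sup_norm k < nat \<lceil>D\<rceil> + 1" by linarith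
    then show "k \<in> symm_box (nat \<lceil>D\<rceil> + 1)" by (simp only: sup_norm_less_iff)
  qed
qed (rule finite_symm_box)

lemma norm_int_vec_ge_1:
  assumes "k \<noteq> 0"
  shows "1 \<le> norm (int_vec (k :: int ^ 'n::finite))"
proof -
  obtain i where "k $ i \<noteq> 0" using assms by (auto simp: vec_eq_iff)
  then have "1 \<le> \<bar>k $ i\<bar>" by simp
  then have "sup_norm k \<ge> 1" using abs_component_le_sup_norm[of k i] by linarith
  then show ?thesis using sup_norm_le_norm[of k] by simp
qed

text \<open>Distinct lattice points are at distance at least \<open>1\<close>, so for \<open>\<rho> = 1\<close> every off-diagonal term is far.\<close>

lemma (in torus_prob) energy_le_far_sum:
  assumes "finite A"
  shows "energy M A b \<le> (\<Sum>k\<in>A. (cmod (b k))\<^sup>2) + far_sum 1 A b"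
proof -
  define g where "g k l = (if 1 \<le> norm (int_vec l - int_vec k)
      then cmod (b k) * cmod (b l) * cmod (fourier_coeff M (l - k)) else 0)" for k l :: "int ^ 'n"
  have "Re (b k * cnj (b l) * fourier_coeff M (l - k)) \<le> (if l = k then (cmod (b k))\<^sup>2 else 0) + g k l" for k l
  proof (cases "l = k")
    case True
    have "Re (b k * cnj (b k)) = (cmod (b k))\<^sup>2"
      by (metis Re_complex_of_real complex_norm_square)
    then show ?thesis using True by (simp add: fourier_coeff_0 g_def)
  next
    case False
    then have "1 \<le> norm (int_vec l - int_vec k)"
      using norm_int_vec_ge_1[of "l - k"] by (simp add: int_vec_diff)
    then show ?thesis
      using complex_Re_le_cmod[of "b k * cnj (b l) * fourier_coeff M (l - k)"] False
      by (simp add: g_def norm_mult)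
  qed
  then have "energy M A b \<le> (\<Sum>k\<in>A. \<Sum>l\<in>A. (if l = k then (cmod (b k))\<^sup>2 else 0) + g k l)"
    unfolding energy_eq_Re by (intro sum_mono)
  also have "\<dots> = (\<Sum>k\<in>A. (cmod (b k))\<^sup>2) + far_sum 1 A b"
    using assms by (simp add: sum.distrib far_sum_def g_def)
  finally show ?thesis .
qed

lemma compact_coefficient_sphere:
  assumes "finite F"
  shows "compact {b :: 'k \<Rightarrow> complex. (\<forall>k. k \<notin> F \<longrightarrow> b k = 0) \<and> (\<Sum>k\<in>F. (cmod (b k))\<^sup>2) = 1}"
proof -
  define S where "S k = (if k \<in> F then cball 0 1 else {0::complex})" for k
  have "compactin (product_topology (\<lambda>_. euclidean) UNIV) (PiE UNIV S)"
    by (auto simp: compactin_PiE S_def)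
  then have "compact (PiE UNIV S)"
    by (simp add: euclidean_product_topology)
  moreover have "closed {b :: 'k \<Rightarrow> complex. (\<Sum>k\<in>F. (cmod (b k))\<^sup>2) = 1}"
    by (intro closed_Collect_eq continuous_intros continuous_on_product_coordinates)
  ultimately have "compact (PiE UNIV S \<inter> {b. (\<Sum>k\<in>F. (cmod (b k))\<^sup>2) = 1})"
    by (rule compact_Int_closed)
  also have "PiE UNIV S \<inter> {b. (\<Sum>k\<in>F. (cmod (b k))\<^sup>2) = 1}
      = {b. (\<forall>k. k \<notin> F \<longrightarrow> b k = 0) \<and> (\<Sum>k\<in>F. (cmod (b k))\<^sup>2) = 1}"
  proof -
    have "cmod (b k) \<le> 1" if "(\<Sum>k\<in>F. (cmod (b k))\<^sup>2) = 1" "k \<in> F" for b :: "'k \<Rightarrow> complex" and k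
    proof -
      have "(cmod (b k))\<^sup>2 \<le> (\<Sum>k\<in>F. (cmod (b k))\<^sup>2)"
        using assms that(2) by (intro member_le_sum) auto
      then show ?thesis using that(1) by (simp add: power_le_one_iff)
    qed
    then show ?thesis by (auto simp: S_def PiE_def Pi_def split: if_splits)
  qed
  finally show ?thesis .
qed

context torus_decay
begin

lemma energy_pos:
  assumes "finite F" "k0 \<in> F" "b k0 \<noteq> 0"
  shows "energy M F b > 0"
proof (rule ccontr)
  assume "\<not> energy M F b > 0"
  then have "energy M F b = 0" using energy_nonneg[of M F b] by simp
  moreover have "integrable M (\<lambda>p. (cmod (trig_poly F b p))\<^sup>2)"
  proof (rule integrable_const_bound)
    show "AE p in M. norm ((cmod (trig_poly F b p))\<^sup>2) \<le> (\<Sum>k\<in>F. cmod (b k))\<^sup>2"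
    proof (rule AE_I2)
      fix p
      have "cmod (trig_poly F b p) \<le> (\<Sum>k\<in>F. cmod (b k))"
        unfolding trig_poly_def by (rule sum_norm_le) (simp add: norm_mult)
      then show "norm ((cmod (trig_poly F b p))\<^sup>2) \<le> (\<Sum>k\<in>F. cmod (b k))\<^sup>2"
        by (simp add: power_mono)
    qed
  qed measurable
  ultimately have "AE p in M. (cmod (trig_poly F b p))\<^sup>2 = 0"
    unfolding energy_def by (subst (asm) integral_nonneg_eq_0_iff_AE) auto
  then have "AE p in M. trig_poly F b p = 0" by simp
  moreover have "{p. trig_poly F b p = 0} \<in> null_sets M"
    using assms by (rule trig_poly_zero_set_null)
  then have "AE p in M. \<not> trig_poly F b p = 0"
    using AE_not_in by fastforce
  ultimately have "AE p in M. False" by eventually_elim simp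
  then show False by (simp add: AE_False)
qed

text \<open>The quadratic form is positive on the compact unit sphere of the space of coefficients.\<close>

lemma observes_finite:
  assumes F: "finite F"
  shows "\<exists>c>0. observes c F"
proof (cases "F = {}")
  case True
  then show ?thesis by (auto simp: observes_def energy_nonneg intro!: exI[of _ 1])
next
  case False
  then obtain k0 where k0: "k0 \<in> F" by blast
  define K where "K = {b :: int ^ 'n \<Rightarrow> complex. (\<forall>k. k \<notin> F \<longrightarrow> b k = 0) \<and> (\<Sum>k\<in>F. (cmod (b k))\<^sup>2) = 1}"
  have "compact K" unfolding K_def by (rule compact_coefficient_sphere[OF F])
  moreover have "(\<Sum>k\<in>F. (cmod (if k = k0 then 1 else 0))\<^sup>2) = (\<Sum>k\<in>F. if k = k0 then 1 else 0)"
    by (intro sum.cong) auto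
  then have "(\<lambda>k. if k = k0 then 1 else 0) \<in> K"
    using k0 F by (auto simp: K_def)
  then have "K \<noteq> {}" by blast
  moreover have "continuous_on K (energy M F)"
    unfolding energy_eq_Re[abs_def]
    by (intro continuous_intros continuous_on_product_coordinates continuous_on_subset[OF continuous_on_product_coordinates]) auto
  ultimately obtain b0 where b0: "b0 \<in> K" "\<And>b. b \<in> K \<Longrightarrow> energy M F b0 \<le> energy M F b"
    by (rule continuous_attains_inf[THEN bexE]) blast
  have "\<exists>k\<in>F. b0 k \<noteq> 0"
  proof (rule ccontr)
    assume "\<not> (\<exists>k\<in>F. b0 k \<noteq> 0)"
    then have "(\<Sum>k\<in>F. (cmod (b0 k))\<^sup>2) = 0" by simp
    then show False using b0(1) by (simp add: K_def)
  qed
  then have pos: "energy M F b0 > 0" using energy_pos[OF F] by blast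
  have "observes (energy M F b0) F"
    unfolding observes_def
  proof
    fix b :: "int ^ 'n \<Rightarrow> complex"
    define \<sigma> where "\<sigma> = (\<Sum>k\<in>F. (cmod (b k))\<^sup>2)"
    have \<sigma>0: "\<sigma> \<ge> 0" unfolding \<sigma>_def by (intro sum_nonneg) auto
    show "energy M F b0 * (\<Sum>k\<in>F. (cmod (b k))\<^sup>2) \<le> energy M F b"
    proof (cases "\<sigma> = 0")
      case True
      then show ?thesis by (simp add: \<sigma>_def[symmetric] energy_nonneg)
    next
      case False
      then have \<sigma>: "\<sigma> > 0" using \<sigma>0 by simp
      define b' where "b' k = (if k \<in> F then b k / of_real (sqrt \<sigma>) else 0)" for k
      have "(\<Sum>k\<in>F. (cmod (b' k))\<^sup>2) = (\<Sum>k\<in>F. (cmod (b k))\<^sup>2 / \<sigma>)"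
        using \<sigma> by (intro sum.cong refl) (simp add: b'_def norm_divide power_divide)
      also have "\<dots> = 1" using \<sigma> by (simp add: \<sigma>_def sum_divide_distrib[symmetric])
      finally have "b' \<in> K" by (simp add: K_def b'_def)
      then have "energy M F b0 \<le> energy M F b'" by (rule b0(2))
      also have "energy M F b' = energy M F b / \<sigma>"
      proof -
        have "trig_poly F b' p = trig_poly F b p / of_real (sqrt \<sigma>)" for p
          unfolding trig_poly_def sum_divide_distrib by (intro sum.cong refl) (simp add: b'_def)
        then show ?thesis
          using \<sigma> by (simp add: energy_def norm_divide power_divide)
      qed
      finally show ?thesis using \<sigma> by (simp add: \<sigma>_def[symmetric] field_simps)
    qed
  qed
  then show ?thesis using pos by blast
qed

lemma sphere_fourier_tail:
  obtains K where "K \<ge> 0"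
    "\<And>A r k J. A \<subseteq> lattice_sphere r \<Longrightarrow>
       (\<Sum>l | l \<in> A \<and> 2 ^ J \<le> norm (int_vec l - int_vec k). cmod (fourier_coeff M (l - k)))
         \<le> K * (2 powr (- \<epsilon> / 2)) ^ J"
proof -
  obtain K where K: "K \<ge> 0"
    "\<And>r (k :: int ^ 'n) (J::nat).
       (\<Sum>l | l \<in> lattice_sphere r \<and> 2 ^ J \<le> norm (int_vec l - int_vec k).
          norm (int_vec l - int_vec k) powr (- (real CARD('n) - 2 + \<epsilon>)))
         \<le> K * (2 powr (- \<epsilon> / 2)) ^ J"
  proof (rule lattice_sphere_tail_sum[OF eps, where 'n = 'n])
    show "2 \<le> CARD('n)" using dim by simp
  qed blast
  show ?thesis
  proof (rule that)
    show "\<bar>C\<bar> * K \<ge> 0" using K by simp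
    fix A :: "(int ^ 'n) set" and r and k :: "int ^ 'n" and J :: nat
    assume A: "A \<subseteq> lattice_sphere r"
    let ?w = "\<lambda>l. norm (int_vec l - int_vec k) powr (- (real CARD('n) - 2 + \<epsilon>))"
    let ?T = "{l. l \<in> lattice_sphere r \<and> 2 ^ J \<le> norm (int_vec l - int_vec k)}"
    have fin: "finite ?T" by (rule finite_subset[OF _ finite_lattice_sphere[of r]]) auto
    have "(\<Sum>l | l \<in> A \<and> 2 ^ J \<le> norm (int_vec l - int_vec k). cmod (fourier_coeff M (l - k)))
        \<le> (\<Sum>l\<in>?T. cmod (fourier_coeff M (l - k)))"
      using A fin by (intro sum_mono2) auto
    also have "\<dots> \<le> (\<Sum>l\<in>?T. \<bar>C\<bar> * ?w l)"
    proof (rule sum_mono)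
      fix l assume l: "l \<in> ?T"
      have "(0::real) < 2 ^ J" by simp
      also have "\<dots> \<le> norm (int_vec l - int_vec k)" using l by simp
      finally have "l - k \<noteq> 0" by auto
      from decay[OF this] have "cmod (fourier_coeff M (l - k)) \<le> C * ?w l"
        by (simp add: int_vec_diff)
      also have "\<dots> \<le> \<bar>C\<bar> * ?w l" by (intro mult_right_mono) auto
      finally show "cmod (fourier_coeff M (l - k)) \<le> \<bar>C\<bar> * ?w l" .
    qed
    also have "\<dots> = \<bar>C\<bar> * (\<Sum>l\<in>?T. ?w l)" by (simp add: sum_distrib_left)
    also have "\<dots> \<le> \<bar>C\<bar> * (K * (2 powr (- \<epsilon> / 2)) ^ J)"
      by (intro mult_left_mono K(2)) auto
    finally show "(\<Sum>l | l \<in> A \<and> 2 ^ J \<le> norm (int_vec l - int_vec k). cmod (fourier_coeff M (l - k)))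
        \<le> \<bar>C\<bar> * K * (2 powr (- \<epsilon> / 2)) ^ J" by simp
  qed
qed

definition differences :: "(int ^ 'n) set \<Rightarrow> (real ^ 'n) set" where
  "differences A = {int_vec x - int_vec y |x y. x \<in> A \<and> y \<in> A}"

text \<open>In the induction step, \<open>J\<close> makes the far terms cost at most half of \<open>c\<close>. If some cluster spans as
  many dimensions as the whole of \<open>A\<close>, its subspace contains all differences of \<open>A\<close>, and so \<open>A\<close>
  lies in a ball of radius \<open>D\<close>; otherwise the induction hypothesis covers every cluster.\<close>

lemma observes_of_small_dim:
  "\<exists>c>0. \<forall>A r. A \<subseteq> lattice_sphere r \<and> dim (differences A) \<le> j \<longrightarrow> observes c A"
proof (induction j)
  case 0
  show ?case
  proof (intro exI[of _ 1] conjI allI impI)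
    fix A r assume A: "A \<subseteq> lattice_sphere r \<and> dim (differences A) \<le> 0"
    have eq: "x = y" if "x \<in> A" "y \<in> A" for x y
    proof -
      have "int_vec x - int_vec y \<in> differences A" using that by (auto simp: differences_def)
      moreover have "differences A \<subseteq> {0}" using A dim_eq_0[of "differences A"] by simp
      ultimately have "int_vec (x - y) = 0" by (auto simp: int_vec_diff)
      then show ?thesis using norm_int_vec_ge_1[of "x - y"] by auto
    qed
    have "observes 1 {k}" for k
      by (simp add: observes_def energy_def trig_poly_def norm_mult prob_space)
    moreover have "observes 1 {}" by (simp add: observes_def energy_nonneg)
    moreover have "A = {} \<or> (\<exists>k. A = {k})" using eq by blast
    ultimately show "observes 1 A" by auto
  qed simp
next
  case (Suc j)
  then obtain c where c: "c > 0" and IH: "\<forall>A r. A \<subseteq> lattice_sphere r \<and> dim (differences A) \<le> j \<longrightarrow> observes c A"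
    by (elim exE conjE)
  obtain K where K: "K \<ge> 0" and tail: "\<And>A r k J. A \<subseteq> lattice_sphere r \<Longrightarrow>
       (\<Sum>l | l \<in> A \<and> 2 ^ J \<le> norm (int_vec l - int_vec k). cmod (fourier_coeff M (l - k)))
         \<le> K * (2 powr (- \<epsilon> / 2)) ^ J"
    by (rule sphere_fourier_tail) blast
  have "(\<lambda>J. K * (2 powr (- \<epsilon> / 2)) ^ J) \<longlonglongrightarrow> 0"
    using eps by (intro tendsto_mult_right_zero LIMSEQ_realpow_zero) (auto simp: powr_less_one)
  then have "eventually (\<lambda>J. K * (2 powr (- \<epsilon> / 2)) ^ J < c / 2) sequentially"
    using c by (intro order_tendstoD(2)) auto
  then obtain J where J: "K * (2 powr (- \<epsilon> / 2)) ^ J < c / 2"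
    using eventually_happens' sequentially_bot by blast
  define \<rho> :: real where "\<rho> = 2 ^ J"
  define V where "V = int_vec ` {m :: int ^ 'n. norm (int_vec m) \<le> \<rho>}"
  have "finite V" by (simp add: V_def finite_int_vec_ball)
  obtain D where D: "\<forall>A r k0. (\<forall>x\<in>A. norm x = r) \<and> k0 \<in> A \<longrightarrow>
    (\<exists>W. subspace W \<and> W \<subseteq> span {x - y |x y. x \<in> A \<and> y \<in> A} \<and>
       (\<forall>x\<in>A. \<forall>y\<in>A. x - k0 \<in> W \<and> y - x \<in> V \<longrightarrow> y - x \<in> W) \<and>
       (\<forall>y. norm y = r \<and> y - k0 \<in> W \<longrightarrow> norm (y - k0) \<le> D))"
    using sphere_cluster_bound[OF \<open>finite V\<close>] by (elim exE)
  define F where "F = {m :: int ^ 'n. norm (int_vec m) \<le> D}"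
  obtain cF where cF: "cF > 0" "observes cF F"
    using observes_finite[of F] finite_int_vec_ball unfolding F_def by blast
  show ?case
  proof (intro exI[of _ "min (c / 2) cF"] conjI allI impI)
    show "min (c / 2) cF > 0" using c cF by simp
    fix A r assume A: "A \<subseteq> lattice_sphere r \<and> dim (differences A) \<le> Suc j"
    have finA: "finite A" using A finite_lattice_sphere finite_subset by blast
    have diffs: "{x - y |x y. x \<in> int_vec ` A \<and> y \<in> int_vec ` A} = differences A"
      by (auto simp: differences_def)
    show "observes (min (c / 2) cF) A"
    proof (cases "\<exists>k0\<in>A. \<forall>k\<in>A. norm (int_vec k - int_vec k0) \<le> D")
      case True
      then obtain k0 where k0: "\<forall>k\<in>A. norm (int_vec k - int_vec k0) \<le> D" by blast
      have "A \<subseteq> (+) k0 ` F"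
      proof
        fix k assume "k \<in> A"
        then have "k - k0 \<in> F" using k0 by (simp add: F_def int_vec_diff)
        then show "k \<in> (+) k0 ` F" by (intro image_eqI[of _ _ "k - k0"]) auto
      qed
      moreover have "finite ((+) k0 ` F)" by (simp add: F_def finite_int_vec_ball)
      ultimately have "observes cF A"
        using observes_subset[OF observes_translate[OF cF(2)]] by blast
      then show ?thesis by (rule observes_mono) simp
    next
      case False
      have clusters: "\<exists>B. k0 \<in> B \<and> B \<subseteq> A \<and> observes c B \<and>
           (\<forall>x\<in>B. \<forall>y\<in>A - B. \<rho> \<le> norm (int_vec y - int_vec x))" if k0: "k0 \<in> A" for k0
      proof -
        have "(\<forall>x\<in>int_vec ` A. norm x = r) \<and> int_vec k0 \<in> int_vec ` A"
          using A k0 by (auto simp: lattice_sphere_def)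
        from D[rule_format, OF this] obtain W where W: "subspace W" "W \<subseteq> span (differences A)"
          and closed: "\<forall>x\<in>int_vec ` A. \<forall>y\<in>int_vec ` A. x - int_vec k0 \<in> W \<and> y - x \<in> V \<longrightarrow> y - x \<in> W"
          and small: "\<forall>y. norm y = r \<and> y - int_vec k0 \<in> W \<longrightarrow> norm (y - int_vec k0) \<le> D"
          unfolding diffs by (elim exE conjE)
        define B where "B = {k \<in> A. int_vec k - int_vec k0 \<in> W}"
        have "B \<subseteq> A" by (auto simp: B_def)
        have "k0 \<in> B" using k0 W(1) by (simp add: B_def subspace_0)
        have iso: "\<rho> \<le> norm (int_vec y - int_vec x)" if "x \<in> B" "y \<in> A - B" for x y
        proof (rule ccontr)
          assume "\<not> \<rho> \<le> norm (int_vec y - int_vec x)"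
          then have "int_vec y - int_vec x \<in> V"
            unfolding V_def by (intro image_eqI[of _ _ "y - x"]) (auto simp: int_vec_diff)
          then have "int_vec y - int_vec x \<in> W" using closed that by (auto simp: B_def)
          then have "(int_vec y - int_vec x) + (int_vec x - int_vec k0) \<in> W"
            using that W(1) by (intro subspace_add) (auto simp: B_def)
          then show False using that by (simp add: B_def)
        qed
        have "dim W \<le> j"
        proof (rule ccontr)
          assume "\<not> dim W \<le> j"
          then have "dim (span (differences A)) \<le> dim W" using A by simp
          then have "W = span (differences A)"
            using W by (intro subspace_dim_equal) auto
          then have "int_vec k - int_vec k0 \<in> W" if "k \<in> A" for k
            using that k0 by (auto simp: differences_def intro!: span_base)
          then have "norm (int_vec k - int_vec k0) \<le> D" if "k \<in> A" for k
            using small A that by (auto simp: lattice_sphere_def)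
          then show False using False k0 by blast
        qed
        moreover have "dim (differences B) \<le> dim W"
        proof (rule dim_subset)
          show "differences B \<subseteq> W"
          proof
            fix v assume "v \<in> differences B"
            then obtain x y where v: "v = int_vec x - int_vec y" "x \<in> B" "y \<in> B"
              by (auto simp: differences_def)
            then have "(int_vec x - int_vec k0) - (int_vec y - int_vec k0) \<in> W"
              using subspace_diff[OF W(1), of "int_vec x - int_vec k0" "int_vec y - int_vec k0"]
              by (simp add: B_def)
            then show "v \<in> W" by (simp add: v)
          qed
        qed
        ultimately have "observes c B"
          using IH A \<open>B \<subseteq> A\<close> by (meson order_trans)
        then show ?thesis using \<open>B \<subseteq> A\<close> \<open>k0 \<in> B\<close> iso by blast
      qed
      have "observes (c / 2) A"
        unfolding observes_def
      proof
        fix b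
        define \<sigma> where "\<sigma> = (\<Sum>k\<in>A. (cmod (b k))\<^sup>2)"
        have "far_sum \<rho> A b \<le> c / 2 * \<sigma>"
          unfolding \<sigma>_def
        proof (rule far_sum_le[OF finA])
          fix k
          show "(\<Sum>l | l \<in> A \<and> \<rho> \<le> norm (int_vec l - int_vec k). cmod (fourier_coeff M (l - k))) \<le> c / 2"
            using tail[of A r k J] A J unfolding \<rho>_def by linarith
        qed
        moreover have "c * \<sigma> - far_sum \<rho> A b \<le> energy M A b"
          unfolding \<sigma>_def by (rule energy_ge_of_isolated_clusters[OF finA clusters])
        ultimately have "c / 2 * \<sigma> \<le> energy M A b" by simp
        then show "c / 2 * (\<Sum>k\<in>A. (cmod (b k))\<^sup>2) \<le> energy M A b" by (simp only: \<sigma>_def)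
      qed
      then show ?thesis by (rule observes_mono) simp
    qed
  qed
qed

lemma eigenspace_trig_poly:
  assumes "u \<in> eigenspace r"
  obtains b where "u = trig_poly (lattice_sphere r) b"
  using assms by (auto simp: eigenspace_def trig_poly_def[abs_def])

lemma observability: "observability_inequality M"
proof -
  obtain c where c: "c > 0" and obs: "\<forall>A r. A \<subseteq> lattice_sphere r \<and> dim (differences A) \<le> DIM(real ^ 'n) \<longrightarrow> observes c A"
    using observes_of_small_dim[of "DIM(real ^ 'n)"] by (elim exE conjE)
  show ?thesis
    unfolding observability_inequality_def
  proof (intro exI[of _ "1 / c"] ballI)
    fix u :: "'n torus \<Rightarrow> complex" assume "u \<in> (\<Union>r\<in>sqrt_nats. eigenspace r)"
    then obtain r where "u \<in> eigenspace r" by blast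
    then obtain b where u: "u = trig_poly (lattice_sphere r) b" by (rule eigenspace_trig_poly)
    have "observes c (lattice_sphere r)" using obs dim_subset_UNIV by blast
    then have "c * energy torus_lebesgue (lattice_sphere r) b \<le> energy M (lattice_sphere r) b"
      by (simp add: observes_def energy_torus_lebesgue finite_lattice_sphere)
    then show "(\<integral>x. (cmod (u x))\<^sup>2 \<partial>torus_lebesgue) \<le> 1 / c * (\<integral>x. (cmod (u x))\<^sup>2 \<partial>M)"
      using c by (simp add: u energy_def[symmetric] field_simps)
  qed
qed

lemma trace: "trace_inequality M"
proof -
  obtain K where K: "\<And>A r k J. A \<subseteq> lattice_sphere r \<Longrightarrow>
       (\<Sum>l | l \<in> A \<and> 2 ^ J \<le> norm (int_vec l - int_vec k). cmod (fourier_coeff M (l - k)))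
         \<le> K * (2 powr (- \<epsilon> / 2)) ^ J"
    by (rule sphere_fourier_tail) blast
  show ?thesis
    unfolding trace_inequality_def
  proof (intro exI[of _ "1 + K"] ballI)
    fix u :: "'n torus \<Rightarrow> complex" assume "u \<in> (\<Union>r\<in>sqrt_nats. eigenspace r)"
    then obtain r where "u \<in> eigenspace r" by blast
    then obtain b where u: "u = trig_poly (lattice_sphere r) b" by (rule eigenspace_trig_poly)
    define S where "S = (lattice_sphere r :: (int ^ 'n) set)"
    have S: "finite S" by (simp add: S_def finite_lattice_sphere)
    have "far_sum 1 S b \<le> K * (\<Sum>k\<in>S. (cmod (b k))\<^sup>2)"
    proof (rule far_sum_le[OF S])
      fix k
      show "(\<Sum>l | l \<in> S \<and> 1 \<le> norm (int_vec l - int_vec k). cmod (fourier_coeff M (l - k))) \<le> K"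
        using K[of S r k 0] by (simp add: S_def)
    qed
    then have "energy M S b \<le> (1 + K) * energy torus_lebesgue S b"
      using energy_le_far_sum[OF S, of b] by (simp add: energy_torus_lebesgue[OF S] distrib_right)
    then show "(\<integral>x. (cmod (u x))\<^sup>2 \<partial>M) \<le> (1 + K) * (\<integral>x. (cmod (u x))\<^sup>2 \<partial>torus_lebesgue)"
      by (simp add: u energy_def S_def)
  qed
qed

end

theorem theorem7p1:
  fixes M :: "('n::finite) torus measure" and \<epsilon> C :: real
  assumes "CARD('n) \<ge> 3"
    and "prob_space M" and "sets M = sets borel"
    and "\<epsilon> > 0"
    and "\<And>k :: int ^ 'n. k \<noteq> 0 \<Longrightarrow>
           cmod (fourier_coeff M k) \<le> C * norm (int_vec k) powr (- (real CARD('n) - 2 + \<epsilon>))"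
  shows "observability_inequality M \<and> trace_inequality M"
proof -
  interpret torus_decay M \<epsilon> C
    using assms by (simp add: torus_decay_def torus_prob_def torus_prob_axioms_def torus_decay_axioms_def)
  show ?thesis using observability trace by blast
qed

end
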